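(* Let $R$ be a commutative noetherian ring, $M$ an $R$-complex and $\mathfrak p\in\mathrm{Spec}R$. (1) $\mathfrak{p}\in\mathrm{coSupp}_R M$ if and only if $\mathfrak{p}\in\mathrm{Supp}_R D_R(M)$. (2) If $\mathfrak{p}\in\mathrm{Supp}_R M$, then $\mathfrak{p}\in\mathrm{coSupp}_R D_R(M)$. The converse holds when $M\in\mathrm{D}^{\mathrm{n}}(R)$, i.e. when each $\mathrm{H}_i(M)$ is a noetherian $R$-module.
   Context: $R$ is a commutative noetherian ring, not necessarily local. $R$-complexes are arbitrary (unbounded) chain complexes; $\simeq$ denotes isomorphism in the derived category $\mathrm{D}(R)$. $E(R/\mathfrak{p})$ is the injective envelope of $R/\mathfrak{p}$, and $k(\mathfrak p)=R_\mathfrak p/\mathfrak pR_\mathfrak p$. Put $D_R(-)=\mathrm{Hom}_R(-,\bigoplus_{\mathfrak{m}\in\mathrm{Max}R}E(R/\mathfrak{m}))$. For an $R$-complex $M$ and $\mathfrak{p}\in\mathrm{Spec}R$, the co-localization of $M$ at $\mathfrak p$ is the $R_\mathfrak p$-complex ${}^{\mathfrak{p}}M=\mathrm{Hom}_{R_\mathfrak{p}}(D_R(M)_\mathfrak{p},E_{R_\mathfrak{p}}(k(\mathfrak{p})))$. The big support is $\mathrm{Supp}_R M=\{\mathfrak{p}\in\mathrm{Spec}R\mid M_\mathfrak{p}\not\simeq 0\}$ and the big cosupport is $\mathrm{coSupp}_R M=\{\mathfrak{p}\in\mathrm{Spec}R \mid {}^{\mathfrak{p}}M\not\simeq 0\}$.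 *)

theory Defs
  imports "HOL-Algebra.Module" "HOL-Algebra.Ring_Divisibility"
begin

section \<open>Modules\<close>

text \<open>
  In a module record the inherited fields \<^const>\<open>mult\<close> and \<^const>\<open>one\<close> carry no meaning; they are
  left \<^const>\<open>undefined\<close> in the constructions below.
\<close>

definition mod_hom ::
    "('r, 'z) ring_scheme \<Rightarrow> ('r, 'm) module \<Rightarrow> ('r, 'n) module \<Rightarrow> ('m \<Rightarrow> 'n) set" where
  "mod_hom R M N = {f \<in> carrier M \<rightarrow> carrier N.
     (\<forall>x \<in> carrier M. \<forall>y \<in> carrier M. f (x \<oplus>\<^bsub>M\<^esub> y) = f x \<oplus>\<^bsub>N\<^esub> f y) \<and>
     (\<forall>r \<in> carrier R. \<forall>x \<in> carrier M. f (r \<odot>\<^bsub>M\<^esub> x) = r \<odot>\<^bsub>N\<^esub> f x)}"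

definition self_mod :: "('r, 'z) ring_scheme \<Rightarrow> ('r, 'r) module" where
  "self_mod R = \<lparr>carrier = carrier R, mult = undefined, one = undefined,
     zero = \<zero>\<^bsub>R\<^esub>, add = add R, smult = mult R\<rparr>"

definition zero_mod :: "('r, unit) module" where
  "zero_mod = \<lparr>carrier = {()}, mult = undefined, one = undefined,
     zero = (), add = (\<lambda>_ _. ()), smult = (\<lambda>_ _. ())\<rparr>"

definition quot_mod :: "('r, 'm) module \<Rightarrow> 'm set \<Rightarrow> ('r, 'm set) module" where
  "quot_mod M N = \<lparr>carrier = a_rcosets\<^bsub>M\<^esub> N, mult = undefined, one = undefined,
     zero = N, add = set_add M, smult = (\<lambda>r X. \<Union>x\<in>X. N +>\<^bsub>M\<^esub> (r \<odot>\<^bsub>M\<^esub> x))\<rparr>"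

text \<open>
  The elements of \<open>Hom(M, N)\<close> are the linear maps that are \<^const>\<open>undefined\<close> off \<^term>\<open>carrier M\<close>, so
  that two of them are equal as soon as they agree on \<^term>\<open>carrier M\<close>.
\<close>

definition hom_mod ::
    "('r, 'z) ring_scheme \<Rightarrow> ('r, 'm) module \<Rightarrow> ('r, 'n) module \<Rightarrow> ('r, 'm \<Rightarrow> 'n) module" where
  "hom_mod R M N = \<lparr>carrier = mod_hom R M N \<inter> extensional (carrier M),
     mult = undefined, one = undefined,
     zero = (\<lambda>x\<in>carrier M. \<zero>\<^bsub>N\<^esub>),
     add = (\<lambda>f g. \<lambda>x\<in>carrier M. f x \<oplus>\<^bsub>N\<^esub> g x),
     smult = (\<lambda>r f. \<lambda>x\<in>carrier M. r \<odot>\<^bsub>N\<^esub> f x)\<rparr>"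

definition direct_sum_mod :: "'i set \<Rightarrow> ('i \<Rightarrow> ('r, 'm) module) \<Rightarrow> ('r, 'i \<Rightarrow> 'm) module" where
  "direct_sum_mod I M = \<lparr>
     carrier = {x \<in> \<Pi>\<^sub>E i\<in>I. carrier (M i). finite {i \<in> I. x i \<noteq> \<zero>\<^bsub>M i\<^esub>}},
     mult = undefined, one = undefined,
     zero = (\<lambda>i\<in>I. \<zero>\<^bsub>M i\<^esub>),
     add = (\<lambda>x y. \<lambda>i\<in>I. x i \<oplus>\<^bsub>M i\<^esub> y i),
     smult = (\<lambda>r x. \<lambda>i\<in>I. r \<odot>\<^bsub>M i\<^esub> x i)\<rparr>"

definition generated_submod :: "('r, 'z) ring_scheme \<Rightarrow> ('r, 'm) module \<Rightarrow> 'm set \<Rightarrow> 'm set" where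
  "generated_submod R M A = \<Inter>{N. submodule N R M \<and> A \<subseteq> N}"

definition noetherian_mod :: "('r, 'z) ring_scheme \<Rightarrow> ('r, 'm) module \<Rightarrow> bool" where
  "noetherian_mod R M \<longleftrightarrow> module R M \<and>
     (\<forall>N. submodule N R M \<longrightarrow> (\<exists>A\<subseteq>N. finite A \<and> N = generated_submod R M A))"

text \<open>
  A definition cannot quantify over all types, so the test modules \<open>A\<close>, \<open>B\<close> have their elements in
  \<^typ>\<open>'r + 'e\<close>. This is no restriction: that type contains copies of \<open>R\<close> and of its ideals, and by
  Baer's criterion these test modules already detect injectivity against modules over any type.
\<close>

definition injective_mod :: "('r, 'z) ring_scheme \<Rightarrow> ('r, 'e) module \<Rightarrow> bool" where
  "injective_mod R E \<longleftrightarrow> module R E \<and>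
     (\<forall>(A :: ('r, 'r + 'e) module) (B :: ('r, 'r + 'e) module) i f.
        module R A \<and> module R B \<and> i \<in> mod_hom R A B \<and> inj_on i (carrier A) \<and> f \<in> mod_hom R A E
        \<longrightarrow> (\<exists>g \<in> mod_hom R B E. \<forall>a \<in> carrier A. g (i a) = f a))"

definition injective_envelope ::
    "('r, 'z) ring_scheme \<Rightarrow> ('r, 'm) module \<Rightarrow> ('r, 'e) module \<Rightarrow> bool" where
  "injective_envelope R N E \<longleftrightarrow> injective_mod R E \<and>
     (\<exists>i \<in> mod_hom R N E. inj_on i (carrier N) \<and>
        (\<forall>U. submodule U R E \<and> U \<noteq> {\<zero>\<^bsub>E\<^esub>} \<longrightarrow> U \<inter> i ` carrier N \<noteq> {\<zero>\<^bsub>E\<^esub>}))"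


section \<open>Localization at a prime ideal\<close>

text \<open>
  A fraction \<open>m/s\<close> is the class of the pair \<open>(m, s)\<close>, and \<open>m/s = n/t\<close> iff \<open>u(tm) = u(sn)\<close> for
  some \<open>u\<close> outside \<open>p\<close>.
\<close>

definition frac_rel ::
    "('r, 'z) ring_scheme \<Rightarrow> 'r set \<Rightarrow> ('r, 'm) module \<Rightarrow> (('m \<times> 'r) \<times> ('m \<times> 'r)) set" where
  "frac_rel R p M = {((m, s), (n, t)).
     m \<in> carrier M \<and> n \<in> carrier M \<and> s \<in> carrier R - p \<and> t \<in> carrier R - p \<and>
     (\<exists>u \<in> carrier R - p. u \<odot>\<^bsub>M\<^esub> (t \<odot>\<^bsub>M\<^esub> m) = u \<odot>\<^bsub>M\<^esub> (s \<odot>\<^bsub>M\<^esub> n))}"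

definition fraction ::
    "('r, 'z) ring_scheme \<Rightarrow> 'r set \<Rightarrow> ('r, 'm) module \<Rightarrow> 'm \<Rightarrow> 'r \<Rightarrow> ('m \<times> 'r) set" where
  "fraction R p M m s = frac_rel R p M `` {(m, s)}"

definition loc_mod ::
    "('r, 'z) ring_scheme \<Rightarrow> 'r set \<Rightarrow> ('r, 'm) module \<Rightarrow> (('r \<times> 'r) set, ('m \<times> 'r) set) module" where
  "loc_mod R p M = \<lparr>
     carrier = (carrier M \<times> (carrier R - p)) // frac_rel R p M,
     mult = undefined, one = undefined,
     zero = fraction R p M \<zero>\<^bsub>M\<^esub> \<one>\<^bsub>R\<^esub>,
     add = (\<lambda>X Y. \<Union>(m, s)\<in>X. \<Union>(n, t)\<in>Y.
              fraction R p M ((t \<odot>\<^bsub>M\<^esub> m) \<oplus>\<^bsub>M\<^esub> (s \<odot>\<^bsub>M\<^esub> n)) (s \<otimes>\<^bsub>R\<^esub> t)),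
     smult = (\<lambda>A X. \<Union>(a, s)\<in>A. \<Union>(m, t)\<in>X. fraction R p M (a \<odot>\<^bsub>M\<^esub> m) (s \<otimes>\<^bsub>R\<^esub> t))\<rparr>"

definition loc_ring :: "('r, 'z) ring_scheme \<Rightarrow> 'r set \<Rightarrow> ('r \<times> 'r) set ring" where
  "loc_ring R p = (let L = loc_mod R p (self_mod R) in
     \<lparr>carrier = carrier L, mult = smult L, one = fraction R p (self_mod R) \<one>\<^bsub>R\<^esub> \<one>\<^bsub>R\<^esub>,
      zero = \<zero>\<^bsub>L\<^esub>, add = add L\<rparr>)"

definition loc_map ::
    "('r, 'z) ring_scheme \<Rightarrow> 'r set \<Rightarrow> ('r, 'n) module \<Rightarrow> ('m \<Rightarrow> 'n) \<Rightarrow> ('m \<times> 'r) set \<Rightarrow> ('n \<times> 'r) set"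
  where
  "loc_map R p N f X = (\<Union>(m, s)\<in>X. fraction R p N (f m) s)"

text \<open>The ideal \<open>pR\<^sub>p\<close> and the residue field \<open>k(p) = R\<^sub>p/pR\<^sub>p\<close>, the latter as an \<open>R\<^sub>p\<close>-module.\<close>

definition loc_ideal :: "('r, 'z) ring_scheme \<Rightarrow> 'r set \<Rightarrow> ('r \<times> 'r) set set" where
  "loc_ideal R p = genideal (loc_ring R p) ((\<lambda>a. fraction R p (self_mod R) a \<one>\<^bsub>R\<^esub>) ` p)"

definition residue_mod ::
    "('r, 'z) ring_scheme \<Rightarrow> 'r set \<Rightarrow> (('r \<times> 'r) set, ('r \<times> 'r) set set) module" where
  "residue_mod R p = quot_mod (self_mod (loc_ring R p)) (loc_ideal R p)"


section \<open>Complexes and the derived category\<close>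

text \<open>Complexes are graded homologically: \<^term>\<open>bd X n\<close> maps degree \<open>n\<close> to degree \<open>n - 1\<close>.\<close>

record ('r, 'm) cplx =
  obj :: "int \<Rightarrow> ('r, 'm) module"
  bd :: "int \<Rightarrow> 'm \<Rightarrow> 'm"

definition is_complex :: "('r, 'z) ring_scheme \<Rightarrow> ('r, 'm) cplx \<Rightarrow> bool" where
  "is_complex R X \<longleftrightarrow> (\<forall>n. module R (obj X n) \<and>
     bd X n \<in> mod_hom R (obj X n) (obj X (n - 1)) \<and>
     (\<forall>x \<in> carrier (obj X n). bd X (n - 1) (bd X n x) = \<zero>\<^bsub>obj X (n - 1 - 1)\<^esub>))"

definition zero_complex :: "('r, unit) cplx" where
  "zero_complex = \<lparr>obj = (\<lambda>_. zero_mod), bd = (\<lambda>_ _. ())\<rparr>"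

definition cycles :: "('r, 'm) cplx \<Rightarrow> int \<Rightarrow> 'm set" where
  "cycles X n = {x \<in> carrier (obj X n). bd X n x = \<zero>\<^bsub>obj X (n - 1)\<^esub>}"

definition boundaries :: "('r, 'm) cplx \<Rightarrow> int \<Rightarrow> 'm set" where
  "boundaries X n = bd X (n + 1) ` carrier (obj X (n + 1))"

definition homology :: "('r, 'm) cplx \<Rightarrow> int \<Rightarrow> ('r, 'm set) module" where
  "homology X n = quot_mod ((obj X n)\<lparr>carrier := cycles X n\<rparr>) (boundaries X n)"

definition is_chain_map ::
    "('r, 'z) ring_scheme \<Rightarrow> ('r, 'm) cplx \<Rightarrow> ('r, 'n) cplx \<Rightarrow> (int \<Rightarrow> 'm \<Rightarrow> 'n) \<Rightarrow> bool" where
  "is_chain_map R X Y f \<longleftrightarrow> (\<forall>n. f n \<in> mod_hom R (obj X n) (obj Y n) \<and>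
     (\<forall>x \<in> carrier (obj X n). f (n - 1) (bd X n x) = bd Y n (f n x)))"

definition homology_map ::
    "('r, 'n) cplx \<Rightarrow> (int \<Rightarrow> 'm \<Rightarrow> 'n) \<Rightarrow> int \<Rightarrow> 'm set \<Rightarrow> 'n set" where
  "homology_map Y f n C = (\<Union>x\<in>C. boundaries Y n +>\<^bsub>obj Y n\<^esub> f n x)"

definition quasi_iso ::
    "('r, 'z) ring_scheme \<Rightarrow> ('r, 'm) cplx \<Rightarrow> ('r, 'n) cplx \<Rightarrow> (int \<Rightarrow> 'm \<Rightarrow> 'n) \<Rightarrow> bool" where
  "quasi_iso R X Y f \<longleftrightarrow> is_chain_map R X Y f \<and>
     (\<forall>n. bij_betw (homology_map Y f n) (carrier (homology X n)) (carrier (homology Y n)))"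

text \<open>
  Isomorphism in \<open>D(R)\<close>: a roof \<open>X \<leftarrow> Z \<rightarrow> Y\<close> of quasi-isomorphisms. The type of the elements of \<open>Z\<close>
  has cardinality at least those of \<open>'r\<close>, \<open>'m\<close> and the natural numbers, so it has room for a semi-free
  resolution of \<open>X\<close>; hence restricting \<open>Z\<close> to this type loses no isomorphisms.
\<close>

definition derived_iso ::
    "('r, 'z) ring_scheme \<Rightarrow> ('r, 'm) cplx \<Rightarrow> ('r, 'n) cplx \<Rightarrow> bool" where
  "derived_iso R X Y \<longleftrightarrow> (\<exists>(Z :: ('r, (nat \<times> 'r \<times> 'm \<times> 'n) list) cplx) f g.
     is_complex R Z \<and> quasi_iso R Z X f \<and> quasi_iso R Z Y g)"

definition loc_complex ::
    "('r, 'z) ring_scheme \<Rightarrow> 'r set \<Rightarrow> ('r, 'm) cplx \<Rightarrow> (('r \<times> 'r) set, ('m \<times> 'r) set) cplx" where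
  "loc_complex R p X = \<lparr>obj = (\<lambda>n. loc_mod R p (obj X n)),
     bd = (\<lambda>n. loc_map R p (obj X (n - 1)) (bd X n))\<rparr>"

text \<open>
  The complex \<open>Hom(X, I)\<close> for a module \<open>I\<close>, regarded as a complex in degree \<open>0\<close>. Its component of
  degree \<open>n\<close> is \<open>Hom(X\<^bsub>-n\<^esub>, I)\<close>, and the general differential \<open>\<partial>(f) = \<partial>\<^sup>I f - (-1)\<^bsup>|f|\<^esup> f \<partial>\<^sup>X\<close> of a Hom
  complex reduces to \<open>\<partial>(f) = - (-1)\<^sup>n f \<partial>\<^sup>X\<close>.
\<close>

definition hom_complex ::
    "('r, 'z) ring_scheme \<Rightarrow> ('r, 'm) cplx \<Rightarrow> ('r, 'e) module \<Rightarrow> ('r, 'm \<Rightarrow> 'e) cplx" where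
  "hom_complex R X I = \<lparr>
     obj = (\<lambda>n. hom_mod R (obj X (- n)) I),
     bd = (\<lambda>n f. \<lambda>x\<in>carrier (obj X (1 - n)).
             if even n then \<ominus>\<^bsub>I\<^esub> f (bd X (1 - n) x) else f (bd X (1 - n) x))\<rparr>"


section \<open>Support and cosupport\<close>

text \<open>
  Injective envelopes are unique only up to isomorphism and enter as parameters: \<open>E m\<close> is a chosen
  envelope of \<open>R/m\<close> over \<open>R\<close>, and \<open>F p\<close> is a chosen envelope of \<open>k(p)\<close> over \<open>R\<^sub>p\<close>.
\<close>

definition big_Supp :: "('r, 'z) ring_scheme \<Rightarrow> ('r, 'm) cplx \<Rightarrow> 'r set set" where
  "big_Supp R M = {p. primeideal p R \<and>
     \<not> derived_iso (loc_ring R p) (loc_complex R p M) zero_complex}"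

definition matlis_dual ::
    "('r, 'z) ring_scheme \<Rightarrow> ('r set \<Rightarrow> ('r, 'e) module) \<Rightarrow> ('r, 'm) cplx
      \<Rightarrow> ('r, 'm \<Rightarrow> 'r set \<Rightarrow> 'e) cplx" where
  "matlis_dual R E M = hom_complex R M (direct_sum_mod {m. maximalideal m R} E)"

definition colocalization ::
    "('r, 'z) ring_scheme \<Rightarrow> ('r set \<Rightarrow> ('r, 'e) module)
      \<Rightarrow> ('r set \<Rightarrow> (('r \<times> 'r) set, 'f) module) \<Rightarrow> 'r set \<Rightarrow> ('r, 'm) cplx
      \<Rightarrow> (('r \<times> 'r) set, (('m \<Rightarrow> 'r set \<Rightarrow> 'e) \<times> 'r) set \<Rightarrow> 'f) cplx" where
  "colocalization R E F p M = hom_complex (loc_ring R p) (loc_complex R p (matlis_dual R E M)) (F p)"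

definition big_coSupp ::
    "('r, 'z) ring_scheme \<Rightarrow> ('r set \<Rightarrow> ('r, 'e) module)
      \<Rightarrow> ('r set \<Rightarrow> (('r \<times> 'r) set, 'f) module) \<Rightarrow> ('r, 'm) cplx \<Rightarrow> 'r set set" where
  "big_coSupp R E F M = {p. primeideal p R \<and>
     \<not> derived_iso (loc_ring R p) (colocalization R E F p M) zero_complex}"

end

theory Submission
  imports Defs
begin

text \<open>
  Everything is expressed on the level of cycles and boundaries. A complex is isomorphic to \<open>0\<close> in the
  derived category iff it is exact (\<open>derived_iso_zero_iff_exact\<close>), and \<open>X\<^sub>p\<close> is exact iff every
  cycle \<open>z\<close> of \<open>X\<close> has a multiple \<open>s z\<close>, with \<open>s\<close> outside \<open>p\<close>, that is a boundary
  (\<open>exact_loc_complex_iff\<close>). So (co)support is a question about annihilators of homology, and no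
  resolutions are involved.

  The other ingredient is that \<open>E(k(p))\<close> over \<open>R\<^sub>p\<close> and \<open>I = \<Oplus>\<^sub>m E(R/m)\<close> over \<open>R\<close> are injective
  cogenerators. Injectivity is used in the form of Baer's criterion, from which Zorn's lemma gives the
  extension of partial linear maps on modules of arbitrary type (\<open>extend_linear_graph\<close>). For the
  direct sum this is where \<open>R\<close> has to be noetherian: ideals are finitely generated, so a map from an
  ideal meets only finitely many summands (\<open>baer_injective_direct_sum\<close>). The cogenerator property
  holds because every proper ideal lies in a maximal ideal \<open>m\<close>, which kills the image of \<open>1\<close> in the
  envelope of \<open>R/m\<close>; over \<open>R\<^sub>p\<close> the only maximal ideal is \<open>pR\<^sub>p\<close> (\<open>loc_ideal_largest\<close>).

  For an injective cogenerator, a complex \<open>X\<close> is exact iff \<open>Hom(X, I)\<close> is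
  (\<open>exact_hom_complex_iff\<close>). Applied over \<open>R\<^sub>p\<close> to \<open>D(M)\<^sub>p\<close> and \<open>E(k(p))\<close> this identifies the
  cosupport of \<open>M\<close> with the support of \<open>D(M)\<close>. It remains to compare the supports of \<open>M\<close> and of
  \<open>D(D(M))\<close>. The evaluation map embeds \<open>H(M)\<close> into \<open>H(D(D(M)))\<close>
  (\<open>double_dual_evaluation\<close>), so that local vanishing passes from \<open>D(D(M))\<close> to \<open>M\<close>.
  Conversely, if \<open>H\<^sub>n(M)\<^sub>p = 0\<close> and \<open>H\<^sub>n(M)\<close> is noetherian, hence finitely generated, then one
  single \<open>s\<close> outside \<open>p\<close> kills all of \<open>H\<^sub>n(M)\<close> (\<open>noetherian_uniform_annihilator\<close>); dualizing twice
  preserves annihilators (\<open>hom_complex_annihilator\<close>), so \<open>s\<close> kills \<open>H\<^sub>n(D(D(M)))\<close> as well. For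
  infinitely generated homology no such common \<open>s\<close> need exist.
\<close>

section \<open>Linear maps and modules of linear maps\<close>

lemma mod_homI:
  assumes "\<And>x. x \<in> carrier M \<Longrightarrow> f x \<in> carrier N"
    and "\<And>x y. x \<in> carrier M \<Longrightarrow> y \<in> carrier M \<Longrightarrow> f (x \<oplus>\<^bsub>M\<^esub> y) = f x \<oplus>\<^bsub>N\<^esub> f y"
    and "\<And>r x. r \<in> carrier R \<Longrightarrow> x \<in> carrier M \<Longrightarrow> f (r \<odot>\<^bsub>M\<^esub> x) = r \<odot>\<^bsub>N\<^esub> f x"
  shows "f \<in> mod_hom R M N"
  using assms unfolding mod_hom_def by auto

lemma mod_homD:
  assumes "f \<in> mod_hom R M N"
  shows "x \<in> carrier M \<Longrightarrow> f x \<in> carrier N"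
    and "x \<in> carrier M \<Longrightarrow> y \<in> carrier M \<Longrightarrow> f (x \<oplus>\<^bsub>M\<^esub> y) = f x \<oplus>\<^bsub>N\<^esub> f y"
    and "r \<in> carrier R \<Longrightarrow> x \<in> carrier M \<Longrightarrow> f (r \<odot>\<^bsub>M\<^esub> x) = r \<odot>\<^bsub>N\<^esub> f x"
  using assms unfolding mod_hom_def by auto

lemma mod_hom_zero:
  assumes "module R M" "module R N" "f \<in> mod_hom R M N"
  shows "f \<zero>\<^bsub>M\<^esub> = \<zero>\<^bsub>N\<^esub>"
proof -
  interpret M: module R M by fact
  interpret N: module R N by fact
  have "f (\<zero>\<^bsub>R\<^esub> \<odot>\<^bsub>M\<^esub> \<zero>\<^bsub>M\<^esub>) = \<zero>\<^bsub>R\<^esub> \<odot>\<^bsub>N\<^esub> f \<zero>\<^bsub>M\<^esub>"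
    using mod_homD(3)[OF assms(3)] by blast
  then show ?thesis using mod_homD(1)[OF assms(3)] by simp
qed

lemma mod_hom_const_zero:
  assumes "module R N"
  shows "(\<lambda>x. \<zero>\<^bsub>N\<^esub>) \<in> mod_hom R M N"
proof -
  interpret N: module R N by fact
  show ?thesis by (intro mod_homI) auto
qed

lemma mod_hom_add:
  assumes "module R N" "f \<in> mod_hom R M N" "g \<in> mod_hom R M N"
  shows "(\<lambda>x. f x \<oplus>\<^bsub>N\<^esub> g x) \<in> mod_hom R M N"
proof -
  interpret N: module R N by fact
  show ?thesis
    using mod_homD[OF assms(2)] mod_homD[OF assms(3)]
    by (intro mod_homI) (auto simp: N.a_ac N.smult_r_distr)
qed

lemma mod_hom_smult:
  assumes "module R N" "f \<in> mod_hom R M N" "r \<in> carrier R"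
  shows "(\<lambda>x. r \<odot>\<^bsub>N\<^esub> f x) \<in> mod_hom R M N"
proof -
  interpret N: module R N by fact
  show ?thesis
    using mod_homD[OF assms(2)] assms(3)
    by (intro mod_homI)
      (auto simp: N.smult_r_distr N.smult_assoc1[symmetric] N.R.m_comm)
qed

lemma mod_hom_minus:
  assumes "module R N" "f \<in> mod_hom R M N"
  shows "(\<lambda>x. \<ominus>\<^bsub>N\<^esub> f x) \<in> mod_hom R M N"
proof -
  interpret N: module R N by fact
  show ?thesis
    using mod_homD[OF assms(2)]
    by (intro mod_homI) (auto simp: N.minus_add N.smult_r_minus)
qed

lemma mod_hom_comp:
  assumes "f \<in> mod_hom R M N" "g \<in> mod_hom R N P"
  shows "(\<lambda>x. g (f x)) \<in> mod_hom R M P"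
  by (rule mod_homI) (simp_all add: mod_homD[OF assms(1)] mod_homD[OF assms(2)])

lemma mod_hom_restrict:
  assumes "module R M" "f \<in> mod_hom R M N"
  shows "(\<lambda>x\<in>carrier M. f x) \<in> mod_hom R M N"
proof -
  interpret M: module R M by fact
  show ?thesis using mod_homD[OF assms(2)] by (intro mod_homI) auto
qed

lemma hom_mod_sel [simp]:
  "carrier (hom_mod R M N) = mod_hom R M N \<inter> extensional (carrier M)"
  "\<zero>\<^bsub>hom_mod R M N\<^esub> = (\<lambda>x\<in>carrier M. \<zero>\<^bsub>N\<^esub>)"
  "f \<oplus>\<^bsub>hom_mod R M N\<^esub> g = (\<lambda>x\<in>carrier M. f x \<oplus>\<^bsub>N\<^esub> g x)"
  "r \<odot>\<^bsub>hom_mod R M N\<^esub> f = (\<lambda>x\<in>carrier M. r \<odot>\<^bsub>N\<^esub> f x)"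
  by (simp_all add: hom_mod_def)

lemma hom_mod_module:
  assumes "module R M" "module R N"
  shows "module R (hom_mod R M N)"
proof -
  interpret M: module R M by fact
  interpret N: module R N by fact
  note D = mod_homD(1)
  note ex = extensionalityI[of _ "carrier M"]
  show ?thesis
  proof (rule moduleI[OF M.is_cring])
    show "abelian_group (hom_mod R M N)"
    proof (rule abelian_groupI)
      fix f assume f: "f \<in> carrier (hom_mod R M N)"
      show "\<exists>g\<in>carrier (hom_mod R M N). g \<oplus>\<^bsub>hom_mod R M N\<^esub> f = \<zero>\<^bsub>hom_mod R M N\<^esub>"
      proof (rule bexI)
        show "(\<lambda>x\<in>carrier M. \<ominus>\<^bsub>N\<^esub> f x) \<in> carrier (hom_mod R M N)"
          using f mod_hom_restrict[OF assms(1) mod_hom_minus[OF assms(2), of f M]] by simp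
        show "(\<lambda>x\<in>carrier M. \<ominus>\<^bsub>N\<^esub> f x) \<oplus>\<^bsub>hom_mod R M N\<^esub> f = \<zero>\<^bsub>hom_mod R M N\<^esub>"
          using f by (auto simp: N.M.l_neg D intro!: restrict_ext)
      qed
    next
      fix f g h
      assume f: "f \<in> carrier (hom_mod R M N)" and g: "g \<in> carrier (hom_mod R M N)"
        and h: "h \<in> carrier (hom_mod R M N)"
      show "f \<oplus>\<^bsub>hom_mod R M N\<^esub> g \<oplus>\<^bsub>hom_mod R M N\<^esub> h
          = f \<oplus>\<^bsub>hom_mod R M N\<^esub> (g \<oplus>\<^bsub>hom_mod R M N\<^esub> h)"
        using f g h by (auto simp: D N.a_assoc intro!: restrict_ext)
    next
      fix f g
      assume f: "f \<in> carrier (hom_mod R M N)" and g: "g \<in> carrier (hom_mod R M N)"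
      show "f \<oplus>\<^bsub>hom_mod R M N\<^esub> g = g \<oplus>\<^bsub>hom_mod R M N\<^esub> f"
        using f g by (auto simp: D N.a_comm intro!: restrict_ext)
      show "f \<oplus>\<^bsub>hom_mod R M N\<^esub> g \<in> carrier (hom_mod R M N)"
        using f g mod_hom_restrict[OF assms(1) mod_hom_add[OF assms(2), of f M g]] by auto
    next
      show "\<zero>\<^bsub>hom_mod R M N\<^esub> \<in> carrier (hom_mod R M N)"
        using mod_hom_restrict[OF assms(1) mod_hom_const_zero[OF assms(2)]] by auto
    next
      fix f assume f: "f \<in> carrier (hom_mod R M N)"
      show "\<zero>\<^bsub>hom_mod R M N\<^esub> \<oplus>\<^bsub>hom_mod R M N\<^esub> f = f"
        using f by (intro ex) (auto simp: D)
    qed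
  next
    fix a f assume "a \<in> carrier R" "f \<in> carrier (hom_mod R M N)"
    then show "a \<odot>\<^bsub>hom_mod R M N\<^esub> f \<in> carrier (hom_mod R M N)"
      using mod_hom_restrict[OF assms(1) mod_hom_smult[OF assms(2), of f M a]] by auto
  next
    fix a b f assume "a \<in> carrier R" "b \<in> carrier R" "f \<in> carrier (hom_mod R M N)"
    then show "(a \<oplus>\<^bsub>R\<^esub> b) \<odot>\<^bsub>hom_mod R M N\<^esub> f
        = a \<odot>\<^bsub>hom_mod R M N\<^esub> f \<oplus>\<^bsub>hom_mod R M N\<^esub> b \<odot>\<^bsub>hom_mod R M N\<^esub> f"
      by (auto simp: D N.smult_l_distr intro!: restrict_ext)
  next
    fix a f g
    assume "a \<in> carrier R" "f \<in> carrier (hom_mod R M N)" "g \<in> carrier (hom_mod R M N)"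
    then show "a \<odot>\<^bsub>hom_mod R M N\<^esub> (f \<oplus>\<^bsub>hom_mod R M N\<^esub> g)
        = a \<odot>\<^bsub>hom_mod R M N\<^esub> f \<oplus>\<^bsub>hom_mod R M N\<^esub> a \<odot>\<^bsub>hom_mod R M N\<^esub> g"
      by (auto simp: D N.smult_r_distr intro!: restrict_ext)
  next
    fix a b f assume "a \<in> carrier R" "b \<in> carrier R" "f \<in> carrier (hom_mod R M N)"
    then show "a \<otimes>\<^bsub>R\<^esub> b \<odot>\<^bsub>hom_mod R M N\<^esub> f
        = a \<odot>\<^bsub>hom_mod R M N\<^esub> (b \<odot>\<^bsub>hom_mod R M N\<^esub> f)"
      by (auto simp: D N.smult_assoc1 intro!: restrict_ext)
  next
    fix f assume "f \<in> carrier (hom_mod R M N)"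
    then show "\<one>\<^bsub>R\<^esub> \<odot>\<^bsub>hom_mod R M N\<^esub> f = f"
      by (intro ex) (auto simp: D)
  qed
qed

lemma self_mod_sel [simp]:
  "carrier (self_mod R) = carrier R" "\<zero>\<^bsub>self_mod R\<^esub> = \<zero>\<^bsub>R\<^esub>"
  "r \<oplus>\<^bsub>self_mod R\<^esub> s = r \<oplus>\<^bsub>R\<^esub> s" "r \<odot>\<^bsub>self_mod R\<^esub> s = r \<otimes>\<^bsub>R\<^esub> s"
  by (simp_all add: self_mod_def)

lemma self_mod_module:
  assumes "cring R"
  shows "module R (self_mod R)"
proof -
  interpret cring R by fact
  show ?thesis
  proof (rule moduleI[OF assms abelian_groupI])
    fix x assume "x \<in> carrier (self_mod R)"
    then show "\<exists>y\<in>carrier (self_mod R). y \<oplus>\<^bsub>self_mod R\<^esub> x = \<zero>\<^bsub>self_mod R\<^esub>"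
      by (intro bexI[of _ "\<ominus>\<^bsub>R\<^esub> x"]) (simp_all add: l_neg)
  qed (simp_all add: a_ac m_assoc l_distr r_distr)
qed


section \<open>Injective modules: Baer's criterion and extension of partial maps\<close>

definition baer_injective :: "('r, 'z) ring_scheme \<Rightarrow> ('r, 'e) module \<Rightarrow> bool" where
  "baer_injective R E \<longleftrightarrow> module R E \<and>
     (\<forall>J h. ideal J R \<and> h \<in> mod_hom R ((self_mod R)\<lparr>carrier := J\<rparr>) E
        \<longrightarrow> (\<exists>e \<in> carrier E. \<forall>r \<in> J. h r = r \<odot>\<^bsub>E\<^esub> e))"

text \<open>
  A partial linear map from \<open>M\<close> to \<open>I\<close>, encoded as a submodule of \<open>M \<times> I\<close>. Graphs make unions of
  chains and the adjunction of one further element immediate; single-valuedness only has to be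
  required over zero.
\<close>

definition linear_graph ::
    "('r, 'z) ring_scheme \<Rightarrow> ('r, 'm) module \<Rightarrow> ('r, 'e) module \<Rightarrow> ('m \<times> 'e) set \<Rightarrow> bool" where
  "linear_graph R M I G \<longleftrightarrow> G \<subseteq> carrier M \<times> carrier I \<and> (\<zero>\<^bsub>M\<^esub>, \<zero>\<^bsub>I\<^esub>) \<in> G \<and>
     (\<forall>x a y b. (x, a) \<in> G \<and> (y, b) \<in> G \<longrightarrow> (x \<oplus>\<^bsub>M\<^esub> y, a \<oplus>\<^bsub>I\<^esub> b) \<in> G) \<and>
     (\<forall>r \<in> carrier R. \<forall>x a. (x, a) \<in> G \<longrightarrow> (r \<odot>\<^bsub>M\<^esub> x, r \<odot>\<^bsub>I\<^esub> a) \<in> G) \<and>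
     (\<forall>a. (\<zero>\<^bsub>M\<^esub>, a) \<in> G \<longrightarrow> a = \<zero>\<^bsub>I\<^esub>)"

lemma linear_graphI:
  assumes "\<And>x a. (x, a) \<in> G \<Longrightarrow> x \<in> carrier M \<and> a \<in> carrier I"
    and "(\<zero>\<^bsub>M\<^esub>, \<zero>\<^bsub>I\<^esub>) \<in> G"
    and "\<And>x a y b. (x, a) \<in> G \<Longrightarrow> (y, b) \<in> G \<Longrightarrow> (x \<oplus>\<^bsub>M\<^esub> y, a \<oplus>\<^bsub>I\<^esub> b) \<in> G"
    and "\<And>r x a. r \<in> carrier R \<Longrightarrow> (x, a) \<in> G \<Longrightarrow> (r \<odot>\<^bsub>M\<^esub> x, r \<odot>\<^bsub>I\<^esub> a) \<in> G"
    and "\<And>a. (\<zero>\<^bsub>M\<^esub>, a) \<in> G \<Longrightarrow> a = \<zero>\<^bsub>I\<^esub>"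
  shows "linear_graph R M I G"
  unfolding linear_graph_def
proof (intro conjI ballI allI impI)
  show "G \<subseteq> carrier M \<times> carrier I" using assms(1) by auto
qed (use assms(2-) in blast)+

lemma linear_graphD:
  assumes "linear_graph R M I G"
  shows "(x, a) \<in> G \<Longrightarrow> x \<in> carrier M" and "(x, a) \<in> G \<Longrightarrow> a \<in> carrier I"
    and "(\<zero>\<^bsub>M\<^esub>, \<zero>\<^bsub>I\<^esub>) \<in> G"
    and "(x, a) \<in> G \<Longrightarrow> (y, b) \<in> G \<Longrightarrow> (x \<oplus>\<^bsub>M\<^esub> y, a \<oplus>\<^bsub>I\<^esub> b) \<in> G"
    and "r \<in> carrier R \<Longrightarrow> (x, a) \<in> G \<Longrightarrow> (r \<odot>\<^bsub>M\<^esub> x, r \<odot>\<^bsub>I\<^esub> a) \<in> G"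
    and "(\<zero>\<^bsub>M\<^esub>, a) \<in> G \<Longrightarrow> a = \<zero>\<^bsub>I\<^esub>"
  using assms unfolding linear_graph_def by blast+

lemma (in module) minus_eq_smult:
  "x \<in> carrier M \<Longrightarrow> (\<ominus> \<one>) \<odot>\<^bsub>M\<^esub> x = \<ominus>\<^bsub>M\<^esub> x"
  by (simp add: smult_l_minus)

lemma linear_graph_single_valued:
  assumes "module R M" "module R I" "linear_graph R M I G" "(x, a) \<in> G" "(x, b) \<in> G"
  shows "a = b"
proof -
  interpret M: module R M by fact
  interpret I: module R I by fact
  note G = linear_graphD[OF assms(3)]
  have x: "x \<in> carrier M" and a: "a \<in> carrier I" and b: "b \<in> carrier I"
    using G(1,2) assms(4,5) by blast+
  have "(x \<oplus>\<^bsub>M\<^esub> (\<ominus>\<^bsub>R\<^esub> \<one>\<^bsub>R\<^esub>) \<odot>\<^bsub>M\<^esub> x, a \<oplus>\<^bsub>I\<^esub> (\<ominus>\<^bsub>R\<^esub> \<one>\<^bsub>R\<^esub>) \<odot>\<^bsub>I\<^esub> b) \<in> G"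
    using G(4)[OF assms(4) G(5)[OF _ assms(5), of "\<ominus>\<^bsub>R\<^esub> \<one>\<^bsub>R\<^esub>"]] by simp
  then have "a \<oplus>\<^bsub>I\<^esub> \<ominus>\<^bsub>I\<^esub> b = \<zero>\<^bsub>I\<^esub>"
    using G(6) x a b by (simp add: M.minus_eq_smult I.minus_eq_smult M.M.r_neg)
  then show ?thesis using a b by (metis I.M.minus_equality I.M.minus_minus I.M.a_inv_closed)
qed

text \<open>
  A graph is adjoined the element \<open>x\<close> by prescribing a value \<open>e\<close> at \<open>x\<close> that agrees with the values
  which the graph already assigns to multiples of \<open>x\<close>.
\<close>

lemma linear_graph_adjoin:
  assumes "module R M" "module R I" "linear_graph R M I G"
    and x: "x \<in> carrier M" and e: "e \<in> carrier I"
    and compat: "\<And>r a. r \<in> carrier R \<Longrightarrow> (r \<odot>\<^bsub>M\<^esub> x, a) \<in> G \<Longrightarrow> a = r \<odot>\<^bsub>I\<^esub> e"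
  shows "linear_graph R M I
    {(d \<oplus>\<^bsub>M\<^esub> r \<odot>\<^bsub>M\<^esub> x, a \<oplus>\<^bsub>I\<^esub> r \<odot>\<^bsub>I\<^esub> e) | d a r. (d, a) \<in> G \<and> r \<in> carrier R}"
    (is "linear_graph R M I ?H")
proof -
  interpret M: module R M by fact
  interpret I: module R I by fact
  note G = linear_graphD[OF assms(3)]
  have H: "(d \<oplus>\<^bsub>M\<^esub> r \<odot>\<^bsub>M\<^esub> x, a \<oplus>\<^bsub>I\<^esub> r \<odot>\<^bsub>I\<^esub> e) \<in> ?H" if "(d, a) \<in> G" "r \<in> carrier R" for d a r
    using that by blast
  show ?thesis
  proof (rule linear_graphI)
    fix y b assume "(y, b) \<in> ?H"
    then show "y \<in> carrier M \<and> b \<in> carrier I" using G(1,2) x e by auto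
  next
    show "(\<zero>\<^bsub>M\<^esub>, \<zero>\<^bsub>I\<^esub>) \<in> ?H" using H[OF G(3), of "\<zero>\<^bsub>R\<^esub>"] x e by simp
  next
    fix y b z c assume "(y, b) \<in> ?H" "(z, c) \<in> ?H"
    then obtain d a r d' a' r' where *:
        "(d, a) \<in> G" "r \<in> carrier R" "y = d \<oplus>\<^bsub>M\<^esub> r \<odot>\<^bsub>M\<^esub> x" "b = a \<oplus>\<^bsub>I\<^esub> r \<odot>\<^bsub>I\<^esub> e"
        "(d', a') \<in> G" "r' \<in> carrier R" "z = d' \<oplus>\<^bsub>M\<^esub> r' \<odot>\<^bsub>M\<^esub> x" "c = a' \<oplus>\<^bsub>I\<^esub> r' \<odot>\<^bsub>I\<^esub> e"
      by blast
    have "y \<oplus>\<^bsub>M\<^esub> z = (d \<oplus>\<^bsub>M\<^esub> d') \<oplus>\<^bsub>M\<^esub> (r \<oplus>\<^bsub>R\<^esub> r') \<odot>\<^bsub>M\<^esub> x"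
      "b \<oplus>\<^bsub>I\<^esub> c = (a \<oplus>\<^bsub>I\<^esub> a') \<oplus>\<^bsub>I\<^esub> (r \<oplus>\<^bsub>R\<^esub> r') \<odot>\<^bsub>I\<^esub> e"
      using * x e G(1)[OF *(1)] G(1)[OF *(5)] G(2)[OF *(1)] G(2)[OF *(5)]
      by (simp_all add: M.M.a_ac I.M.a_ac M.smult_l_distr I.smult_l_distr)
    then show "(y \<oplus>\<^bsub>M\<^esub> z, b \<oplus>\<^bsub>I\<^esub> c) \<in> ?H"
      using H[OF G(4)[OF *(1,5)], of "r \<oplus>\<^bsub>R\<^esub> r'"] *(2,6) by simp
  next
    fix s y b assume s: "s \<in> carrier R" and "(y, b) \<in> ?H"
    then obtain d a r where *:
        "(d, a) \<in> G" "r \<in> carrier R" "y = d \<oplus>\<^bsub>M\<^esub> r \<odot>\<^bsub>M\<^esub> x" "b = a \<oplus>\<^bsub>I\<^esub> r \<odot>\<^bsub>I\<^esub> e"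
      by blast
    have "s \<odot>\<^bsub>M\<^esub> y = s \<odot>\<^bsub>M\<^esub> d \<oplus>\<^bsub>M\<^esub> (s \<otimes>\<^bsub>R\<^esub> r) \<odot>\<^bsub>M\<^esub> x"
      "s \<odot>\<^bsub>I\<^esub> b = s \<odot>\<^bsub>I\<^esub> a \<oplus>\<^bsub>I\<^esub> (s \<otimes>\<^bsub>R\<^esub> r) \<odot>\<^bsub>I\<^esub> e"
      using * x e s G(1)[OF *(1)] G(2)[OF *(1)]
      by (simp_all add: M.smult_r_distr I.smult_r_distr M.smult_assoc1 I.smult_assoc1)
    then show "(s \<odot>\<^bsub>M\<^esub> y, s \<odot>\<^bsub>I\<^esub> b) \<in> ?H"
      using H[OF G(5)[OF s *(1)], of "s \<otimes>\<^bsub>R\<^esub> r"] *(2) s by simp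
  next
    fix b assume "(\<zero>\<^bsub>M\<^esub>, b) \<in> ?H"
    then obtain d a r where *:
        "(d, a) \<in> G" "r \<in> carrier R" "\<zero>\<^bsub>M\<^esub> = d \<oplus>\<^bsub>M\<^esub> r \<odot>\<^bsub>M\<^esub> x" "b = a \<oplus>\<^bsub>I\<^esub> r \<odot>\<^bsub>I\<^esub> e"
      by blast
    have cl: "d \<in> carrier M" "a \<in> carrier I" using G(1,2) *(1) by blast+
    have "\<ominus>\<^bsub>M\<^esub> d = r \<odot>\<^bsub>M\<^esub> x"
      using M.M.minus_equality[of "r \<odot>\<^bsub>M\<^esub> x" d] *(2,3) x cl by (simp add: M.M.a_comm)
    moreover have "(\<ominus>\<^bsub>M\<^esub> d, \<ominus>\<^bsub>I\<^esub> a) \<in> G"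
      using G(5)[OF _ *(1), of "\<ominus>\<^bsub>R\<^esub> \<one>\<^bsub>R\<^esub>"] cl by (simp add: M.minus_eq_smult I.minus_eq_smult)
    ultimately have "r \<odot>\<^bsub>I\<^esub> e = \<ominus>\<^bsub>I\<^esub> a" using compat[OF *(2), of "\<ominus>\<^bsub>I\<^esub> a"] by simp
    then show "b = \<zero>\<^bsub>I\<^esub>" using *(4) cl by (simp add: I.M.r_neg)
  qed
qed

text \<open>
  Baer's argument: the values of a graph on the multiples of \<open>x\<close> form a linear map on the ideal of
  those \<open>r\<close> for which \<open>r x\<close> lies in the domain, and a single \<open>e\<close> induces this map.
\<close>

lemma baer_value:
  assumes "module R M" "baer_injective R I" "linear_graph R M I G" and x: "x \<in> carrier M"
  shows "\<exists>e \<in> carrier I. \<forall>r \<in> carrier R. \<forall>a. (r \<odot>\<^bsub>M\<^esub> x, a) \<in> G \<longrightarrow> a = r \<odot>\<^bsub>I\<^esub> e"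
proof -
  interpret M: module R M by fact
  interpret I: module R I using assms(2) unfolding baer_injective_def by blast
  note G = linear_graphD[OF assms(3)]
  note sv = linear_graph_single_valued[OF assms(1) I.module_axioms assms(3)]
  define J where "J = {r \<in> carrier R. \<exists>a. (r \<odot>\<^bsub>M\<^esub> x, a) \<in> G}"
  define h where "h r = (THE a. (r \<odot>\<^bsub>M\<^esub> x, a) \<in> G)" for r
  have h_eq: "h r = a" if "(r \<odot>\<^bsub>M\<^esub> x, a) \<in> G" for r a
    unfolding h_def using that sv by blast
  have hG: "(r \<odot>\<^bsub>M\<^esub> x, h r) \<in> G" if "r \<in> J" for r
    using that h_eq unfolding J_def by fastforce
  have add: "((r \<oplus>\<^bsub>R\<^esub> s) \<odot>\<^bsub>M\<^esub> x, h r \<oplus>\<^bsub>I\<^esub> h s) \<in> G" if "r \<in> J" "s \<in> J" for r s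
    using G(4)[OF hG hG, OF that] that x by (simp add: J_def M.smult_l_distr)
  have smult: "((s \<otimes>\<^bsub>R\<^esub> r) \<odot>\<^bsub>M\<^esub> x, s \<odot>\<^bsub>I\<^esub> h r) \<in> G" if "s \<in> carrier R" "r \<in> J" for r s
    using G(5)[OF that(1) hG[OF that(2)]] that x by (simp add: J_def M.smult_assoc1)
  have Jc: "J \<subseteq> carrier R" unfolding J_def by blast
  have Jm: "s \<otimes>\<^bsub>R\<^esub> r \<in> J" if "s \<in> carrier R" "r \<in> J" for r s
    using smult[OF that] that Jc unfolding J_def by blast
  have "ideal J R"
  proof (rule idealI[OF M.R.ring_axioms])
    show "subgroup J (add_monoid R)"
    proof (rule M.R.add.subgroupI)
      have "\<zero>\<^bsub>R\<^esub> \<in> J" using G(3) x unfolding J_def by auto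
      then show "J \<noteq> {}" by blast
      show "\<ominus>\<^bsub>R\<^esub> r \<in> J" if "r \<in> J" for r
        using Jm[OF _ that, of "\<ominus>\<^bsub>R\<^esub> \<one>\<^bsub>R\<^esub>"] that Jc M.R.l_minus[of "\<one>\<^bsub>R\<^esub>" r] by auto
      show "r \<oplus>\<^bsub>R\<^esub> s \<in> J" if "r \<in> J" "s \<in> J" for r s
        using add[OF that] that Jc unfolding J_def by blast
    qed (rule Jc)
    show "s \<otimes>\<^bsub>R\<^esub> r \<in> J" if "r \<in> J" "s \<in> carrier R" for r s using Jm that by blast
    show "r \<otimes>\<^bsub>R\<^esub> s \<in> J" if "r \<in> J" "s \<in> carrier R" for r s
      using Jm[OF that(2,1)] that Jc M.R.m_comm[of r s] by auto
  qed
  moreover have "h \<in> mod_hom R ((self_mod R)\<lparr>carrier := J\<rparr>) I"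
    using G(2)[OF hG] h_eq[OF add] h_eq[OF smult] by (intro mod_homI) (auto simp: self_mod_def)
  ultimately obtain e where e: "e \<in> carrier I" "\<forall>r\<in>J. h r = r \<odot>\<^bsub>I\<^esub> e"
    using assms(2) unfolding baer_injective_def by blast
  show ?thesis
  proof (intro bexI[OF _ e(1)] ballI allI impI)
    fix r a assume "r \<in> carrier R" and ra: "(r \<odot>\<^bsub>M\<^esub> x, a) \<in> G"
    then have "r \<in> J" unfolding J_def by blast
    then show "a = r \<odot>\<^bsub>I\<^esub> e" using e(2) h_eq[OF ra] by simp
  qed
qed

text \<open>
  By Zorn's lemma a partial linear map into a Baer-injective module has a maximal extension, which is
  defined everywhere since otherwise another element could be adjoined. The source \<open>M\<close> may have
  elements of any type.
\<close>

lemma extend_linear_graph: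
  assumes "module R M" "baer_injective R I" "linear_graph R M I G"
  shows "\<exists>g \<in> mod_hom R M I. \<forall>(x, a) \<in> G. g x = a"
proof -
  interpret M: module R M by fact
  interpret I: module R I using assms(2) unfolding baer_injective_def by blast
  let ?A = "{H. linear_graph R M I H \<and> G \<subseteq> H}"
  have "\<exists>H\<in>?A. \<forall>X\<in>?A. H \<subseteq> X \<longrightarrow> X = H"
  proof (rule subset_Zorn_nonempty)
    show "?A \<noteq> {}" using assms(3) by blast
    fix C assume "C \<noteq> {}" and C: "subset.chain ?A C"
    then obtain H0 where H0: "H0 \<in> C" by blast
    have lg: "linear_graph R M I H" if "H \<in> C" for H
      using C that unfolding subset_chain_def by blast
    have "linear_graph R M I (\<Union>C)"
    proof (rule linear_graphI)
      fix x a y b assume "(x, a) \<in> \<Union>C" "(y, b) \<in> \<Union>C"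
      then obtain H where "H \<in> C" "(x, a) \<in> H" "(y, b) \<in> H"
        using C unfolding subset_chain_def by blast
      then show "(x \<oplus>\<^bsub>M\<^esub> y, a \<oplus>\<^bsub>I\<^esub> b) \<in> \<Union>C" using linear_graphD(4)[OF lg] by blast
    next
      show "(\<zero>\<^bsub>M\<^esub>, \<zero>\<^bsub>I\<^esub>) \<in> \<Union>C" using linear_graphD(3)[OF lg[OF H0]] H0 by blast
    next
      fix x a assume "(x, a) \<in> \<Union>C"
      then show "x \<in> carrier M \<and> a \<in> carrier I" using linear_graphD(1,2)[OF lg] by blast
    next
      fix r x a assume "r \<in> carrier R" "(x, a) \<in> \<Union>C"
      then show "(r \<odot>\<^bsub>M\<^esub> x, r \<odot>\<^bsub>I\<^esub> a) \<in> \<Union>C" using linear_graphD(5)[OF lg] by blast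
    next
      fix a assume "(\<zero>\<^bsub>M\<^esub>, a) \<in> \<Union>C"
      then show "a = \<zero>\<^bsub>I\<^esub>" using linear_graphD(6)[OF lg] by blast
    qed
    then show "\<Union>C \<in> ?A" using C H0 unfolding subset_chain_def by blast
  qed
  then obtain H where "H \<in> ?A" and maxA: "\<forall>X\<in>?A. H \<subseteq> X \<longrightarrow> X = H" by (rule bexE)
  then have H: "linear_graph R M I H" "G \<subseteq> H" by simp_all
  have max: "X = H" if "linear_graph R M I X" "H \<subseteq> X" for X
    using maxA that H(2) by simp
  note HD = linear_graphD[OF H(1)]
  note sv = linear_graph_single_valued[OF assms(1) I.module_axioms H(1)]
  have total: "\<exists>a. (x, a) \<in> H" if x: "x \<in> carrier M" for x
  proof -
    obtain e where e: "e \<in> carrier I"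
      and compat: "\<forall>r \<in> carrier R. \<forall>a. (r \<odot>\<^bsub>M\<^esub> x, a) \<in> H \<longrightarrow> a = r \<odot>\<^bsub>I\<^esub> e"
      using baer_value[OF assms(1,2) H(1) x] by (rule bexE)
    let ?H = "{(d \<oplus>\<^bsub>M\<^esub> r \<odot>\<^bsub>M\<^esub> x, a \<oplus>\<^bsub>I\<^esub> r \<odot>\<^bsub>I\<^esub> e) | d a r. (d, a) \<in> H \<and> r \<in> carrier R}"
    have mem: "(d \<oplus>\<^bsub>M\<^esub> r \<odot>\<^bsub>M\<^esub> x, a \<oplus>\<^bsub>I\<^esub> r \<odot>\<^bsub>I\<^esub> e) \<in> ?H"
      if "(d, a) \<in> H" "r \<in> carrier R" for d a r
      using that by blast
    have "(d, a) \<in> ?H" if "(d, a) \<in> H" for d a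
      using mem[OF that, of "\<zero>\<^bsub>R\<^esub>"] HD(1,2)[OF that] x e by simp
    then have "H \<subseteq> ?H" by (intro subrelI)
    then have "?H = H"
      using compat by (intro max linear_graph_adjoin[OF assms(1) I.module_axioms H(1) x e]) simp_all
    moreover have "(x, e) \<in> ?H"
      using mem[OF HD(3), of "\<one>\<^bsub>R\<^esub>"] x e by simp
    ultimately show ?thesis by blast
  qed
  define g where "g x = (THE a. (x, a) \<in> H)" for x
  have g_eq: "g x = a" if "(x, a) \<in> H" for x a
    unfolding g_def using that sv by blast
  have gH: "(x, g x) \<in> H" if "x \<in> carrier M" for x
    using total[OF that] g_eq by fastforce
  have "g \<in> mod_hom R M I"
    using HD(2)[OF gH] g_eq[OF HD(4)[OF gH gH]] g_eq[OF HD(5)[OF _ gH]]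
    by (intro mod_homI) auto
  moreover have "\<forall>(x, a) \<in> G. g x = a" using g_eq H(2) by auto
  ultimately show ?thesis by blast
qed

lemma (in module) module_minus_zero: "\<ominus>\<^bsub>M\<^esub> \<zero>\<^bsub>M\<^esub> = \<zero>\<^bsub>M\<^esub>"
  using minus_eq_smult[of "\<zero>\<^bsub>M\<^esub>"] by simp

lemma ideal_subset: "ideal J R \<Longrightarrow> J \<subseteq> carrier R"
  by (simp add: ideal.axioms(1) additive_subgroup.a_subset)

text \<open>
  The ideal \<open>J\<close> as a module whose elements have the type over which the test modules of
  \<^const>\<open>injective_mod\<close> range.
\<close>

definition test_mod :: "('r, 'z) ring_scheme \<Rightarrow> 'r set \<Rightarrow> ('r, 'r + 'e) module" where
  "test_mod R J = \<lparr>carrier = Inl ` J, mult = undefined, one = undefined, zero = Inl \<zero>\<^bsub>R\<^esub>,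
     add = (\<lambda>x y. Inl (projl x \<oplus>\<^bsub>R\<^esub> projl y)), smult = (\<lambda>r x. Inl (r \<otimes>\<^bsub>R\<^esub> projl x))\<rparr>"

lemma test_mod_module:
  assumes "cring R" "ideal J R"
  shows "module R (test_mod R J)"
proof -
  interpret cring R by fact
  interpret J: ideal J R by fact
  note J = ideal_subset[OF assms(2), THEN subsetD]
  show ?thesis
  proof (rule moduleI[OF assms(1) abelian_groupI])
    fix x assume "x \<in> carrier (test_mod R J)"
    then obtain j where j: "j \<in> J" "x = Inl j" by (auto simp: test_mod_def)
    show "\<exists>y\<in>carrier (test_mod R J). y \<oplus>\<^bsub>test_mod R J\<^esub> x = \<zero>\<^bsub>test_mod R J\<^esub>"
      using j J by (intro bexI[of _ "Inl (\<ominus>\<^bsub>R\<^esub> j)"]) (auto simp: test_mod_def l_neg)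
  qed (auto simp: test_mod_def J a_ac m_assoc l_distr r_distr J.I_l_closed)
qed

text \<open>
  The maps \<open>J \<rightarrow> E\<close> extend along \<open>J \<subseteq> R\<close>, both copied into the type of the test modules, and the
  extension to \<open>R\<close> is multiplication by its value at \<open>1\<close>.
\<close>

lemma injective_imp_baer_injective:
  assumes "injective_mod R E"
  shows "baer_injective R E"
proof -
  interpret E: module R E using assms unfolding injective_mod_def by blast
  have "\<exists>e \<in> carrier E. \<forall>r \<in> J. h r = r \<odot>\<^bsub>E\<^esub> e"
    if J: "ideal J R" and h: "h \<in> mod_hom R ((self_mod R)\<lparr>carrier := J\<rparr>) E" for J h
  proof -
    let ?A = "test_mod R J :: ('a, 'a + 'c) module"
    let ?B = "test_mod R (carrier R) :: ('a, 'a + 'c) module"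
    note Jc = ideal_subset[OF J, THEN subsetD]
    have "id \<in> mod_hom R ?A ?B"
      using Jc by (intro mod_homI) (auto simp: test_mod_def)
    moreover have "(\<lambda>x. h (projl x)) \<in> mod_hom R ?A E"
      using h by (auto simp: test_mod_def mod_hom_def self_mod_def)
    moreover have "module R ?A" "module R ?B"
      using test_mod_module[OF E.R.is_cring] J E.R.oneideal by blast+
    moreover have "inj_on id (carrier ?A)" by simp
    ultimately have "\<exists>g \<in> mod_hom R ?B E. \<forall>a \<in> carrier ?A. g (id a) = h (projl a)"
      using assms unfolding injective_mod_def by blast
    then obtain g where g: "g \<in> mod_hom R ?B E" "\<forall>a \<in> carrier ?A. g (id a) = h (projl a)" ..
    have "h r = r \<odot>\<^bsub>E\<^esub> g (Inl \<one>\<^bsub>R\<^esub>)" if "r \<in> J" for r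
      using that g(2) Jc[OF that] mod_homD(3)[OF g(1), of r "Inl \<one>\<^bsub>R\<^esub>"]
      by (simp add: test_mod_def)
    moreover have "g (Inl \<one>\<^bsub>R\<^esub>) \<in> carrier E"
      by (rule mod_homD(1)[OF g(1)]) (simp add: test_mod_def)
    ultimately show ?thesis by blast
  qed
  then show ?thesis unfolding baer_injective_def using E.module_axioms by blast
qed

lemma direct_sum_mod_sel [simp]:
  "x \<in> carrier (direct_sum_mod I M) \<longleftrightarrow>
     x \<in> (\<Pi>\<^sub>E i\<in>I. carrier (M i)) \<and> finite {i \<in> I. x i \<noteq> \<zero>\<^bsub>M i\<^esub>}"
  "\<zero>\<^bsub>direct_sum_mod I M\<^esub> = (\<lambda>i\<in>I. \<zero>\<^bsub>M i\<^esub>)"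
  "x \<oplus>\<^bsub>direct_sum_mod I M\<^esub> y = (\<lambda>i\<in>I. x i \<oplus>\<^bsub>M i\<^esub> y i)"
  "r \<odot>\<^bsub>direct_sum_mod I M\<^esub> x = (\<lambda>i\<in>I. r \<odot>\<^bsub>M i\<^esub> x i)"
  by (simp_all add: direct_sum_mod_def)

lemma direct_sum_mod_module:
  assumes "cring R" "\<And>i. i \<in> I \<Longrightarrow> module R (M i)"
  shows "module R (direct_sum_mod I M)" (is "module R ?S")
proof -
  interpret cring R by fact
  note ag = module.axioms(2)[OF assms(2)]
  note ops = abelian_groupE(1,2,3,5)[OF ag] abelian_group.a_inv_closed[OF ag] abelian_group.l_neg[OF ag]
    module.smult_l_distr[OF assms(2)] module.smult_r_distr[OF assms(2)]
    module.smult_assoc1[OF assms(2)]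
  have comp: "x i \<in> carrier (M i)" if "x \<in> carrier ?S" "i \<in> I" for x i
    using that by auto
  have ex: "x = y" if "x \<in> carrier ?S" "y \<in> carrier ?S" "\<And>i. i \<in> I \<Longrightarrow> x i = y i" for x y
    using that by (intro PiE_ext[of x I _ y]) auto
  have closed: "(\<lambda>i\<in>I. F i (x i)) \<in> carrier ?S"
    if "x \<in> carrier ?S" "\<And>i a. i \<in> I \<Longrightarrow> a \<in> carrier (M i) \<Longrightarrow> F i a \<in> carrier (M i)"
      "\<And>i. i \<in> I \<Longrightarrow> F i \<zero>\<^bsub>M i\<^esub> = \<zero>\<^bsub>M i\<^esub>" for x F
  proof -
    have "finite {i \<in> I. x i \<noteq> \<zero>\<^bsub>M i\<^esub>}" using that(1) by simp
    then have "finite {i \<in> I. (\<lambda>i\<in>I. F i (x i)) i \<noteq> \<zero>\<^bsub>M i\<^esub>}"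
      by (rule rev_finite_subset) (use that(3) in auto)
    then show ?thesis using that(2) comp[OF that(1)] by auto
  qed
  have add_closed: "x \<oplus>\<^bsub>?S\<^esub> y \<in> carrier ?S" if "x \<in> carrier ?S" "y \<in> carrier ?S" for x y
  proof -
    have "finite ({i \<in> I. x i \<noteq> \<zero>\<^bsub>M i\<^esub>} \<union> {i \<in> I. y i \<noteq> \<zero>\<^bsub>M i\<^esub>})" using that by simp
    then have "finite {i \<in> I. (\<lambda>i\<in>I. x i \<oplus>\<^bsub>M i\<^esub> y i) i \<noteq> \<zero>\<^bsub>M i\<^esub>}"
      by (rule rev_finite_subset) (auto simp: ops)
    then show ?thesis using comp[OF that(1)] comp[OF that(2)] by (auto simp: ops)
  qed
  have smult_closed: "r \<odot>\<^bsub>?S\<^esub> x \<in> carrier ?S" if "r \<in> carrier R" "x \<in> carrier ?S" for r x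
    unfolding direct_sum_mod_sel(4)
    by (rule closed[OF that(2)])
      (simp_all add: module.smult_closed[OF assms(2)] module.smult_r_null[OF assms(2)] that(1))
  have zero_closed: "\<zero>\<^bsub>?S\<^esub> \<in> carrier ?S" by (simp add: ops)
  show ?thesis
  proof (rule moduleI[OF assms(1) abelian_groupI])
    fix x assume x: "x \<in> carrier ?S"
    have "(\<lambda>i\<in>I. \<ominus>\<^bsub>M i\<^esub> x i) \<in> carrier ?S"
      by (rule closed[OF x])
        (simp_all add: ops module.module_minus_zero[OF assms(2)])
    moreover have "(\<lambda>i\<in>I. \<ominus>\<^bsub>M i\<^esub> x i) \<oplus>\<^bsub>?S\<^esub> x = \<zero>\<^bsub>?S\<^esub>"
      using comp[OF x] by (auto simp: ops intro!: restrict_ext)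
    ultimately show "\<exists>y\<in>carrier ?S. y \<oplus>\<^bsub>?S\<^esub> x = \<zero>\<^bsub>?S\<^esub>"
      by blast
    show "\<zero>\<^bsub>?S\<^esub> \<oplus>\<^bsub>?S\<^esub> x = x"
      by (rule ex[OF add_closed[OF zero_closed x] x]) (use comp[OF x] in \<open>simp add: ops\<close>)
    show "\<one>\<^bsub>R\<^esub> \<odot>\<^bsub>?S\<^esub> x = x"
      by (rule ex[OF smult_closed[OF one_closed x] x])
        (use comp[OF x] in \<open>simp add: module.smult_one[OF assms(2)]\<close>)
  next
    fix x y z assume "x \<in> carrier ?S" "y \<in> carrier ?S" "z \<in> carrier ?S"
    note c = this[THEN comp]
    show "x \<oplus>\<^bsub>?S\<^esub> y \<oplus>\<^bsub>?S\<^esub> z = x \<oplus>\<^bsub>?S\<^esub> (y \<oplus>\<^bsub>?S\<^esub> z)"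
      unfolding direct_sum_mod_sel by (rule restrict_ext) (simp add: ops c)
  next
    fix x y assume "x \<in> carrier ?S" "y \<in> carrier ?S"
    note c = this[THEN comp]
    show "x \<oplus>\<^bsub>?S\<^esub> y = y \<oplus>\<^bsub>?S\<^esub> x"
      unfolding direct_sum_mod_sel by (rule restrict_ext) (rule abelian_groupE(4)[OF ag c])
  next
    fix a b x assume "a \<in> carrier R" "b \<in> carrier R" "x \<in> carrier ?S"
    note c = this(1,2) comp[OF this(3)]
    show "(a \<oplus>\<^bsub>R\<^esub> b) \<odot>\<^bsub>?S\<^esub> x = a \<odot>\<^bsub>?S\<^esub> x \<oplus>\<^bsub>?S\<^esub> b \<odot>\<^bsub>?S\<^esub> x"
      "a \<otimes>\<^bsub>R\<^esub> b \<odot>\<^bsub>?S\<^esub> x = a \<odot>\<^bsub>?S\<^esub> (b \<odot>\<^bsub>?S\<^esub> x)"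
      unfolding direct_sum_mod_sel by (rule restrict_ext, simp add: ops c)+
  next
    fix a x y assume "a \<in> carrier R" "x \<in> carrier ?S" "y \<in> carrier ?S"
    note c = this(1) comp[OF this(2)] comp[OF this(3)]
    show "a \<odot>\<^bsub>?S\<^esub> (x \<oplus>\<^bsub>?S\<^esub> y) = a \<odot>\<^bsub>?S\<^esub> x \<oplus>\<^bsub>?S\<^esub> a \<odot>\<^bsub>?S\<^esub> y"
      unfolding direct_sum_mod_sel by (rule restrict_ext) (simp add: ops c)
  qed (fact add_closed zero_closed smult_closed)+
qed

text \<open>
  Over a noetherian ring a linear map from an ideal to a direct sum takes values in a finite subsum,
  because finitely many generators of the ideal have finite joint support; so Baer's criterion can be
  applied in each of these finitely many components.
\<close>

lemma baer_injective_direct_sum: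
  assumes "cring R" "noetherian_ring R" "\<And>i. i \<in> I \<Longrightarrow> baer_injective R (M i)"
  shows "baer_injective R (direct_sum_mod I M)" (is "baer_injective R ?S")
proof -
  interpret cring R by fact
  interpret noetherian_ring R by fact
  have mods: "module R (M i)" if "i \<in> I" for i
    using assms(3)[OF that] unfolding baer_injective_def by blast
  note S = direct_sum_mod_module[OF assms(1) mods]
  interpret S: module R ?S by (rule S)
  have "\<exists>e \<in> carrier ?S. \<forall>r \<in> J. h r = r \<odot>\<^bsub>?S\<^esub> e"
    if J: "ideal J R" and h: "h \<in> mod_hom R ((self_mod R)\<lparr>carrier := J\<rparr>) ?S" for J h
  proof -
    interpret J: ideal J R by fact
    have hS: "h r \<in> carrier ?S" if "r \<in> J" for r using mod_homD(1)[OF h, of r] that by simp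
    have h_add: "h (r \<oplus>\<^bsub>R\<^esub> s) = h r \<oplus>\<^bsub>?S\<^esub> h s" if "r \<in> J" "s \<in> J" for r s
      using mod_homD(2)[OF h, of r s] that by (simp add: self_mod_def)
    have h_smult: "h (s \<otimes>\<^bsub>R\<^esub> r) = s \<odot>\<^bsub>?S\<^esub> h r" if "s \<in> carrier R" "r \<in> J" for r s
      using mod_homD(3)[OF h, of s r] that by (simp add: self_mod_def)
    have comp: "h r i \<in> carrier (M i)" if "r \<in> J" "i \<in> I" for r i
      using hS[OF that(1)] that(2) by auto
    obtain A where A: "A \<subseteq> carrier R" "finite A" "J = Idl\<^bsub>R\<^esub> A" using finetely_gen[OF J] by blast
    have AJ: "A \<subseteq> J" using genideal_self[OF A(1)] A(3) by simp
    define T where "T = (\<Union>a\<in>A. {i \<in> I. h a i \<noteq> \<zero>\<^bsub>M i\<^esub>})"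
    have "finite T" unfolding T_def using A(2) AJ hS by auto
    \<comment> \<open>the ideal of all \<open>r\<close> whose image is supported on \<open>T\<close>; it contains the generators, hence \<open>J\<close>\<close>
    define K where "K = {r \<in> J. \<forall>i \<in> I - T. h r i = \<zero>\<^bsub>M i\<^esub>}"
    have Kmult: "s \<otimes>\<^bsub>R\<^esub> r \<in> K" if "r \<in> K" "s \<in> carrier R" for r s
      using that J.I_l_closed unfolding K_def
      by (auto simp: h_smult module.smult_r_null[OF mods])
    have "ideal K R"
    proof (rule idealI[OF ring_axioms])
      show "subgroup K (add_monoid R)"
      proof (rule add.subgroupI)
        show "K \<subseteq> carrier R" using J.Icarr unfolding K_def by blast
        have "h \<zero>\<^bsub>R\<^esub> = \<zero>\<^bsub>?S\<^esub>"
          using h_smult[of "\<zero>\<^bsub>R\<^esub>" "\<zero>\<^bsub>R\<^esub>"] J.zero_closed S.smult_l_null[OF hS[OF J.zero_closed]]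
          by (metis zero_closed r_null)
        then have "\<zero>\<^bsub>R\<^esub> \<in> K" using J.zero_closed unfolding K_def by simp
        then show "K \<noteq> {}" by blast
        show "\<ominus>\<^bsub>R\<^esub> r \<in> K" if "r \<in> K" for r
          using Kmult[OF that, of "\<ominus>\<^bsub>R\<^esub> \<one>\<^bsub>R\<^esub>"] that J.Icarr l_minus[of "\<one>\<^bsub>R\<^esub>" r]
          unfolding K_def by simp
        show "r \<oplus>\<^bsub>R\<^esub> s \<in> K" if "r \<in> K" "s \<in> K" for r s
          using that abelian_groupE(2)[OF module.axioms(2)[OF mods]]
            abelian_groupE(5)[OF module.axioms(2)[OF mods]]
          unfolding K_def by (simp add: h_add)
      qed
      show "r \<otimes>\<^bsub>R\<^esub> s \<in> K" if "r \<in> K" "s \<in> carrier R" for r s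
        using Kmult[OF that] m_comm[of r s] that J.Icarr unfolding K_def by simp
    qed (rule Kmult)
    moreover have "A \<subseteq> K" using AJ unfolding K_def T_def by blast
    ultimately have "J \<subseteq> K" unfolding A(3) by (rule genideal_minimal)
    then have supp: "h r i = \<zero>\<^bsub>M i\<^esub>" if "r \<in> J" "i \<in> I" "i \<notin> T" for r i
      using that unfolding K_def by blast
    have "\<exists>e \<in> carrier (M i). \<forall>r\<in>J. h r i = r \<odot>\<^bsub>M i\<^esub> e" if i: "i \<in> I" for i
    proof -
      have "(\<lambda>r. h r i) \<in> mod_hom R ((self_mod R)\<lparr>carrier := J\<rparr>) (M i)"
        using i comp h_add h_smult by (intro mod_homI) (simp_all add: self_mod_def)
      then show ?thesis using assms(3)[OF i] J unfolding baer_injective_def by blast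
    qed
    then obtain e where e: "\<And>i. i \<in> I \<Longrightarrow> e i \<in> carrier (M i)"
      "\<And>i r. i \<in> I \<Longrightarrow> r \<in> J \<Longrightarrow> h r i = r \<odot>\<^bsub>M i\<^esub> e i" by metis
    define e' where "e' = (\<lambda>i\<in>I. if i \<in> T then e i else \<zero>\<^bsub>M i\<^esub>)"
    have "{i \<in> I. e' i \<noteq> \<zero>\<^bsub>M i\<^esub>} \<subseteq> T" unfolding e'_def by auto
    then have "finite {i \<in> I. e' i \<noteq> \<zero>\<^bsub>M i\<^esub>}" using \<open>finite T\<close> by (rule finite_subset)
    moreover have "e' \<in> (\<Pi>\<^sub>E i\<in>I. carrier (M i))"
      using e(1) abelian_groupE(2)[OF module.axioms(2)[OF mods]] unfolding e'_def by simp
    ultimately have e': "e' \<in> carrier ?S" by simp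
    have "h r = r \<odot>\<^bsub>?S\<^esub> e'" if r: "r \<in> J" for r
    proof (rule PiE_ext)
      show "h r \<in> (\<Pi>\<^sub>E i\<in>I. carrier (M i))" using hS[OF r] by simp
      show "r \<odot>\<^bsub>?S\<^esub> e' \<in> (\<Pi>\<^sub>E i\<in>I. carrier (M i))"
        using S.smult_closed[OF J.Icarr[OF r] e'] by (simp only: direct_sum_mod_sel)
      show "h r i = (r \<odot>\<^bsub>?S\<^esub> e') i" if "i \<in> I" for i
        using that e(2)[OF that r] supp[OF r that] module.smult_r_null[OF mods J.Icarr[OF r]]
        unfolding e'_def by simp
    qed
    then show ?thesis using e' by blast
  qed
  note baer = this
  show ?thesis
    unfolding baer_injective_def
    by (intro conjI S.module_axioms allI impI, elim conjE) (rule baer)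
qed


section \<open>Cogenerators\<close>

text \<open>
  An element \<open>e\<close> with \<open>J e = 0\<close> is a linear map \<open>R/J \<rightarrow> I\<close>, so the condition says that every nonzero
  cyclic module has a nonzero map to \<open>I\<close>.
\<close>

definition cogenerating :: "('r, 'z) ring_scheme \<Rightarrow> ('r, 'e) module \<Rightarrow> bool" where
  "cogenerating R I \<longleftrightarrow> (\<forall>J. ideal J R \<and> J \<noteq> carrier R \<longrightarrow>
     (\<exists>e \<in> carrier I. e \<noteq> \<zero>\<^bsub>I\<^esub> \<and> (\<forall>r \<in> J. r \<odot>\<^bsub>I\<^esub> e = \<zero>\<^bsub>I\<^esub>)))"

text \<open>
  With \<open>J\<close> the annihilator of \<open>y\<close> modulo \<open>N\<close>, a nonzero \<open>e\<close> with \<open>J e = 0\<close> is an admissible value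
  at \<open>y\<close> for a map that vanishes on \<open>N\<close>; injectivity extends this map to all of \<open>M\<close>.
\<close>

lemma separate_from_submodule:
  assumes "module R M" "baer_injective R I" "cogenerating R I" "submodule N R M"
    and y: "y \<in> carrier M" "y \<notin> N"
  shows "\<exists>g \<in> mod_hom R M I. (\<forall>n \<in> N. g n = \<zero>\<^bsub>I\<^esub>) \<and> g y \<noteq> \<zero>\<^bsub>I\<^esub>"
proof -
  interpret M: module R M by fact
  interpret I: module R I using assms(2) unfolding baer_injective_def by blast
  note N = M.submoduleE[OF assms(4)]
  have N0: "\<zero>\<^bsub>M\<^esub> \<in> N" using subgroup.one_closed[OF submodule.axioms(1)[OF assms(4)]] by simp
  define J where "J = {r \<in> carrier R. r \<odot>\<^bsub>M\<^esub> y \<in> N}"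
  have Jm: "s \<otimes>\<^bsub>R\<^esub> r \<in> J" if "r \<in> J" "s \<in> carrier R" for r s
    using that y(1) N(4) unfolding J_def by (auto simp: M.smult_assoc1)
  have "ideal J R"
  proof (rule idealI[OF M.R.ring_axioms])
    show "subgroup J (add_monoid R)"
    proof (rule M.R.add.subgroupI)
      show "J \<subseteq> carrier R" unfolding J_def by blast
      show "J \<noteq> {}" using N0 y(1) unfolding J_def by (auto intro!: exI[of _ "\<zero>\<^bsub>R\<^esub>"])
      show "\<ominus>\<^bsub>R\<^esub> r \<in> J" if "r \<in> J" for r
        using that y(1) N(3) unfolding J_def by (auto simp: M.smult_l_minus)
      show "r \<oplus>\<^bsub>R\<^esub> s \<in> J" if "r \<in> J" "s \<in> J" for r s
        using that y(1) N(5) unfolding J_def by (auto simp: M.smult_l_distr)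
    qed
    show "r \<otimes>\<^bsub>R\<^esub> s \<in> J" if "r \<in> J" "s \<in> carrier R" for r s
      using Jm[OF that] that M.R.m_comm[of r s] unfolding J_def by auto
  qed (rule Jm)
  moreover have "\<one>\<^bsub>R\<^esub> \<notin> J" using y unfolding J_def by simp
  ultimately obtain e where e: "e \<in> carrier I" "e \<noteq> \<zero>\<^bsub>I\<^esub>" "\<forall>r \<in> J. r \<odot>\<^bsub>I\<^esub> e = \<zero>\<^bsub>I\<^esub>"
    using assms(3) M.R.one_closed unfolding cogenerating_def by metis
  let ?G = "N \<times> {\<zero>\<^bsub>I\<^esub>}"
  let ?H = "{(d \<oplus>\<^bsub>M\<^esub> r \<odot>\<^bsub>M\<^esub> y, a \<oplus>\<^bsub>I\<^esub> r \<odot>\<^bsub>I\<^esub> e) | d a r. (d, a) \<in> ?G \<and> r \<in> carrier R}"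
  have G: "linear_graph R M I ?G"
    using N N0 by (intro linear_graphI) auto
  have "linear_graph R M I ?H"
    by (rule linear_graph_adjoin[OF assms(1) I.module_axioms G y(1) e(1)])
      (use e(3) in \<open>simp add: J_def\<close>)
  then obtain g where g: "g \<in> mod_hom R M I" "\<forall>(x, a) \<in> ?H. g x = a"
    using extend_linear_graph[OF assms(1,2)] by blast
  have mem: "(d \<oplus>\<^bsub>M\<^esub> r \<odot>\<^bsub>M\<^esub> y, \<zero>\<^bsub>I\<^esub> \<oplus>\<^bsub>I\<^esub> r \<odot>\<^bsub>I\<^esub> e) \<in> ?H" if "d \<in> N" "r \<in> carrier R" for d r
    using that by blast
  have val: "g (d \<oplus>\<^bsub>M\<^esub> r \<odot>\<^bsub>M\<^esub> y) = \<zero>\<^bsub>I\<^esub> \<oplus>\<^bsub>I\<^esub> r \<odot>\<^bsub>I\<^esub> e" if "d \<in> N" "r \<in> carrier R" for d r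
    using bspec[OF g(2) mem[OF that]] by simp
  have "g n = \<zero>\<^bsub>I\<^esub>" if "n \<in> N" for n
    using val[OF that M.R.zero_closed] that N(1) y(1) e(1) by (auto simp: subset_iff)
  moreover have "g y = e" using val[OF N0 M.R.one_closed] y(1) e(1) by simp
  ultimately show ?thesis using g(1) e(2) by blast
qed

section \<open>Injective envelopes of residue rings\<close>

lemma (in abelian_group) coset_absorb:
  assumes "subgroup N (add_monoid G)" "n \<in> N" "z \<in> carrier G"
  shows "N +> (n \<oplus> z) = N +> z"
proof -
  have N: "N \<subseteq> carrier G" using subgroup.subset[OF assms(1)] by simp
  then have n: "n \<in> carrier G" using assms(2) by blast
  show ?thesis
    using add.coset_mult_assoc[OF N n assms(3)] add.coset_join2[OF n assms(1,2)]
    by (simp add: a_r_coset_def)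
qed

lemma (in abelian_group) coset_eq_iff:
  assumes "subgroup N (add_monoid G)" "z \<in> carrier G"
  shows "N +> z = N \<longleftrightarrow> z \<in> N"
  using add.coset_join1[OF _ assms(2,1)] add.coset_join2[OF assms(2,1)]
  unfolding a_r_coset_def by blast

lemma quot_mod_smult:
  assumes "module R M" "submodule N R M" "r \<in> carrier R" "z \<in> carrier M"
  shows "r \<odot>\<^bsub>quot_mod M N\<^esub> (N +>\<^bsub>M\<^esub> z) = N +>\<^bsub>M\<^esub> (r \<odot>\<^bsub>M\<^esub> z)"
proof -
  interpret module R M by fact
  note N = submoduleE[OF assms(2)]
  have "N +>\<^bsub>M\<^esub> (r \<odot>\<^bsub>M\<^esub> x) = N +>\<^bsub>M\<^esub> (r \<odot>\<^bsub>M\<^esub> z)" if x: "x \<in> N +>\<^bsub>M\<^esub> z" for x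
  proof -
    obtain n where n: "n \<in> N" "x = n \<oplus>\<^bsub>M\<^esub> z"
      using x unfolding a_r_coset_def' by blast
    then have "r \<odot>\<^bsub>M\<^esub> x = r \<odot>\<^bsub>M\<^esub> n \<oplus>\<^bsub>M\<^esub> r \<odot>\<^bsub>M\<^esub> z"
      using assms N(1) by (auto simp: smult_r_distr)
    then show ?thesis using M.coset_absorb[OF submodule.axioms(1)[OF assms(2)] N(4)[OF assms(3) n(1)]] assms by simp
  qed
  moreover have "N +>\<^bsub>M\<^esub> z \<noteq> {}" using N(2) by (auto simp: a_r_coset_def')
  ultimately show ?thesis by (simp add: quot_mod_def)
qed

lemma quot_mod_carrier:
  "carrier (quot_mod M N) = (\<lambda>x. N +>\<^bsub>M\<^esub> x) ` carrier M"
  by (auto simp: quot_mod_def A_RCOSETS_def')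

lemma ideal_submodule_self:
  assumes "cring R" "ideal J R"
  shows "submodule J R (self_mod R)"
proof -
  interpret S: module R "self_mod R" by (rule self_mod_module[OF assms(1)])
  interpret J: ideal J R by fact
  have "\<ominus>\<^bsub>self_mod R\<^esub> a \<in> J" if "a \<in> J" for a
  proof -
    have a: "a \<in> carrier R" using that by (rule J.Icarr)
    have "\<ominus>\<^bsub>self_mod R\<^esub> a = (\<ominus>\<^bsub>R\<^esub> \<one>\<^bsub>R\<^esub>) \<odot>\<^bsub>self_mod R\<^esub> a"
      using S.minus_eq_smult[of a] a by simp
    then show ?thesis using J.I_l_closed[OF that, of "\<ominus>\<^bsub>R\<^esub> \<one>\<^bsub>R\<^esub>"] by simp
  qed
  then show ?thesis
    using J.I_l_closed J.a_subset by (intro S.submoduleI) auto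
qed

text \<open>
  The image of the residue class of \<open>1\<close> in the envelope of \<open>R/J\<close> is killed by \<open>J\<close>, and it is nonzero
  because \<open>J\<close> is proper and \<open>R/J\<close> embeds.
\<close>

lemma injective_envelope_quot:
  assumes "cring R" "ideal J R" "J \<noteq> carrier R"
    and "injective_envelope R (quot_mod (self_mod R) J) E"
  shows "baer_injective R E"
    and "\<exists>e \<in> carrier E. e \<noteq> \<zero>\<^bsub>E\<^esub> \<and> (\<forall>r \<in> J. r \<odot>\<^bsub>E\<^esub> e = \<zero>\<^bsub>E\<^esub>)"
proof -
  have inj: "injective_mod R E" using assms(4) unfolding injective_envelope_def by blast
  then show "baer_injective R E" by (rule injective_imp_baer_injective)
  interpret S: module R "self_mod R" by (rule self_mod_module[OF assms(1)])
  interpret J: ideal J R by fact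
  interpret E: module R E using inj unfolding injective_mod_def by blast
  note JS = ideal_submodule_self[OF assms(1,2)]
  let ?Q = "quot_mod (self_mod R) J"
  obtain i where i: "i \<in> mod_hom R ?Q E" "inj_on i (carrier ?Q)"
    using assms(4) unfolding injective_envelope_def by blast
  let ?c = "\<lambda>x. J +>\<^bsub>self_mod R\<^esub> x"
  have c: "?c x \<in> carrier ?Q" if "x \<in> carrier R" for x using that by (auto simp: quot_mod_carrier)
  have c0: "?c x = J" if "x \<in> J" for x
    using S.M.coset_eq_iff[OF submodule.axioms(1)[OF JS], of x] that J.Icarr by simp
  have iJ: "i J = \<zero>\<^bsub>E\<^esub>"
  proof -
    have "i (\<zero>\<^bsub>R\<^esub> \<odot>\<^bsub>?Q\<^esub> ?c \<zero>\<^bsub>R\<^esub>) = \<zero>\<^bsub>E\<^esub>"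
      using mod_homD(3)[OF i(1) _ c, of "\<zero>\<^bsub>R\<^esub>" "\<zero>\<^bsub>R\<^esub>"] mod_homD(1)[OF i(1) c, of "\<zero>\<^bsub>R\<^esub>"] by simp
    then show ?thesis using quot_mod_smult[OF S.module_axioms JS, of "\<zero>\<^bsub>R\<^esub>" "\<zero>\<^bsub>R\<^esub>"] c0[of "\<zero>\<^bsub>R\<^esub>"] by simp
  qed
  have "r \<odot>\<^bsub>E\<^esub> i (?c \<one>\<^bsub>R\<^esub>) = \<zero>\<^bsub>E\<^esub>" if "r \<in> J" for r
    using mod_homD(3)[OF i(1) _ c, of r "\<one>\<^bsub>R\<^esub>"] quot_mod_smult[OF S.module_axioms JS, of r "\<one>\<^bsub>R\<^esub>"]
      c0[OF that] iJ J.Icarr[OF that] by simp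
  moreover have "i (?c \<one>\<^bsub>R\<^esub>) \<noteq> \<zero>\<^bsub>E\<^esub>"
  proof
    assume "i (?c \<one>\<^bsub>R\<^esub>) = \<zero>\<^bsub>E\<^esub>"
    then have "i (?c \<one>\<^bsub>R\<^esub>) = i (?c \<zero>\<^bsub>R\<^esub>)" using iJ c0[of "\<zero>\<^bsub>R\<^esub>"] by simp
    then have "?c \<one>\<^bsub>R\<^esub> = J"
      using inj_onD[OF i(2) _ c c, of "\<one>\<^bsub>R\<^esub>" "\<zero>\<^bsub>R\<^esub>"] c0[of "\<zero>\<^bsub>R\<^esub>"] by simp
    then show False
      using S.M.coset_eq_iff[OF submodule.axioms(1)[OF JS], of "\<one>\<^bsub>R\<^esub>"] J.one_imp_carrier assms(3) by simp
  qed
  ultimately show "\<exists>e \<in> carrier E. e \<noteq> \<zero>\<^bsub>E\<^esub> \<and> (\<forall>r \<in> J. r \<odot>\<^bsub>E\<^esub> e = \<zero>\<^bsub>E\<^esub>)"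
    using mod_homD(1)[OF i(1) c, of "\<one>\<^bsub>R\<^esub>"] by blast
qed

lemma (in noetherian_ring) exists_maximalideal:
  assumes "ideal J R" "J \<noteq> carrier R"
  shows "\<exists>m. maximalideal m R \<and> J \<subseteq> m"
proof -
  let ?A = "{I. ideal I R \<and> J \<subseteq> I \<and> I \<noteq> carrier R}"
  have "\<exists>m\<in>?A. \<forall>X\<in>?A. m \<subseteq> X \<longrightarrow> X = m"
  proof (rule subset_Zorn_nonempty)
    show "?A \<noteq> {}" using assms by blast
    fix C assume C: "C \<noteq> {}" "subset.chain ?A C"
    then have "subset.chain {I. ideal I R} C" unfolding subset_chain_def by blast
    then have "\<Union>C \<in> C" using ideal_chain_is_trivial C(1) by blast
    then show "\<Union>C \<in> ?A" using C(2) unfolding subset_chain_def by blast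
  qed
  then obtain m where m: "m \<in> ?A" "\<forall>X\<in>?A. m \<subseteq> X \<longrightarrow> X = m" by (rule bexE)
  have "maximalideal m R"
  proof (rule maximalidealI)
    show "ideal m R" "carrier R \<noteq> m" using m(1) by auto
    fix I assume I: "ideal I R" "m \<subseteq> I" "I \<subseteq> carrier R"
    then show "I = m \<or> I = carrier R" using m by blast
  qed
  then show ?thesis using m(1) by blast
qed

text \<open>
  A proper ideal lies in a maximal ideal \<open>m\<close>, and the summand \<open>E(R/m)\<close> contains a nonzero element that
  \<open>m\<close> kills.
\<close>

lemma sum_of_envelopes_injective_cogenerator:
  assumes "cring R" "noetherian_ring R"
    and env: "\<And>m. maximalideal m R \<Longrightarrow> injective_envelope R (quot_mod (self_mod R) m) (E m)"
  shows "baer_injective R (direct_sum_mod {m. maximalideal m R} E)" (is "baer_injective R ?I")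
    and "cogenerating R (direct_sum_mod {m. maximalideal m R} E)"
proof -
  interpret cring R by fact
  interpret noetherian_ring R by fact
  have max: "ideal m R" "m \<noteq> carrier R" if "maximalideal m R" for m
    using that maximalideal.axioms(1) maximalideal.I_notcarr by blast+
  note envelope = injective_envelope_quot[OF assms(1) max env]
  have mods: "module R (E m)" if "maximalideal m R" for m
    using envelope(1)[OF that that that] unfolding baer_injective_def by blast
  show "baer_injective R ?I"
    by (rule baer_injective_direct_sum[OF assms(1,2)]) (use envelope(1) in blast)
  show "cogenerating R ?I"
    unfolding cogenerating_def
  proof (intro allI impI, elim conjE)
    fix J assume "ideal J R" "J \<noteq> carrier R"
    then obtain m where m: "maximalideal m R" "J \<subseteq> m" using exists_maximalideal by blast
    obtain e where e: "e \<in> carrier (E m)" "e \<noteq> \<zero>\<^bsub>E m\<^esub>" "\<forall>r \<in> m. r \<odot>\<^bsub>E m\<^esub> e = \<zero>\<^bsub>E m\<^esub>"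
      using envelope(2)[OF m(1) m(1) m(1)] by blast
    let ?e = "\<lambda>i\<in>{m. maximalideal m R}. if i = m then e else \<zero>\<^bsub>E i\<^esub>"
    have "{i \<in> {m. maximalideal m R}. ?e i \<noteq> \<zero>\<^bsub>E i\<^esub>} \<subseteq> {m}" by auto
    then have "finite {i \<in> {m. maximalideal m R}. ?e i \<noteq> \<zero>\<^bsub>E i\<^esub>}"
      using finite_subset by blast
    then have "?e \<in> carrier ?I"
      using e(1) abelian_groupE(2)[OF module.axioms(2)[OF mods]] by simp
    moreover have "?e \<noteq> \<zero>\<^bsub>?I\<^esub>"
      using e(2) m(1) by (auto dest: fun_cong[of _ _ m])
    moreover have "r \<odot>\<^bsub>?I\<^esub> ?e = \<zero>\<^bsub>?I\<^esub>" if "r \<in> J" for r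
    proof -
      have "r \<in> m" "r \<in> carrier R" using that m(2) ideal.Icarr[OF max(1)[OF m(1)]] by blast+
      then show ?thesis
        using e(3) module.smult_r_null[OF mods] by (auto intro!: restrict_ext)
    qed
    ultimately show "\<exists>e \<in> carrier ?I. e \<noteq> \<zero>\<^bsub>?I\<^esub> \<and> (\<forall>r \<in> J. r \<odot>\<^bsub>?I\<^esub> e = \<zero>\<^bsub>?I\<^esub>)" by blast
  qed
qed

section \<open>Complexes and exactness\<close>

definition exact_complex :: "('r, 'm) cplx \<Rightarrow> bool" where
  "exact_complex X \<longleftrightarrow> (\<forall>n. cycles X n \<subseteq> boundaries X n)"

lemma is_complexD:
  assumes "is_complex R X"
  shows "module R (obj X n)"
    and "bd X n \<in> mod_hom R (obj X n) (obj X (n - 1))"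
    and "x \<in> carrier (obj X n) \<Longrightarrow> bd X (n - 1) (bd X n x) = \<zero>\<^bsub>obj X (n - 1 - 1)\<^esub>"
    and "bd X (n + 1) \<in> mod_hom R (obj X (n + 1)) (obj X n)"
    and "x \<in> carrier (obj X (n + 1)) \<Longrightarrow> bd X n (bd X (n + 1) x) = \<zero>\<^bsub>obj X (n - 1)\<^esub>"
proof -
  have c: "module R (obj X n)" "bd X n \<in> mod_hom R (obj X n) (obj X (n - 1))"
    "\<forall>x \<in> carrier (obj X n). bd X (n - 1) (bd X n x) = \<zero>\<^bsub>obj X (n - 1 - 1)\<^esub>" for n
    using assms unfolding is_complex_def by blast+
  show "module R (obj X n)" "bd X n \<in> mod_hom R (obj X n) (obj X (n - 1))"
    "x \<in> carrier (obj X n) \<Longrightarrow> bd X (n - 1) (bd X n x) = \<zero>\<^bsub>obj X (n - 1 - 1)\<^esub>"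
    using c by blast+
  show "bd X (n + 1) \<in> mod_hom R (obj X (n + 1)) (obj X n)"
    "x \<in> carrier (obj X (n + 1)) \<Longrightarrow> bd X n (bd X (n + 1) x) = \<zero>\<^bsub>obj X (n - 1)\<^esub>"
    using c(2)[of "n + 1"] c(3)[of "n + 1"] by simp_all
qed

lemma cycles_submodule:
  assumes "is_complex R X"
  shows "submodule (cycles X n) R (obj X n)"
proof -
  interpret M: module R "obj X n" by (rule is_complexD(1)[OF assms])
  interpret N: module R "obj X (n - 1)" by (rule is_complexD(1)[OF assms])
  note d = mod_homD[OF is_complexD(2)[OF assms, of n]]
  have sm: "r \<odot>\<^bsub>obj X n\<^esub> x \<in> cycles X n" if "r \<in> carrier R" "x \<in> cycles X n" for r x
    using that by (simp add: cycles_def d)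
  show ?thesis
  proof (rule M.submoduleI)
    show "\<zero>\<^bsub>obj X n\<^esub> \<in> cycles X n"
      using mod_hom_zero[OF M.module_axioms N.module_axioms is_complexD(2)[OF assms]]
      by (simp add: cycles_def)
    show "\<ominus>\<^bsub>obj X n\<^esub> x \<in> cycles X n" if "x \<in> cycles X n" for x
      using sm[OF _ that, of "\<ominus>\<^bsub>R\<^esub> \<one>\<^bsub>R\<^esub>"] that M.minus_eq_smult[of x] by (simp add: cycles_def)
  qed (simp_all add: sm, simp_all add: cycles_def d subset_iff)
qed

lemma boundaries_subset_cycles:
  assumes "is_complex R X"
  shows "boundaries X n \<subseteq> cycles X n"
  using mod_homD(1)[OF is_complexD(4)[OF assms]] is_complexD(5)[OF assms]
  by (auto simp: boundaries_def cycles_def)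

lemma boundaries_submodule:
  assumes "is_complex R X"
  shows "submodule (boundaries X n) R (obj X n)"
proof -
  interpret M: module R "obj X n" by (rule is_complexD(1)[OF assms])
  interpret N: module R "obj X (n + 1)" by (rule is_complexD(1)[OF assms])
  note d = mod_homD[OF is_complexD(4)[OF assms, of n]]
  have in_B: "bd X (n + 1) w \<in> boundaries X n" if "w \<in> carrier (obj X (n + 1))" for w
    using that unfolding boundaries_def by blast
  have sm: "r \<odot>\<^bsub>obj X n\<^esub> x \<in> boundaries X n" if r: "r \<in> carrier R" and x: "x \<in> boundaries X n" for r x
  proof -
    obtain w where "w \<in> carrier (obj X (n + 1))" "x = bd X (n + 1) w"
      using x unfolding boundaries_def by blast
    then show ?thesis using in_B[of "r \<odot>\<^bsub>obj X (n + 1)\<^esub> w"] r by (simp add: d)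
  qed
  have sub: "boundaries X n \<subseteq> carrier (obj X n)" using d(1) unfolding boundaries_def by blast
  show ?thesis
  proof (rule M.submoduleI[OF sub])
    show "\<zero>\<^bsub>obj X n\<^esub> \<in> boundaries X n"
      using mod_hom_zero[OF N.module_axioms M.module_axioms is_complexD(4)[OF assms]]
        in_B[of "\<zero>\<^bsub>obj X (n + 1)\<^esub>"] by simp
    show "\<ominus>\<^bsub>obj X n\<^esub> x \<in> boundaries X n" if "x \<in> boundaries X n" for x
      using sm[OF _ that, of "\<ominus>\<^bsub>R\<^esub> \<one>\<^bsub>R\<^esub>"] that sub M.minus_eq_smult[of x] by auto
    show "x \<oplus>\<^bsub>obj X n\<^esub> y \<in> boundaries X n" if xy: "x \<in> boundaries X n" "y \<in> boundaries X n" for x y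
    proof -
      obtain v w where "v \<in> carrier (obj X (n + 1))" "x = bd X (n + 1) v"
        "w \<in> carrier (obj X (n + 1))" "y = bd X (n + 1) w"
        using xy unfolding boundaries_def by blast
      then show ?thesis using in_B[of "v \<oplus>\<^bsub>obj X (n + 1)\<^esub> w"] by (simp add: d)
    qed
  qed (rule sm)
qed

lemma zero_in_boundaries:
  assumes "is_complex R X"
  shows "\<zero>\<^bsub>obj X n\<^esub> \<in> boundaries X n"
  using subgroup.one_closed[OF submodule.axioms(1)[OF boundaries_submodule[OF assms]]] by simp

lemma coset_carrier_update [simp]: "N +>\<^bsub>M\<lparr>carrier := Z\<rparr>\<^esub> x = N +>\<^bsub>M\<^esub> x"
  by (simp add: a_r_coset_def')

lemma homology_carrier:
  "carrier (homology X n) = (\<lambda>z. boundaries X n +>\<^bsub>obj X n\<^esub> z) ` cycles X n"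
  by (simp add: homology_def quot_mod_carrier)

lemma boundary_coset_iff:
  assumes "is_complex R X" "z \<in> cycles X n"
  shows "boundaries X n +>\<^bsub>obj X n\<^esub> z = boundaries X n \<longleftrightarrow> z \<in> boundaries X n"
proof -
  interpret M: module R "obj X n" by (rule is_complexD(1)[OF assms(1)])
  show ?thesis
    using M.M.coset_eq_iff[OF submodule.axioms(1)[OF boundaries_submodule[OF assms(1)]]] assms(2)
    by (simp add: cycles_def)
qed

lemma homology_zero:
  assumes "is_complex R X"
  shows "boundaries X n \<in> carrier (homology X n)"
  using boundary_coset_iff[OF assms] zero_in_boundaries[OF assms]
    boundaries_subset_cycles[OF assms] unfolding homology_carrier by blast

lemma exact_iff_trivial_homology:
  assumes "is_complex R X"
  shows "exact_complex X \<longleftrightarrow> (\<forall>n. carrier (homology X n) = {boundaries X n})"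
proof -
  have "cycles X n \<subseteq> boundaries X n \<longleftrightarrow> carrier (homology X n) = {boundaries X n}" for n
  proof
    assume "cycles X n \<subseteq> boundaries X n"
    then show "carrier (homology X n) = {boundaries X n}"
      using homology_zero[OF assms, of n] boundary_coset_iff[OF assms] unfolding homology_carrier
      by auto
  next
    assume H: "carrier (homology X n) = {boundaries X n}"
    show "cycles X n \<subseteq> boundaries X n"
    proof
      fix z assume z: "z \<in> cycles X n"
      then have "boundaries X n +>\<^bsub>obj X n\<^esub> z \<in> carrier (homology X n)"
        unfolding homology_carrier by (rule imageI)
      then show "z \<in> boundaries X n" using H boundary_coset_iff[OF assms z] by simp
    qed
  qed
  then show ?thesis unfolding exact_complex_def by blast
qed

text \<open>A zero complex whose elements have the type required of the middle term of a roof.\<close>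

definition null_complex :: "('r, 'a list) cplx" where
  "null_complex = \<lparr>obj = (\<lambda>_. \<lparr>carrier = {[]}, mult = undefined, one = undefined, zero = [],
     add = (\<lambda>_ _. []), smult = (\<lambda>_ _. [])\<rparr>), bd = (\<lambda>_ _. [])\<rparr>"

lemma null_complex_is_complex:
  assumes "cring R"
  shows "is_complex R null_complex"
proof -
  have "module R (obj null_complex n :: ('a, 'c list) module)" for n
    by (rule moduleI[OF assms abelian_groupI]) (simp_all add: null_complex_def)
  then show ?thesis by (simp add: is_complex_def null_complex_def mod_hom_def)
qed

lemma exact_null_complex: "exact_complex null_complex"
  by (auto simp: exact_complex_def cycles_def boundaries_def null_complex_def)

lemma zero_complex_is_complex:
  assumes "cring R"
  shows "is_complex R zero_complex"
proof -
  have "module R (zero_mod :: ('a, unit) module)"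
    by (rule moduleI[OF assms abelian_groupI]) (simp_all add: zero_mod_def)
  then show ?thesis by (simp add: is_complex_def zero_complex_def mod_hom_def zero_mod_def)
qed

lemma exact_zero_complex: "exact_complex zero_complex"
  by (auto simp: exact_complex_def cycles_def boundaries_def zero_complex_def zero_mod_def)

lemma quasi_iso_zero_map:
  assumes "is_complex R X" "is_complex R Y" "exact_complex X" "exact_complex Y"
  shows "quasi_iso R X Y (\<lambda>n x. \<zero>\<^bsub>obj Y n\<^esub>)"
proof -
  note mod = is_complexD(1)[OF assms(2)]
  have zero: "bd Y n \<zero>\<^bsub>obj Y n\<^esub> = \<zero>\<^bsub>obj Y (n - 1)\<^esub>" for n
    by (rule mod_hom_zero[OF mod mod is_complexD(2)[OF assms(2)]])
  have X: "carrier (homology X n) = {boundaries X n}"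
    and Y: "carrier (homology Y n) = {boundaries Y n}" for n
    using assms exact_iff_trivial_homology by blast+
  have "boundaries Y n +>\<^bsub>obj Y n\<^esub> \<zero>\<^bsub>obj Y n\<^esub> = boundaries Y n" for n
    using boundary_coset_iff[OF assms(2)] zero_in_boundaries[OF assms(2)]
      boundaries_subset_cycles[OF assms(2)] by blast
  then have "homology_map Y (\<lambda>n x. \<zero>\<^bsub>obj Y n\<^esub>) n (boundaries X n) = boundaries Y n" for n
    using zero_in_boundaries[OF assms(1), of n] unfolding homology_map_def by auto
  then show ?thesis
    unfolding quasi_iso_def is_chain_map_def
    by (simp add: mod_hom_const_zero[OF mod] X Y zero bij_betw_def)
qed

text \<open>
  All homology of the zero complex is a single class, and a roof of quasi-isomorphisms transports this
  to \<open>X\<close>; conversely two exact complexes are quasi-isomorphic by the zero map.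
\<close>

lemma derived_iso_zero_iff_exact:
  fixes R :: "('r, 'z) ring_scheme" and X :: "('r, 'm) cplx"
  assumes "is_complex R X"
  shows "derived_iso R X zero_complex \<longleftrightarrow> exact_complex X"
proof
  have R: "cring R" using is_complexD(1)[OF assms] unfolding module_def by blast
  let ?O = "zero_complex :: ('r, unit) cplx"
  note zc = zero_complex_is_complex[OF R]
  show "derived_iso R X zero_complex" if "exact_complex X"
    unfolding derived_iso_def
    using null_complex_is_complex[OF R]
      quasi_iso_zero_map[OF null_complex_is_complex[OF R] assms exact_null_complex that]
      quasi_iso_zero_map[OF null_complex_is_complex[OF R] zc exact_null_complex exact_zero_complex]
    by blast
  assume "derived_iso R X zero_complex"
  then obtain Z :: "('r, (nat \<times> 'r \<times> 'm \<times> unit) list) cplx" and f g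
    where f: "quasi_iso R Z X f" and g: "quasi_iso R Z ?O g"
    unfolding derived_iso_def by blast
  have "carrier (homology X n) = {boundaries X n}" for n
  proof -
    let ?H = "carrier (homology Z n)"
    have f_bij: "bij_betw (homology_map X f n) ?H (carrier (homology X n))"
      and g_bij: "bij_betw (homology_map ?O g n) ?H (carrier (homology ?O n))"
      using f g unfolding quasi_iso_def by simp_all
    have "carrier (homology ?O n) = {boundaries ?O n}"
      using iffD1[OF exact_iff_trivial_homology[OF zc] exact_zero_complex] by (rule spec)
    then have g_const: "homology_map ?O g n x = boundaries ?O n" if "x \<in> ?H" for x
      using bij_betwE[OF g_bij] that by blast
    have "x = y" if "x \<in> ?H" "y \<in> ?H" for x y
      using inj_onD[OF bij_betw_imp_inj_on[OF g_bij] _ that] g_const that by simp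
    then have "x = y" if "x \<in> carrier (homology X n)" "y \<in> carrier (homology X n)" for x y
      using that unfolding bij_betw_imp_surj_on[OF f_bij, symmetric] by blast
    then show ?thesis using homology_zero[OF assms, of n] by blast
  qed
  then show "exact_complex X" using exact_iff_trivial_homology[OF assms] by blast
qed


section \<open>Dual complexes\<close>

lemma hom_complex_sel:
  "obj (hom_complex R X I) n = hom_mod R (obj X (- n)) I"
  "bd (hom_complex R X I) n f = (\<lambda>x\<in>carrier (obj X (1 - n)).
     if even n then \<ominus>\<^bsub>I\<^esub> f (bd X (1 - n) x) else f (bd X (1 - n) x))"
  by (simp_all add: hom_complex_def)

lemma bd_mod_hom_shift:
  "is_complex R X \<Longrightarrow> bd X (1 - n) \<in> mod_hom R (obj X (1 - n)) (obj X (- n))"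
  using is_complexD(2)[of R X "1 - n"] by simp

lemma hom_complex_is_complex:
  assumes "is_complex R X" "module R I"
  shows "is_complex R (hom_complex R X I)"
  unfolding is_complex_def
proof (intro allI conjI ballI)
  fix n
  interpret I: module R I by fact
  let ?D = "hom_complex R X I"
  note mX = is_complexD(1)[OF assms(1)]
  interpret Y: module R "obj X (1 - n)" by (rule mX)
  note d = bd_mod_hom_shift[OF assms(1)]
  show "module R (obj ?D n)" using hom_mod_module[OF mX assms(2)] by (simp add: hom_complex_sel)
  have idx: "- (n - 1) = 1 - n" by simp
  have closed: "bd ?D n f \<in> carrier (obj ?D (n - 1))" if f: "f \<in> carrier (obj ?D n)" for f
  proof -
    have "(\<lambda>x. f (bd X (1 - n) x)) \<in> mod_hom R (obj X (1 - n)) I"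
      by (rule mod_hom_comp[OF d]) (use f in \<open>simp add: hom_complex_sel\<close>)
    then have "(\<lambda>x. if even n then \<ominus>\<^bsub>I\<^esub> f (bd X (1 - n) x) else f (bd X (1 - n) x))
        \<in> mod_hom R (obj X (1 - n)) I"
      by (cases "even n") (simp_all add: mod_hom_minus[OF assms(2)])
    from mod_hom_restrict[OF mX this] show ?thesis by (simp add: hom_complex_sel)
  qed
  show "bd ?D n \<in> mod_hom R (obj ?D n) (obj ?D (n - 1))"
  proof (rule mod_homI[OF closed])
    fix f g assume fg: "f \<in> carrier (obj ?D n)" "g \<in> carrier (obj ?D n)"
    then have "f x \<in> carrier I" "g x \<in> carrier I" if "x \<in> carrier (obj X (- n))" for x
      using that mod_homD(1) by (auto simp: hom_complex_sel)
    then show "bd ?D n (f \<oplus>\<^bsub>obj ?D n\<^esub> g) = bd ?D n f \<oplus>\<^bsub>obj ?D (n - 1)\<^esub> bd ?D n g"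
      using mod_homD(1)[OF d[of n]]
      by (auto simp: hom_complex_sel idx I.M.minus_add intro!: restrict_ext)
  next
    fix r f assume rf: "r \<in> carrier R" "f \<in> carrier (obj ?D n)"
    then have "f x \<in> carrier I" if "x \<in> carrier (obj X (- n))" for x
      using that mod_homD(1) by (auto simp: hom_complex_sel)
    then show "bd ?D n (r \<odot>\<^bsub>obj ?D n\<^esub> f) = r \<odot>\<^bsub>obj ?D (n - 1)\<^esub> bd ?D n f"
      using mod_homD(1)[OF d[of n]] rf(1)
      by (auto simp: hom_complex_sel idx I.smult_r_minus intro!: restrict_ext)
  qed
  fix f assume f: "f \<in> carrier (obj ?D n)"
  have f0: "f \<zero>\<^bsub>obj X (- n)\<^esub> = \<zero>\<^bsub>I\<^esub>"
    using mod_hom_zero[OF mX assms(2)] f by (simp add: hom_complex_sel)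
  have dd: "bd X (1 - n) (bd X (2 - n) x) = \<zero>\<^bsub>obj X (- n)\<^esub>" if "x \<in> carrier (obj X (2 - n))" for x
    using is_complexD(5)[OF assms(1), of x "1 - n"] that by (simp add: add.commute)
  have dc: "bd X (2 - n) x \<in> carrier (obj X (1 - n))" if "x \<in> carrier (obj X (2 - n))" for x
    using mod_homD(1)[OF is_complexD(2)[OF assms(1), of "2 - n"]] that by simp
  show "bd ?D (n - 1) (bd ?D n f) = \<zero>\<^bsub>obj ?D (n - 1 - 1)\<^esub>"
    using dd dc f0 I.module_minus_zero by (auto simp: hom_complex_sel intro!: restrict_ext)
qed

lemma hom_complex_cycles:
  assumes "is_complex R X" "module R I"
  shows "f \<in> cycles (hom_complex R X I) (- n) \<longleftrightarrow>
    f \<in> mod_hom R (obj X n) I \<and> f \<in> extensional (carrier (obj X n)) \<and>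
    (\<forall>b \<in> boundaries X n. f b = \<zero>\<^bsub>I\<^esub>)"
proof -
  interpret I: module R I by fact
  have idx: "1 - - n = n + 1" "- (- n - 1) = n + 1" by simp_all
  have "bd (hom_complex R X I) (- n) f = \<zero>\<^bsub>obj (hom_complex R X I) (- n - 1)\<^esub> \<longleftrightarrow>
      (\<forall>b \<in> boundaries X n. f b = \<zero>\<^bsub>I\<^esub>)" if f: "f \<in> mod_hom R (obj X n) I"
  proof -
    have fc: "f (bd X (n + 1) x) \<in> carrier I" if "x \<in> carrier (obj X (n + 1))" for x
      using mod_homD(1)[OF f] mod_homD(1)[OF is_complexD(4)[OF assms(1)]] that by blast
    have neg: "\<ominus>\<^bsub>I\<^esub> a = \<zero>\<^bsub>I\<^esub> \<longleftrightarrow> a = \<zero>\<^bsub>I\<^esub>" if "a \<in> carrier I" for a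
      using I.M.minus_minus[OF that] I.module_minus_zero by auto
    have "bd (hom_complex R X I) (- n) f = \<zero>\<^bsub>obj (hom_complex R X I) (- n - 1)\<^esub> \<longleftrightarrow>
        (\<forall>x \<in> carrier (obj X (n + 1)). f (bd X (n + 1) x) = \<zero>\<^bsub>I\<^esub>)"
      unfolding hom_complex_sel hom_mod_sel idx
      by (auto simp: restrict_def fun_eq_iff neg fc)
    then show ?thesis by (simp add: boundaries_def)
  qed
  then show ?thesis by (auto simp: cycles_def hom_complex_sel(1))
qed

text \<open>The sign of the differential is absorbed into \<open>g\<close>.\<close>

lemma hom_complex_boundaries:
  assumes "is_complex R X" "module R I"
  shows "h \<in> boundaries (hom_complex R X I) (- n) \<longleftrightarrow>
    (\<exists>g \<in> mod_hom R (obj X (n - 1)) I. h = (\<lambda>x\<in>carrier (obj X n). g (bd X n x)))"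
proof -
  interpret I: module R I by fact
  have idx: "1 - (- n + 1) = n" "- (- n + 1) = n - 1" by simp_all
  note dc = mod_homD(1)[OF is_complexD(2)[OF assms(1), of n]]
  let ?sgn = "\<lambda>g x. if even (- n + 1) then \<ominus>\<^bsub>I\<^esub> g x else g x"
  have sgn: "?sgn g \<in> mod_hom R (obj X (n - 1)) I" if "g \<in> mod_hom R (obj X (n - 1)) I" for g
    using that mod_hom_minus[OF assms(2) that] by (cases "even (- n + 1)") auto
  have bd: "bd (hom_complex R X I) (- n + 1) f = (\<lambda>x\<in>carrier (obj X n). ?sgn f (bd X n x))" for f
    unfolding hom_complex_sel idx ..
  show ?thesis
  proof
    assume "h \<in> boundaries (hom_complex R X I) (- n)"
    then obtain f where f: "f \<in> mod_hom R (obj X (n - 1)) I"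
      "h = (\<lambda>x\<in>carrier (obj X n). ?sgn f (bd X n x))"
      unfolding boundaries_def bd hom_complex_sel(1) idx hom_mod_sel by blast
    show "\<exists>g \<in> mod_hom R (obj X (n - 1)) I. h = (\<lambda>x\<in>carrier (obj X n). g (bd X n x))"
      by (rule bexI[where x = "?sgn f"]) (fact f(2), rule sgn[OF f(1)])
  next
    assume "\<exists>g \<in> mod_hom R (obj X (n - 1)) I. h = (\<lambda>x\<in>carrier (obj X n). g (bd X n x))"
    then obtain g where g: "g \<in> mod_hom R (obj X (n - 1)) I"
      "h = (\<lambda>x\<in>carrier (obj X n). g (bd X n x))" by blast
    let ?f = "\<lambda>x\<in>carrier (obj X (n - 1)). ?sgn g x"
    have "h = bd (hom_complex R X I) (- n + 1) ?f"
      unfolding bd g(2) using dc mod_homD(1)[OF g(1)] by (auto intro!: restrict_ext)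
    moreover have "?f \<in> carrier (obj (hom_complex R X I) (- n + 1))"
      unfolding hom_complex_sel(1) idx hom_mod_sel
      using mod_hom_restrict[OF is_complexD(1)[OF assms(1)] sgn[OF g(1)]] by blast
    ultimately show "h \<in> boundaries (hom_complex R X I) (- n)" unfolding boundaries_def by blast
  qed
qed

text \<open>
  If \<open>s\<close> kills \<open>H\<^sub>n(X)\<close> and \<open>f\<close> is a cocycle, then \<open>s f\<close> vanishes on the cycles, hence factors through
  the differential \<open>X\<^sub>n \<rightarrow> X\<^bsub>n-1\<^esub>\<close>; injectivity extends the factor from the boundaries to all of
  \<open>X\<^bsub>n-1\<^esub>\<close>. This is the part of \<open>H(Hom(X, I)) = Hom(H(X), I)\<close> that is needed here.
\<close>

lemma hom_complex_annihilator:
  assumes "is_complex R X" "baer_injective R I" "s \<in> carrier R"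
    and kill: "\<And>z. z \<in> cycles X n \<Longrightarrow> s \<odot>\<^bsub>obj X n\<^esub> z \<in> boundaries X n"
    and f: "f \<in> cycles (hom_complex R X I) (- n)"
  shows "s \<odot>\<^bsub>obj (hom_complex R X I) (- n)\<^esub> f \<in> boundaries (hom_complex R X I) (- n)"
proof -
  interpret I: module R I using assms(2) unfolding baer_injective_def by blast
  note I = I.module_axioms
  interpret M: module R "obj X n" by (rule is_complexD(1)[OF assms(1)])
  interpret N: module R "obj X (n - 1)" by (rule is_complexD(1)[OF assms(1)])
  have fh: "f \<in> mod_hom R (obj X n) I" and f0: "\<And>b. b \<in> boundaries X n \<Longrightarrow> f b = \<zero>\<^bsub>I\<^esub>"
    using f hom_complex_cycles[OF assms(1) I] by blast+
  note fD = mod_homD[OF fh] and dD = mod_homD[OF is_complexD(2)[OF assms(1), of n]]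
  \<comment> \<open>the factor of \<open>s f\<close> through the differential; it is well defined because \<open>s f\<close> kills the cycles\<close>
  let ?G = "(\<lambda>x. (bd X n x, s \<odot>\<^bsub>I\<^esub> f x)) ` carrier (obj X n)"
  have mem: "(bd X n x, s \<odot>\<^bsub>I\<^esub> f x) \<in> ?G" if "x \<in> carrier (obj X n)" for x using that by blast
  have "linear_graph R (obj X (n - 1)) I ?G"
  proof (rule linear_graphI)
    fix y a assume "(y, a) \<in> ?G"
    then show "y \<in> carrier (obj X (n - 1)) \<and> a \<in> carrier I" using dD(1) fD(1) assms(3) by auto
  next
    show "(\<zero>\<^bsub>obj X (n - 1)\<^esub>, \<zero>\<^bsub>I\<^esub>) \<in> ?G"
      using mem[of "\<zero>\<^bsub>obj X n\<^esub>"] assms(3) mod_hom_zero[OF M.module_axioms I fh]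
        mod_hom_zero[OF M.module_axioms N.module_axioms is_complexD(2)[OF assms(1)]] by simp
  next
    fix y a z b assume "(y, a) \<in> ?G" "(z, b) \<in> ?G"
    then obtain v w where "v \<in> carrier (obj X n)" "y = bd X n v" "a = s \<odot>\<^bsub>I\<^esub> f v"
      "w \<in> carrier (obj X n)" "z = bd X n w" "b = s \<odot>\<^bsub>I\<^esub> f w" by blast
    then show "(y \<oplus>\<^bsub>obj X (n - 1)\<^esub> z, a \<oplus>\<^bsub>I\<^esub> b) \<in> ?G"
      using mem[of "v \<oplus>\<^bsub>obj X n\<^esub> w"] assms(3) by (simp add: fD dD I.smult_r_distr)
  next
    fix r y a assume r: "r \<in> carrier R" and "(y, a) \<in> ?G"
    then obtain v where v: "v \<in> carrier (obj X n)" "y = bd X n v" "a = s \<odot>\<^bsub>I\<^esub> f v" by blast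
    have "r \<odot>\<^bsub>I\<^esub> (s \<odot>\<^bsub>I\<^esub> f v) = s \<odot>\<^bsub>I\<^esub> (r \<odot>\<^bsub>I\<^esub> f v)"
      using r v assms(3) fD(1) by (simp add: I.smult_assoc1[symmetric] I.R.m_comm)
    then show "(r \<odot>\<^bsub>obj X (n - 1)\<^esub> y, r \<odot>\<^bsub>I\<^esub> a) \<in> ?G"
      using mem[of "r \<odot>\<^bsub>obj X n\<^esub> v"] assms(3) v r by (simp add: fD dD)
  next
    fix a assume "(\<zero>\<^bsub>obj X (n - 1)\<^esub>, a) \<in> ?G"
    then obtain v where v: "v \<in> carrier (obj X n)" "bd X n v = \<zero>\<^bsub>obj X (n - 1)\<^esub>" "a = s \<odot>\<^bsub>I\<^esub> f v"
      by auto
    then have "f (s \<odot>\<^bsub>obj X n\<^esub> v) = \<zero>\<^bsub>I\<^esub>" using kill f0 by (simp add: cycles_def)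
    then show "a = \<zero>\<^bsub>I\<^esub>" using v assms(3) by (simp add: fD)
  qed
  then obtain g where g: "g \<in> mod_hom R (obj X (n - 1)) I" "\<forall>(y, a) \<in> ?G. g y = a"
    using extend_linear_graph[OF N.module_axioms assms(2)] by blast
  have "s \<odot>\<^bsub>obj (hom_complex R X I) (- n)\<^esub> f = (\<lambda>x\<in>carrier (obj X n). g (bd X n x))"
    using g(2) by (auto simp: hom_complex_sel(1) intro!: restrict_ext)
  then show ?thesis using hom_complex_boundaries[OF assms(1) I] g(1) by blast
qed

text \<open>
  \<open>Hom(-, I)\<close> reflects exactness because a cycle that is not a boundary is separated from the boundaries
  by some map to \<open>I\<close>, which is a cocycle but cannot be a coboundary. Exactness is preserved because
  \<open>s = 1\<close> is an admissible annihilator in the previous lemma.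
\<close>

lemma exact_hom_complex_iff:
  assumes "is_complex R X" "baer_injective R I" "cogenerating R I"
  shows "exact_complex (hom_complex R X I) \<longleftrightarrow> exact_complex X"
proof
  interpret I: module R I using assms(2) unfolding baer_injective_def by blast
  note I = I.module_axioms
  let ?D = "hom_complex R X I"
  show "exact_complex ?D" if ex: "exact_complex X"
  proof -
    have "f \<in> boundaries ?D n" if f: "f \<in> cycles ?D n" for f n
    proof -
      interpret D: module R "obj ?D n"
        by (rule is_complexD(1)[OF hom_complex_is_complex[OF assms(1) I]])
      interpret M: module R "obj X (- n)" by (rule is_complexD(1)[OF assms(1)])
      have "\<one>\<^bsub>R\<^esub> \<odot>\<^bsub>obj X (- n)\<^esub> z \<in> boundaries X (- n)" if "z \<in> cycles X (- n)" for z
        using ex that unfolding exact_complex_def by (auto simp: cycles_def)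
      from hom_complex_annihilator[OF assms(1,2) _ this, of f]
      have "\<one>\<^bsub>R\<^esub> \<odot>\<^bsub>obj ?D n\<^esub> f \<in> boundaries ?D n" using f by simp
      then show ?thesis using f by (simp add: cycles_def)
    qed
    then show ?thesis unfolding exact_complex_def by blast
  qed
  assume ex: "exact_complex ?D"
  have "z \<in> boundaries X n" if z: "z \<in> cycles X n" for z n
  proof (rule ccontr)
    assume nb: "z \<notin> boundaries X n"
    have zc: "z \<in> carrier (obj X n)" "bd X n z = \<zero>\<^bsub>obj X (n - 1)\<^esub>"
      using z by (simp_all add: cycles_def)
    obtain \<phi> where \<phi>: "\<phi> \<in> mod_hom R (obj X n) I" "\<forall>b \<in> boundaries X n. \<phi> b = \<zero>\<^bsub>I\<^esub>" "\<phi> z \<noteq> \<zero>\<^bsub>I\<^esub>"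
      using separate_from_submodule[OF is_complexD(1)[OF assms(1)] assms(2,3)
          boundaries_submodule[OF assms(1)] zc(1) nb] by blast
    let ?f = "\<lambda>x\<in>carrier (obj X n). \<phi> x"
    have sub: "b \<in> carrier (obj X n)" if "b \<in> boundaries X n" for b
      using boundaries_subset_cycles[OF assms(1)] that by (auto simp: cycles_def)
    have "?f \<in> cycles ?D (- n)"
      unfolding hom_complex_cycles[OF assms(1) I]
      using mod_hom_restrict[OF is_complexD(1)[OF assms(1)] \<phi>(1)] \<phi>(2) sub by simp
    then have "?f \<in> boundaries ?D (- n)" using ex unfolding exact_complex_def by blast
    then obtain g where g: "g \<in> mod_hom R (obj X (n - 1)) I"
      "?f = (\<lambda>x\<in>carrier (obj X n). g (bd X n x))"
      unfolding hom_complex_boundaries[OF assms(1) I] by blast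
    have "\<phi> z = g \<zero>\<^bsub>obj X (n - 1)\<^esub>" using fun_cong[OF g(2), of z] zc by simp
    also have "\<dots> = \<zero>\<^bsub>I\<^esub>" by (rule mod_hom_zero[OF is_complexD(1)[OF assms(1)] I g(1)])
    finally show False using \<phi>(3) by blast
  qed
  then show "exact_complex X" unfolding exact_complex_def by blast
qed

text \<open>
  Evaluation at a cycle \<open>z\<close> is a cycle \<open>w\<close> of the double dual. If \<open>s w\<close> is a boundary, then every map to
  \<open>I\<close> that vanishes on the boundaries also vanishes at \<open>s z\<close>; since \<open>I\<close> is a cogenerator this makes
  \<open>s z\<close> a boundary. In other words, \<open>H(X) \<rightarrow> H(Hom(Hom(X, I), I))\<close> is injective.
\<close>

lemma double_dual_evaluation:
  assumes "is_complex R X" "baer_injective R I" "cogenerating R I" and z: "z \<in> cycles X n"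
  defines "DD \<equiv> hom_complex R (hom_complex R X I) I"
  shows "\<exists>w \<in> cycles DD n. \<forall>s \<in> carrier R.
    s \<odot>\<^bsub>obj DD n\<^esub> w \<in> boundaries DD n \<longrightarrow> s \<odot>\<^bsub>obj X n\<^esub> z \<in> boundaries X n"
proof -
  interpret I: module R I using assms(2) unfolding baer_injective_def by blast
  note I = I.module_axioms
  interpret M: module R "obj X n" by (rule is_complexD(1)[OF assms(1)])
  let ?D = "hom_complex R X I"
  note D = hom_complex_is_complex[OF assms(1) I]
  have zc: "z \<in> carrier (obj X n)" "bd X n z = \<zero>\<^bsub>obj X (n - 1)\<^esub>"
    using z by (simp_all add: cycles_def)
  have objD: "obj ?D (- n) = hom_mod R (obj X n) I" by (simp add: hom_complex_sel)
  let ?w = "\<lambda>f\<in>carrier (obj ?D (- n)). f z"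
  have "(\<lambda>f. f z) \<in> mod_hom R (obj ?D (- n)) I"
    using zc(1) mod_homD(1)[OF _ zc(1)] by (intro mod_homI) (auto simp: objD)
  then have wh: "?w \<in> mod_hom R (obj ?D (- n)) I" by (rule mod_hom_restrict[OF is_complexD(1)[OF D]])
  have w0: "?w b = \<zero>\<^bsub>I\<^esub>" if b: "b \<in> boundaries ?D (- n)" for b
  proof -
    obtain g where g: "g \<in> mod_hom R (obj X (n - 1)) I" "b = (\<lambda>x\<in>carrier (obj X n). g (bd X n x))"
      using b unfolding hom_complex_boundaries[OF assms(1) I] by blast
    have "b \<in> carrier (obj ?D (- n))"
      using b boundaries_subset_cycles[OF D] by (auto simp: cycles_def)
    then show ?thesis
      using g zc mod_hom_zero[OF is_complexD(1)[OF assms(1)] I g(1)] by simp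
  qed
  have "?w \<in> cycles DD (- (- n))"
    unfolding DD_def hom_complex_cycles[OF D I] using wh w0 by simp
  then have "?w \<in> cycles DD n" by simp
  moreover have "s \<odot>\<^bsub>obj X n\<^esub> z \<in> boundaries X n"
    if s: "s \<in> carrier R" and sw: "s \<odot>\<^bsub>obj DD n\<^esub> ?w \<in> boundaries DD n" for s
  proof (rule ccontr)
    assume nb: "s \<odot>\<^bsub>obj X n\<^esub> z \<notin> boundaries X n"
    obtain \<phi> where \<phi>: "\<phi> \<in> mod_hom R (obj X n) I" "\<forall>b \<in> boundaries X n. \<phi> b = \<zero>\<^bsub>I\<^esub>"
      "\<phi> (s \<odot>\<^bsub>obj X n\<^esub> z) \<noteq> \<zero>\<^bsub>I\<^esub>"
      using separate_from_submodule[OF M.module_axioms assms(2,3)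
          boundaries_submodule[OF assms(1)] M.smult_closed[OF s zc(1)] nb] by blast
    let ?f = "\<lambda>x\<in>carrier (obj X n). \<phi> x"
    have sub: "b \<in> carrier (obj X n)" if "b \<in> boundaries X n" for b
      using boundaries_subset_cycles[OF assms(1)] that by (auto simp: cycles_def)
    have "?f \<in> cycles ?D (- n)"
      unfolding hom_complex_cycles[OF assms(1) I]
      using mod_hom_restrict[OF is_complexD(1)[OF assms(1)] \<phi>(1)] \<phi>(2) sub by simp
    then have fc: "?f \<in> carrier (obj ?D (- n))"
      and f0: "bd ?D (- n) ?f = \<zero>\<^bsub>obj ?D (- n - 1)\<^esub>" unfolding cycles_def by blast+
    have "s \<odot>\<^bsub>obj DD n\<^esub> ?w \<in> boundaries DD (- (- n))" using sw by simp
    then obtain \<psi> where \<psi>: "\<psi> \<in> mod_hom R (obj ?D (- n - 1)) I"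
      "s \<odot>\<^bsub>obj DD n\<^esub> ?w = (\<lambda>f\<in>carrier (obj ?D (- n)). \<psi> (bd ?D (- n) f))"
      unfolding DD_def hom_complex_boundaries[OF D I] by blast
    have "(s \<odot>\<^bsub>obj DD n\<^esub> ?w) ?f = \<zero>\<^bsub>I\<^esub>"
      unfolding \<psi>(2) using fc f0 mod_hom_zero[OF is_complexD(1)[OF D] I \<psi>(1)] by simp
    moreover have "(s \<odot>\<^bsub>obj DD n\<^esub> ?w) ?f = s \<odot>\<^bsub>I\<^esub> \<phi> z"
      using fc zc(1) by (simp add: DD_def hom_complex_sel(1)[of R "hom_complex R X I"])
    ultimately show False using \<phi>(3) mod_homD(3)[OF \<phi>(1) s zc(1)] by simp
  qed
  ultimately show ?thesis by blast
qed

text \<open>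
  Each generator of a finitely generated homology module is killed by some element outside \<open>p\<close>; the
  product of these elements kills the whole module.
\<close>

lemma noetherian_uniform_annihilator:
  assumes "is_complex R X" "primeideal p R" "noetherian_mod R (homology X n)"
    and loc: "\<And>z. z \<in> cycles X n \<Longrightarrow> \<exists>s \<in> carrier R - p. s \<odot>\<^bsub>obj X n\<^esub> z \<in> boundaries X n"
  shows "\<exists>s \<in> carrier R - p. \<forall>z \<in> cycles X n. s \<odot>\<^bsub>obj X n\<^esub> z \<in> boundaries X n"
proof -
  interpret p: primeideal p R by fact
  interpret H: module R "homology X n" using assms(3) unfolding noetherian_mod_def by blast
  let ?M = "obj X n\<lparr>carrier := cycles X n\<rparr>"
  let ?B = "boundaries X n"
  have Zc: "z \<in> carrier (obj X n)" if "z \<in> cycles X n" for z using that by (simp add: cycles_def)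
  interpret Z: module R ?M
    by (rule submodule.submodule_is_module[OF cycles_submodule[OF assms(1)] is_complexD(1)[OF assms(1)]])
  interpret M: module R "obj X n" by (rule is_complexD(1)[OF assms(1)])
  note B = M.submoduleE[OF boundaries_submodule[OF assms(1), of n]]
  have "a_inv ?M b \<in> ?B" if "b \<in> ?B" for b
    using Z.minus_eq_smult[of b] M.minus_eq_smult[of b] B(3)[OF that] that
      boundaries_subset_cycles[OF assms(1), of n] Zc[of b] by auto
  then have BZ: "submodule ?B R ?M"
    using B boundaries_subset_cycles[OF assms(1)] zero_in_boundaries[OF assms(1)]
    by (intro Z.submoduleI) simp_all
  have smult: "s \<odot>\<^bsub>homology X n\<^esub> (?B +>\<^bsub>obj X n\<^esub> z) = ?B +>\<^bsub>obj X n\<^esub> (s \<odot>\<^bsub>obj X n\<^esub> z)"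
    if "s \<in> carrier R" "z \<in> cycles X n" for s z
    using quot_mod_smult[OF Z.module_axioms BZ that(1), of z] that(2) by (simp add: homology_def)
  have zero: "\<zero>\<^bsub>homology X n\<^esub> = ?B" by (simp add: homology_def quot_mod_def)
  have kill_iff: "s \<odot>\<^bsub>homology X n\<^esub> (?B +>\<^bsub>obj X n\<^esub> z) = \<zero>\<^bsub>homology X n\<^esub> \<longleftrightarrow> s \<odot>\<^bsub>obj X n\<^esub> z \<in> ?B"
    if "s \<in> carrier R" "z \<in> cycles X n" for s z
    using smult[OF that] zero boundary_coset_iff[OF assms(1), of "s \<odot>\<^bsub>obj X n\<^esub> z"]
      Z.smult_closed[OF that(1), of z] that(2) by simp
  have loc': "\<exists>s \<in> carrier R - p. s \<odot>\<^bsub>homology X n\<^esub> C = \<zero>\<^bsub>homology X n\<^esub>"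
    if C: "C \<in> carrier (homology X n)" for C
  proof -
    obtain z where z: "C = ?B +>\<^bsub>obj X n\<^esub> z" "z \<in> cycles X n"
      using C unfolding homology_carrier by (rule imageE)
    obtain s where s: "s \<in> carrier R - p" "s \<odot>\<^bsub>obj X n\<^esub> z \<in> ?B"
      using loc[OF z(2)] by (rule bexE)
    then have "s \<odot>\<^bsub>homology X n\<^esub> C = \<zero>\<^bsub>homology X n\<^esub>" using kill_iff[of s z] z by simp
    then show ?thesis using s(1) by (rule bexI)
  qed
  obtain A where A: "A \<subseteq> carrier (homology X n)" "finite A"
    "carrier (homology X n) = generated_submod R (homology X n) A"
    using assms(3) H.carrier_is_submodule unfolding noetherian_mod_def by blast
  have "\<exists>s \<in> carrier R - p. \<forall>C \<in> A. s \<odot>\<^bsub>homology X n\<^esub> C = \<zero>\<^bsub>homology X n\<^esub>"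
    using A(2,1)
  proof (induction rule: finite_induct)
    case empty
    have "\<one>\<^bsub>R\<^esub> \<in> carrier R - p" using p.one_imp_carrier p.I_notcarr by auto
    then show ?case by blast
  next
    case (insert C A)
    obtain s where s: "s \<in> carrier R - p" "\<forall>C \<in> A. s \<odot>\<^bsub>homology X n\<^esub> C = \<zero>\<^bsub>homology X n\<^esub>"
      using insert.IH insert.prems by blast
    obtain t where t: "t \<in> carrier R - p" "t \<odot>\<^bsub>homology X n\<^esub> C = \<zero>\<^bsub>homology X n\<^esub>"
      using loc'[of C] insert.prems by blast
    have "s \<otimes>\<^bsub>R\<^esub> t \<in> carrier R - p" using s(1) t(1) p.I_prime by auto
    moreover have "s \<otimes>\<^bsub>R\<^esub> t \<odot>\<^bsub>homology X n\<^esub> C' = \<zero>\<^bsub>homology X n\<^esub>" if C': "C' \<in> insert C A" for C'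
    proof (cases "C' = C")
      case True
      then show ?thesis using s t insert.prems by (simp add: H.smult_assoc1)
    next
      case False
      then have "C' \<in> A" "C' \<in> carrier (homology X n)" using C' insert.prems by auto
      then show ?thesis using s t by (simp add: p.m_comm[of s t] H.smult_assoc1)
    qed
    ultimately show ?case by blast
  qed
  then obtain s where s: "s \<in> carrier R - p" "\<forall>C \<in> A. s \<odot>\<^bsub>homology X n\<^esub> C = \<zero>\<^bsub>homology X n\<^esub>" by blast
  \<comment> \<open>the classes killed by \<open>s\<close> form a submodule, which contains the generators\<close>
  let ?N = "{C \<in> carrier (homology X n). s \<odot>\<^bsub>homology X n\<^esub> C = \<zero>\<^bsub>homology X n\<^esub>}"
  have "submodule ?N R (homology X n)"
  proof (rule H.submoduleI)
    fix a C assume a: "a \<in> carrier R" and N: "C \<in> ?N"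
    then have C: "C \<in> carrier (homology X n)" by simp
    have "s \<odot>\<^bsub>homology X n\<^esub> (a \<odot>\<^bsub>homology X n\<^esub> C) = a \<odot>\<^bsub>homology X n\<^esub> (s \<odot>\<^bsub>homology X n\<^esub> C)"
      using H.smult_assoc1[of s a C] H.smult_assoc1[of a s C] p.m_comm[of s a] a C s(1) by auto
    then show "a \<odot>\<^bsub>homology X n\<^esub> C \<in> ?N" using a N by simp
  qed (use s(1) in \<open>auto simp: H.smult_r_minus H.smult_r_distr H.module_minus_zero\<close>)
  then have "carrier (homology X n) \<subseteq> ?N"
    unfolding A(3) generated_submod_def using s(2) A(1) A(3) unfolding generated_submod_def by blast
  then have "s \<odot>\<^bsub>obj X n\<^esub> z \<in> ?B" if "z \<in> cycles X n" for z
    using kill_iff[of s z] that s(1) unfolding homology_carrier by blast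
  then show ?thesis using s(1) by blast
qed

section \<open>Localization at a prime ideal\<close>

lemma prime_complement_mult:
  assumes "primeideal p R" "s \<in> carrier R - p" "t \<in> carrier R - p"
  shows "s \<otimes>\<^bsub>R\<^esub> t \<in> carrier R - p"
proof -
  interpret p: primeideal p R by fact
  show ?thesis using assms(2,3) p.I_prime[of s t] by auto
qed

lemma prime_complement_one:
  assumes "primeideal p R"
  shows "\<one>\<^bsub>R\<^esub> \<in> carrier R - p"
proof -
  interpret p: primeideal p R by fact
  show ?thesis using p.one_imp_carrier p.I_notcarr by auto
qed

lemma frac_rel_iff:
  "((m, s), (n, t)) \<in> frac_rel R p M \<longleftrightarrow>
     m \<in> carrier M \<and> n \<in> carrier M \<and> s \<in> carrier R - p \<and> t \<in> carrier R - p \<and>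
     (\<exists>u \<in> carrier R - p. u \<odot>\<^bsub>M\<^esub> (t \<odot>\<^bsub>M\<^esub> m) = u \<odot>\<^bsub>M\<^esub> (s \<odot>\<^bsub>M\<^esub> n))"
  by (simp add: frac_rel_def)

lemma equiv_frac_rel:
  assumes "primeideal p R" "module R M"
  shows "equiv (carrier M \<times> (carrier R - p)) (frac_rel R p M)"
proof (rule equivI)
  interpret p: primeideal p R by fact
  interpret M: module R M by fact
  show "frac_rel R p M \<subseteq> (carrier M \<times> (carrier R - p)) \<times> (carrier M \<times> (carrier R - p))"
    by (auto simp: frac_rel_iff)
  show "refl_on (carrier M \<times> (carrier R - p)) (frac_rel R p M)"
    using prime_complement_one[OF assms(1)] by (intro refl_onI) (auto simp: frac_rel_iff)
  show "sym (frac_rel R p M)"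
    by (intro symI) (clarsimp simp: frac_rel_iff, metis DiffI)
  show "trans (frac_rel R p M)"
  proof (rule transI, clarify)
    fix m s n t k r
    assume a: "((m, s), (n, t)) \<in> frac_rel R p M" and b: "((n, t), (k, r)) \<in> frac_rel R p M"
    obtain u where u: "u \<in> carrier R - p" "u \<odot>\<^bsub>M\<^esub> (t \<odot>\<^bsub>M\<^esub> m) = u \<odot>\<^bsub>M\<^esub> (s \<odot>\<^bsub>M\<^esub> n)"
      using a unfolding frac_rel_iff by blast
    obtain v where v: "v \<in> carrier R - p" "v \<odot>\<^bsub>M\<^esub> (r \<odot>\<^bsub>M\<^esub> n) = v \<odot>\<^bsub>M\<^esub> (t \<odot>\<^bsub>M\<^esub> k)"
      using b unfolding frac_rel_iff by blast
    have c: "m \<in> carrier M" "n \<in> carrier M" "k \<in> carrier M"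
      "s \<in> carrier R" "t \<in> carrier R" "r \<in> carrier R" "u \<in> carrier R" "v \<in> carrier R"
      using a b u(1) v(1) unfolding frac_rel_iff by blast+
    have "(u \<otimes>\<^bsub>R\<^esub> (v \<otimes>\<^bsub>R\<^esub> t)) \<odot>\<^bsub>M\<^esub> (r \<odot>\<^bsub>M\<^esub> m) = (v \<otimes>\<^bsub>R\<^esub> r) \<odot>\<^bsub>M\<^esub> (u \<odot>\<^bsub>M\<^esub> (t \<odot>\<^bsub>M\<^esub> m))"
      using c by (simp add: M.smult_assoc1[symmetric] p.m_ac)
    also have "\<dots> = (u \<otimes>\<^bsub>R\<^esub> s) \<odot>\<^bsub>M\<^esub> (v \<odot>\<^bsub>M\<^esub> (r \<odot>\<^bsub>M\<^esub> n))"
      unfolding u(2) using c by (simp add: M.smult_assoc1[symmetric] p.m_ac)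
    also have "\<dots> = (u \<otimes>\<^bsub>R\<^esub> (v \<otimes>\<^bsub>R\<^esub> t)) \<odot>\<^bsub>M\<^esub> (s \<odot>\<^bsub>M\<^esub> k)"
      unfolding v(2) using c by (simp add: M.smult_assoc1[symmetric] p.m_ac)
    finally have "(u \<otimes>\<^bsub>R\<^esub> (v \<otimes>\<^bsub>R\<^esub> t)) \<odot>\<^bsub>M\<^esub> (r \<odot>\<^bsub>M\<^esub> m) = (u \<otimes>\<^bsub>R\<^esub> (v \<otimes>\<^bsub>R\<^esub> t)) \<odot>\<^bsub>M\<^esub> (s \<odot>\<^bsub>M\<^esub> k)" .
    moreover have "u \<otimes>\<^bsub>R\<^esub> (v \<otimes>\<^bsub>R\<^esub> t) \<in> carrier R - p"
      using prime_complement_mult[OF assms(1)] u(1) v(1) a unfolding frac_rel_iff by blast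
    ultimately show "((m, s), (k, r)) \<in> frac_rel R p M"
      using a b unfolding frac_rel_iff by blast
  qed
qed

lemma fraction_eq_iff:
  assumes "primeideal p R" "module R M" "m \<in> carrier M" "n \<in> carrier M"
    and "s \<in> carrier R - p" "t \<in> carrier R - p"
  shows "fraction R p M m s = fraction R p M n t \<longleftrightarrow>
    (\<exists>u \<in> carrier R - p. u \<odot>\<^bsub>M\<^esub> (t \<odot>\<^bsub>M\<^esub> m) = u \<odot>\<^bsub>M\<^esub> (s \<odot>\<^bsub>M\<^esub> n))"
  using eq_equiv_class_iff[OF equiv_frac_rel[OF assms(1,2)], of "(m, s)" "(n, t)"] assms(3-6)
  by (simp add: fraction_def frac_rel_iff)

lemma fraction_mem:
  "(n, t) \<in> fraction R p M m s \<longleftrightarrow> ((m, s), (n, t)) \<in> frac_rel R p M"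
  by (simp add: fraction_def)

lemma fraction_nonempty:
  assumes "primeideal p R" "module R M" "m \<in> carrier M" "s \<in> carrier R - p"
  shows "(m, s) \<in> fraction R p M m s"
  using equiv_class_self[OF equiv_frac_rel[OF assms(1,2)]] assms(3,4) by (simp add: fraction_def)

lemma fraction_eqI:
  assumes "primeideal p R" "module R M" "m \<in> carrier M" "n \<in> carrier M"
    and "s \<in> carrier R - p" "t \<in> carrier R - p" "u \<in> carrier R - p"
    and "u \<odot>\<^bsub>M\<^esub> (t \<odot>\<^bsub>M\<^esub> m) = u \<odot>\<^bsub>M\<^esub> (s \<odot>\<^bsub>M\<^esub> n)"
  shows "fraction R p M m s = fraction R p M n t"
  using fraction_eq_iff[OF assms(1-6)] assms(7,8) by blast

lemma fraction_expand:
  assumes "primeideal p R" "module R M" "m \<in> carrier M" "s \<in> carrier R - p" "u \<in> carrier R - p"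
  shows "fraction R p M (u \<odot>\<^bsub>M\<^esub> m) (u \<otimes>\<^bsub>R\<^esub> s) = fraction R p M m s"
proof -
  interpret p: primeideal p R by fact
  interpret M: module R M by fact
  show ?thesis
    using assms(3-5) prime_complement_mult[OF assms(1)]
    by (intro fraction_eqI[OF assms(1,2) _ _ _ _ prime_complement_one[OF assms(1)]])
      (auto simp: M.smult_assoc1[symmetric] p.m_ac)
qed

lemma loc_mod_carrier:
  "X \<in> carrier (loc_mod R p M) \<longleftrightarrow>
    (\<exists>m \<in> carrier M. \<exists>s \<in> carrier R - p. X = fraction R p M m s)"
  by (auto simp: loc_mod_def fraction_def quotient_def)

lemma fraction_in_carrier:
  "m \<in> carrier M \<Longrightarrow> s \<in> carrier R - p \<Longrightarrow> fraction R p M m s \<in> carrier (loc_mod R p M)"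
  unfolding loc_mod_carrier by blast

text \<open>
  For operations that are defined as unions over all representatives of two equivalence classes.
\<close>

lemma UN_pair_const:
  assumes "x \<in> X" "y \<in> Y" "\<And>m s n t. (m, s) \<in> X \<Longrightarrow> (n, t) \<in> Y \<Longrightarrow> f m s n t = C"
  shows "(\<Union>(m, s)\<in>X. \<Union>(n, t)\<in>Y. f m s n t) = C"
proof (rule UN_constant_eq[OF assms(1)], clarify)
  fix m s assume "(m, s) \<in> X"
  then show "(\<Union>(n, t)\<in>Y. f m s n t) = C"
    using assms(3) by (intro UN_constant_eq[OF assms(2)]) auto
qed

lemma loc_mod_add:
  assumes "primeideal p R" "module R M" "m \<in> carrier M" "n \<in> carrier M"
    and "s \<in> carrier R - p" "t \<in> carrier R - p"
  shows "fraction R p M m s \<oplus>\<^bsub>loc_mod R p M\<^esub> fraction R p M n t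
    = fraction R p M (t \<odot>\<^bsub>M\<^esub> m \<oplus>\<^bsub>M\<^esub> s \<odot>\<^bsub>M\<^esub> n) (s \<otimes>\<^bsub>R\<^esub> t)"
proof -
  interpret p: primeideal p R by fact
  interpret M: module R M by fact
  have "fraction R p M (t' \<odot>\<^bsub>M\<^esub> m' \<oplus>\<^bsub>M\<^esub> s' \<odot>\<^bsub>M\<^esub> n') (s' \<otimes>\<^bsub>R\<^esub> t')
      = fraction R p M (t \<odot>\<^bsub>M\<^esub> m \<oplus>\<^bsub>M\<^esub> s \<odot>\<^bsub>M\<^esub> n) (s \<otimes>\<^bsub>R\<^esub> t)"
    if a: "(m', s') \<in> fraction R p M m s" and b: "(n', t') \<in> fraction R p M n t" for m' s' n' t'
  proof -
    note ab = a[unfolded fraction_mem frac_rel_iff] b[unfolded fraction_mem frac_rel_iff]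
    obtain u where u: "u \<in> carrier R - p" "u \<odot>\<^bsub>M\<^esub> (s' \<odot>\<^bsub>M\<^esub> m) = u \<odot>\<^bsub>M\<^esub> (s \<odot>\<^bsub>M\<^esub> m')"
      using ab(1) by blast
    obtain v where v: "v \<in> carrier R - p" "v \<odot>\<^bsub>M\<^esub> (t' \<odot>\<^bsub>M\<^esub> n) = v \<odot>\<^bsub>M\<^esub> (t \<odot>\<^bsub>M\<^esub> n')"
      using ab(2) by blast
    have c: "m \<in> carrier M" "n \<in> carrier M" "m' \<in> carrier M" "n' \<in> carrier M"
      "s \<in> carrier R" "t \<in> carrier R" "s' \<in> carrier R" "t' \<in> carrier R" "u \<in> carrier R" "v \<in> carrier R"
      using ab u(1) v(1) by blast+
    have "(u \<otimes>\<^bsub>R\<^esub> v) \<odot>\<^bsub>M\<^esub> ((s \<otimes>\<^bsub>R\<^esub> t) \<odot>\<^bsub>M\<^esub> (t' \<odot>\<^bsub>M\<^esub> m'))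
        = (v \<otimes>\<^bsub>R\<^esub> (t \<otimes>\<^bsub>R\<^esub> t')) \<odot>\<^bsub>M\<^esub> (u \<odot>\<^bsub>M\<^esub> (s \<odot>\<^bsub>M\<^esub> m'))"
      using c by (simp add: M.smult_assoc1[symmetric] p.m_ac)
    also have "\<dots> = (u \<otimes>\<^bsub>R\<^esub> v) \<odot>\<^bsub>M\<^esub> ((s' \<otimes>\<^bsub>R\<^esub> t') \<odot>\<^bsub>M\<^esub> (t \<odot>\<^bsub>M\<^esub> m))"
      unfolding u(2)[symmetric] using c by (simp add: M.smult_assoc1[symmetric] p.m_ac)
    finally have 1: "(u \<otimes>\<^bsub>R\<^esub> v) \<odot>\<^bsub>M\<^esub> ((s \<otimes>\<^bsub>R\<^esub> t) \<odot>\<^bsub>M\<^esub> (t' \<odot>\<^bsub>M\<^esub> m'))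
        = (u \<otimes>\<^bsub>R\<^esub> v) \<odot>\<^bsub>M\<^esub> ((s' \<otimes>\<^bsub>R\<^esub> t') \<odot>\<^bsub>M\<^esub> (t \<odot>\<^bsub>M\<^esub> m))" .
    have "(u \<otimes>\<^bsub>R\<^esub> v) \<odot>\<^bsub>M\<^esub> ((s \<otimes>\<^bsub>R\<^esub> t) \<odot>\<^bsub>M\<^esub> (s' \<odot>\<^bsub>M\<^esub> n'))
        = (u \<otimes>\<^bsub>R\<^esub> (s \<otimes>\<^bsub>R\<^esub> s')) \<odot>\<^bsub>M\<^esub> (v \<odot>\<^bsub>M\<^esub> (t \<odot>\<^bsub>M\<^esub> n'))"
      using c by (simp add: M.smult_assoc1[symmetric] p.m_ac)
    also have "\<dots> = (u \<otimes>\<^bsub>R\<^esub> v) \<odot>\<^bsub>M\<^esub> ((s' \<otimes>\<^bsub>R\<^esub> t') \<odot>\<^bsub>M\<^esub> (s \<odot>\<^bsub>M\<^esub> n))"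
      unfolding v(2)[symmetric] using c by (simp add: M.smult_assoc1[symmetric] p.m_ac)
    finally have 2: "(u \<otimes>\<^bsub>R\<^esub> v) \<odot>\<^bsub>M\<^esub> ((s \<otimes>\<^bsub>R\<^esub> t) \<odot>\<^bsub>M\<^esub> (s' \<odot>\<^bsub>M\<^esub> n'))
        = (u \<otimes>\<^bsub>R\<^esub> v) \<odot>\<^bsub>M\<^esub> ((s' \<otimes>\<^bsub>R\<^esub> t') \<odot>\<^bsub>M\<^esub> (s \<odot>\<^bsub>M\<^esub> n))" .
    note pm = prime_complement_mult[OF assms(1)]
    show ?thesis
    proof (rule fraction_eqI[OF assms(1,2)])
      show "u \<otimes>\<^bsub>R\<^esub> v \<in> carrier R - p" by (rule pm[OF u(1) v(1)])
      show "s' \<otimes>\<^bsub>R\<^esub> t' \<in> carrier R - p" "s \<otimes>\<^bsub>R\<^esub> t \<in> carrier R - p"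
        using ab pm by blast+
      show "(u \<otimes>\<^bsub>R\<^esub> v) \<odot>\<^bsub>M\<^esub> ((s \<otimes>\<^bsub>R\<^esub> t) \<odot>\<^bsub>M\<^esub> (t' \<odot>\<^bsub>M\<^esub> m' \<oplus>\<^bsub>M\<^esub> s' \<odot>\<^bsub>M\<^esub> n'))
        = (u \<otimes>\<^bsub>R\<^esub> v) \<odot>\<^bsub>M\<^esub> ((s' \<otimes>\<^bsub>R\<^esub> t') \<odot>\<^bsub>M\<^esub> (t \<odot>\<^bsub>M\<^esub> m \<oplus>\<^bsub>M\<^esub> s \<odot>\<^bsub>M\<^esub> n))"
        using c 1 2 by (simp add: M.smult_r_distr)
    qed (use c in simp_all)
  qed
  from UN_pair_const[OF fraction_nonempty[OF assms(1-3,5)] fraction_nonempty[OF assms(1,2,4,6)] this]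
  show ?thesis by (simp add: loc_mod_def)
qed

lemma loc_mod_smult:
  assumes "primeideal p R" "module R M" "a \<in> carrier R" "m \<in> carrier M"
    and "s \<in> carrier R - p" "t \<in> carrier R - p"
  shows "fraction R p (self_mod R) a s \<odot>\<^bsub>loc_mod R p M\<^esub> fraction R p M m t
    = fraction R p M (a \<odot>\<^bsub>M\<^esub> m) (s \<otimes>\<^bsub>R\<^esub> t)"
proof -
  interpret p: primeideal p R by fact
  interpret M: module R M by fact
  have "fraction R p M (a' \<odot>\<^bsub>M\<^esub> m') (s' \<otimes>\<^bsub>R\<^esub> t') = fraction R p M (a \<odot>\<^bsub>M\<^esub> m) (s \<otimes>\<^bsub>R\<^esub> t)"
    if A: "(a', s') \<in> fraction R p (self_mod R) a s" and b: "(m', t') \<in> fraction R p M m t"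
    for a' s' m' t'
  proof -
    note ab = A[unfolded fraction_mem frac_rel_iff self_mod_sel] b[unfolded fraction_mem frac_rel_iff]
    obtain u where u: "u \<in> carrier R - p" "u \<otimes>\<^bsub>R\<^esub> (s' \<otimes>\<^bsub>R\<^esub> a) = u \<otimes>\<^bsub>R\<^esub> (s \<otimes>\<^bsub>R\<^esub> a')"
      using ab(1) by blast
    obtain v where v: "v \<in> carrier R - p" "v \<odot>\<^bsub>M\<^esub> (t' \<odot>\<^bsub>M\<^esub> m) = v \<odot>\<^bsub>M\<^esub> (t \<odot>\<^bsub>M\<^esub> m')"
      using ab(2) by blast
    have c: "a \<in> carrier R" "a' \<in> carrier R" "m \<in> carrier M" "m' \<in> carrier M"
      "s \<in> carrier R" "t \<in> carrier R" "s' \<in> carrier R" "t' \<in> carrier R" "u \<in> carrier R" "v \<in> carrier R"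
      using ab u(1) v(1) by blast+
    have "(u \<otimes>\<^bsub>R\<^esub> v) \<odot>\<^bsub>M\<^esub> ((s \<otimes>\<^bsub>R\<^esub> t) \<odot>\<^bsub>M\<^esub> (a' \<odot>\<^bsub>M\<^esub> m'))
        = (u \<otimes>\<^bsub>R\<^esub> (s \<otimes>\<^bsub>R\<^esub> a')) \<odot>\<^bsub>M\<^esub> (v \<odot>\<^bsub>M\<^esub> (t \<odot>\<^bsub>M\<^esub> m'))"
      using c by (simp add: M.smult_assoc1[symmetric] p.m_ac)
    also have "\<dots> = (u \<otimes>\<^bsub>R\<^esub> v) \<odot>\<^bsub>M\<^esub> ((s' \<otimes>\<^bsub>R\<^esub> t') \<odot>\<^bsub>M\<^esub> (a \<odot>\<^bsub>M\<^esub> m))"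
      unfolding u(2)[symmetric] v(2)[symmetric]
      using c by (simp add: M.smult_assoc1[symmetric] p.m_ac)
    finally have eq: "(u \<otimes>\<^bsub>R\<^esub> v) \<odot>\<^bsub>M\<^esub> ((s \<otimes>\<^bsub>R\<^esub> t) \<odot>\<^bsub>M\<^esub> (a' \<odot>\<^bsub>M\<^esub> m'))
        = (u \<otimes>\<^bsub>R\<^esub> v) \<odot>\<^bsub>M\<^esub> ((s' \<otimes>\<^bsub>R\<^esub> t') \<odot>\<^bsub>M\<^esub> (a \<odot>\<^bsub>M\<^esub> m))" .
    note pm = prime_complement_mult[OF assms(1)]
    show ?thesis
    proof (rule fraction_eqI[OF assms(1,2) _ _ _ _ _ eq])
      show "u \<otimes>\<^bsub>R\<^esub> v \<in> carrier R - p" by (rule pm[OF u(1) v(1)])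
      show "s' \<otimes>\<^bsub>R\<^esub> t' \<in> carrier R - p" "s \<otimes>\<^bsub>R\<^esub> t \<in> carrier R - p"
        using ab pm by blast+
    qed (use c in simp_all)
  qed
  note eq = this
  have "(a, s) \<in> fraction R p (self_mod R) a s"
    using fraction_nonempty[OF assms(1) self_mod_module[OF p.is_cring], of a s] assms(3,5) by simp
  from UN_pair_const[OF this fraction_nonempty[OF assms(1,2,4,6)] eq]
  show ?thesis by (simp add: loc_mod_def)
qed

lemma loc_mod_zero: "\<zero>\<^bsub>loc_mod R p M\<^esub> = fraction R p M \<zero>\<^bsub>M\<^esub> \<one>\<^bsub>R\<^esub>"
  by (simp add: loc_mod_def)

lemma fraction_zero_iff:
  assumes "primeideal p R" "module R M" "m \<in> carrier M" "s \<in> carrier R - p"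
  shows "fraction R p M m s = \<zero>\<^bsub>loc_mod R p M\<^esub> \<longleftrightarrow> (\<exists>u \<in> carrier R - p. u \<odot>\<^bsub>M\<^esub> m = \<zero>\<^bsub>M\<^esub>)"
proof -
  interpret M: module R M by fact
  show ?thesis
    unfolding loc_mod_zero
    using fraction_eq_iff[OF assms(1-3) M.M.zero_closed assms(4) prime_complement_one[OF assms(1)]]
      assms(3,4) by auto
qed

lemma fraction_zero:
  assumes "primeideal p R" "module R M" "s \<in> carrier R - p"
  shows "fraction R p M \<zero>\<^bsub>M\<^esub> s = \<zero>\<^bsub>loc_mod R p M\<^esub>"
proof -
  interpret M: module R M by fact
  show ?thesis
    using fraction_zero_iff[OF assms(1,2) M.M.zero_closed assms(3)] assms(3) by auto
qed

lemma loc_mod_add_same: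
  assumes "primeideal p R" "module R M" "m \<in> carrier M" "n \<in> carrier M" "s \<in> carrier R - p"
  shows "fraction R p M m s \<oplus>\<^bsub>loc_mod R p M\<^esub> fraction R p M n s = fraction R p M (m \<oplus>\<^bsub>M\<^esub> n) s"
proof -
  interpret M: module R M by fact
  show ?thesis
    using loc_mod_add[OF assms(1-5,5)] fraction_expand[OF assms(1,2) _ assms(5,5), of "m \<oplus>\<^bsub>M\<^esub> n"]
      assms(3-5) by (simp add: M.smult_r_distr)
qed

text \<open>
  With a common denominator the group axioms and distributive laws of \<open>M\<^sub>p\<close> reduce to those of \<open>M\<close>;
  associativity needs it for three fractions at a time.
\<close>

lemma common_denominator:
  assumes "primeideal p R" "module R M" "X \<in> carrier (loc_mod R p M)" "Y \<in> carrier (loc_mod R p M)"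
    and "Z \<in> carrier (loc_mod R p M)"
  shows "\<exists>m \<in> carrier M. \<exists>n \<in> carrier M. \<exists>k \<in> carrier M. \<exists>s \<in> carrier R - p.
    X = fraction R p M m s \<and> Y = fraction R p M n s \<and> Z = fraction R p M k s"
proof -
  interpret p: primeideal p R by fact
  interpret M: module R M by fact
  obtain m s where X: "m \<in> carrier M" "s \<in> carrier R - p" "X = fraction R p M m s"
    using assms(3) unfolding loc_mod_carrier by blast
  obtain n t where Y: "n \<in> carrier M" "t \<in> carrier R - p" "Y = fraction R p M n t"
    using assms(4) unfolding loc_mod_carrier by blast
  obtain k r where Z: "k \<in> carrier M" "r \<in> carrier R - p" "Z = fraction R p M k r"
    using assms(5) unfolding loc_mod_carrier by blast
  note pm = prime_complement_mult[OF assms(1)]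
  let ?d = "s \<otimes>\<^bsub>R\<^esub> (t \<otimes>\<^bsub>R\<^esub> r)"
  have c: "s \<in> carrier R" "t \<in> carrier R" "r \<in> carrier R" using X(2) Y(2) Z(2) by blast+
  have "X = fraction R p M ((t \<otimes>\<^bsub>R\<^esub> r) \<odot>\<^bsub>M\<^esub> m) ?d"
    using fraction_expand[OF assms(1,2) X(1,2) pm[OF Y(2) Z(2)]] X(3) c by (simp add: p.m_ac)
  moreover have "Y = fraction R p M ((s \<otimes>\<^bsub>R\<^esub> r) \<odot>\<^bsub>M\<^esub> n) ?d"
    using fraction_expand[OF assms(1,2) Y(1,2) pm[OF X(2) Z(2)]] Y(3) c by (simp add: p.m_ac)
  moreover have "Z = fraction R p M ((s \<otimes>\<^bsub>R\<^esub> t) \<odot>\<^bsub>M\<^esub> k) ?d"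
    using fraction_expand[OF assms(1,2) Z(1,2) pm[OF X(2) Y(2)]] Z(3) c by (simp add: p.m_ac)
  moreover have "?d \<in> carrier R - p" using pm X(2) Y(2) Z(2) by blast
  ultimately show ?thesis
    using X(1) Y(1) Z(1) M.smult_closed c p.m_closed by metis
qed

lemma loc_mod_abelian_group:
  assumes "primeideal p R" "module R M"
  shows "abelian_group (loc_mod R p M)" (is "abelian_group ?L")
proof (rule abelian_groupI)
  interpret p: primeideal p R by fact
  interpret M: module R M by fact
  note add = loc_mod_add_same[OF assms]
  fix X Y Z assume XYZ: "X \<in> carrier ?L" "Y \<in> carrier ?L" "Z \<in> carrier ?L"
  obtain m n k s where *: "m \<in> carrier M" "n \<in> carrier M" "k \<in> carrier M" "s \<in> carrier R - p"
    "X = fraction R p M m s" "Y = fraction R p M n s" "Z = fraction R p M k s"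
    using common_denominator[OF assms XYZ] by blast
  show "X \<oplus>\<^bsub>?L\<^esub> Y \<oplus>\<^bsub>?L\<^esub> Z = X \<oplus>\<^bsub>?L\<^esub> (Y \<oplus>\<^bsub>?L\<^esub> Z)"
    using * by (simp add: add M.M.a_assoc)
next
  interpret p: primeideal p R by fact
  interpret M: module R M by fact
  note add = loc_mod_add_same[OF assms]
  fix X Y assume XY: "X \<in> carrier ?L" "Y \<in> carrier ?L"
  obtain m n s where *: "m \<in> carrier M" "n \<in> carrier M" "s \<in> carrier R - p"
    "X = fraction R p M m s" "Y = fraction R p M n s"
    using common_denominator[OF assms XY XY(1)] by blast
  show "X \<oplus>\<^bsub>?L\<^esub> Y \<in> carrier ?L"
    using * by (simp add: add fraction_in_carrier)
  show "X \<oplus>\<^bsub>?L\<^esub> Y = Y \<oplus>\<^bsub>?L\<^esub> X"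
    using * by (simp add: add M.M.a_comm)
next
  interpret M: module R M by fact
  show "\<zero>\<^bsub>?L\<^esub> \<in> carrier ?L"
    using fraction_in_carrier[OF M.M.zero_closed prime_complement_one[OF assms(1)]]
    by (simp add: loc_mod_zero)
next
  interpret M: module R M by fact
  fix X assume "X \<in> carrier ?L"
  then obtain m s where *: "m \<in> carrier M" "s \<in> carrier R - p" "X = fraction R p M m s"
    unfolding loc_mod_carrier by blast
  note zero = fraction_zero[OF assms *(2)]
  show "\<zero>\<^bsub>?L\<^esub> \<oplus>\<^bsub>?L\<^esub> X = X"
    using loc_mod_add_same[OF assms M.M.zero_closed *(1,2)] * by (simp add: zero)
  show "\<exists>Y\<in>carrier ?L. Y \<oplus>\<^bsub>?L\<^esub> X = \<zero>\<^bsub>?L\<^esub>"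
    using loc_mod_add_same[OF assms M.M.a_inv_closed[OF *(1)] *(1,2)] *
      fraction_in_carrier[of "\<ominus>\<^bsub>M\<^esub> m" M s R p]
    by (intro bexI[of _ "fraction R p M (\<ominus>\<^bsub>M\<^esub> m) s"]) (simp_all add: zero M.M.l_neg)
qed

lemma loc_ring_sel:
  "carrier (loc_ring R p) = carrier (loc_mod R p (self_mod R))"
  "A \<otimes>\<^bsub>loc_ring R p\<^esub> B = A \<odot>\<^bsub>loc_mod R p (self_mod R)\<^esub> B"
  "\<one>\<^bsub>loc_ring R p\<^esub> = fraction R p (self_mod R) \<one>\<^bsub>R\<^esub> \<one>\<^bsub>R\<^esub>"
  "\<zero>\<^bsub>loc_ring R p\<^esub> = \<zero>\<^bsub>loc_mod R p (self_mod R)\<^esub>"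
  "A \<oplus>\<^bsub>loc_ring R p\<^esub> B = A \<oplus>\<^bsub>loc_mod R p (self_mod R)\<^esub> B"
  by (simp_all add: loc_ring_def Let_def)

text \<open>
  For \<open>M = R\<close> these laws contain associativity, distributivity and the unit law of the ring \<open>R\<^sub>p\<close>.
  They are therefore stated before \<open>R\<^sub>p\<close> is known to be a ring.
\<close>

lemma loc_mod_smult_laws:
  assumes "primeideal p R" "module R M"
    and A: "A \<in> carrier (loc_ring R p)" and B: "B \<in> carrier (loc_ring R p)"
    and X: "X \<in> carrier (loc_mod R p M)" and Y: "Y \<in> carrier (loc_mod R p M)"
  shows "A \<odot>\<^bsub>loc_mod R p M\<^esub> X \<in> carrier (loc_mod R p M)"
    and "(A \<oplus>\<^bsub>loc_ring R p\<^esub> B) \<odot>\<^bsub>loc_mod R p M\<^esub> X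
      = A \<odot>\<^bsub>loc_mod R p M\<^esub> X \<oplus>\<^bsub>loc_mod R p M\<^esub> B \<odot>\<^bsub>loc_mod R p M\<^esub> X"
    and "A \<odot>\<^bsub>loc_mod R p M\<^esub> (X \<oplus>\<^bsub>loc_mod R p M\<^esub> Y)
      = A \<odot>\<^bsub>loc_mod R p M\<^esub> X \<oplus>\<^bsub>loc_mod R p M\<^esub> A \<odot>\<^bsub>loc_mod R p M\<^esub> Y"
    and "(A \<otimes>\<^bsub>loc_ring R p\<^esub> B) \<odot>\<^bsub>loc_mod R p M\<^esub> X
      = A \<odot>\<^bsub>loc_mod R p M\<^esub> (B \<odot>\<^bsub>loc_mod R p M\<^esub> X)"
    and "\<one>\<^bsub>loc_ring R p\<^esub> \<odot>\<^bsub>loc_mod R p M\<^esub> X = X"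
proof -
  interpret p: primeideal p R by fact
  interpret M: module R M by fact
  note S = self_mod_module[OF p.is_cring]
  obtain a b s where ab: "a \<in> carrier R" "b \<in> carrier R" "s \<in> carrier R - p"
    "A = fraction R p (self_mod R) a s" "B = fraction R p (self_mod R) b s"
    using common_denominator[OF assms(1) S A[unfolded loc_ring_sel] B[unfolded loc_ring_sel]
        B[unfolded loc_ring_sel]]
    unfolding self_mod_sel by blast
  obtain m n t where mn: "m \<in> carrier M" "n \<in> carrier M" "t \<in> carrier R - p"
    "X = fraction R p M m t" "Y = fraction R p M n t"
    using common_denominator[OF assms(1,2) X Y Y] by blast
  have st: "s \<otimes>\<^bsub>R\<^esub> t \<in> carrier R - p" "s \<otimes>\<^bsub>R\<^esub> s \<in> carrier R - p"
    using prime_complement_mult[OF assms(1)] ab(3) mn(3) by blast+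
  have sc: "s \<in> carrier R" "t \<in> carrier R" using ab(3) mn(3) by blast+
  note smult = loc_mod_smult[OF assms(1,2)]
  note add = loc_mod_add_same[OF assms(1,2)]
  have addR: "A \<oplus>\<^bsub>loc_ring R p\<^esub> B = fraction R p (self_mod R) (a \<oplus>\<^bsub>R\<^esub> b) s"
    using loc_mod_add_same[OF assms(1) S, of a b s] ab by (simp add: loc_ring_sel)
  have multR: "A \<otimes>\<^bsub>loc_ring R p\<^esub> B = fraction R p (self_mod R) (a \<otimes>\<^bsub>R\<^esub> b) (s \<otimes>\<^bsub>R\<^esub> s)"
    using loc_mod_smult[OF assms(1) S, of a b s s] ab by (simp add: loc_ring_sel)
  show "A \<odot>\<^bsub>loc_mod R p M\<^esub> X \<in> carrier (loc_mod R p M)"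
    using smult[OF ab(1) mn(1) ab(3) mn(3)] fraction_in_carrier[of "a \<odot>\<^bsub>M\<^esub> m" M, OF _ st(1)] ab mn
    by simp
  show "(A \<oplus>\<^bsub>loc_ring R p\<^esub> B) \<odot>\<^bsub>loc_mod R p M\<^esub> X
      = A \<odot>\<^bsub>loc_mod R p M\<^esub> X \<oplus>\<^bsub>loc_mod R p M\<^esub> B \<odot>\<^bsub>loc_mod R p M\<^esub> X"
    unfolding addR unfolding ab(4,5) mn(4)
    using ab mn add[OF _ _ st(1)] by (simp add: smult M.smult_l_distr)
  show "A \<odot>\<^bsub>loc_mod R p M\<^esub> (X \<oplus>\<^bsub>loc_mod R p M\<^esub> Y)
      = A \<odot>\<^bsub>loc_mod R p M\<^esub> X \<oplus>\<^bsub>loc_mod R p M\<^esub> A \<odot>\<^bsub>loc_mod R p M\<^esub> Y"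
    unfolding ab(4) mn(4,5)
    using ab mn add[OF _ _ st(1)] by (simp add: smult add M.smult_r_distr)
  show "(A \<otimes>\<^bsub>loc_ring R p\<^esub> B) \<odot>\<^bsub>loc_mod R p M\<^esub> X
      = A \<odot>\<^bsub>loc_mod R p M\<^esub> (B \<odot>\<^bsub>loc_mod R p M\<^esub> X)"
    unfolding multR unfolding ab(4,5) mn(4)
    using ab mn st by (simp add: smult M.smult_assoc1 p.m_assoc)
  show "\<one>\<^bsub>loc_ring R p\<^esub> \<odot>\<^bsub>loc_mod R p M\<^esub> X = X"
    unfolding loc_ring_sel mn(4)
    using smult[OF p.one_closed mn(1) prime_complement_one[OF assms(1)] mn(3)] mn sc by simp
qed

lemma loc_ring_cring:
  assumes "primeideal p R"
  shows "cring (loc_ring R p)" (is "cring ?L")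
proof -
  interpret p: primeideal p R by fact
  note S = self_mod_module[OF p.is_cring]
  note laws = loc_mod_smult_laws[OF assms S, folded loc_ring_sel]
  note ag = abelian_groupE[OF loc_mod_abelian_group[OF assms S], folded loc_ring_sel]
  have comm: "A \<otimes>\<^bsub>?L\<^esub> B = B \<otimes>\<^bsub>?L\<^esub> A" if AB: "A \<in> carrier ?L" "B \<in> carrier ?L" for A B
  proof -
    obtain a b s where ab: "a \<in> carrier R" "b \<in> carrier R" "s \<in> carrier R - p"
      "A = fraction R p (self_mod R) a s" "B = fraction R p (self_mod R) b s"
      using common_denominator[OF assms S AB[unfolded loc_ring_sel] AB(1)[unfolded loc_ring_sel]]
      unfolding self_mod_sel by blast
    then show ?thesis
      using loc_mod_smult[OF assms S, of a b s s] loc_mod_smult[OF assms S, of b a s s] p.m_comm[of a b]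
      by (simp add: loc_ring_sel)
  qed
  have one: "\<one>\<^bsub>?L\<^esub> \<in> carrier ?L"
    unfolding loc_ring_sel
    by (rule fraction_in_carrier[OF _ prime_complement_one[OF assms]]) simp
  show ?thesis
  proof (rule cringI)
    show "abelian_group ?L" using ag by (intro abelian_groupI) auto
    show "comm_monoid ?L"
      using laws(1,4,5) one comm by (intro comm_monoidI) auto
    show "(A \<oplus>\<^bsub>?L\<^esub> B) \<otimes>\<^bsub>?L\<^esub> C = A \<otimes>\<^bsub>?L\<^esub> C \<oplus>\<^bsub>?L\<^esub> B \<otimes>\<^bsub>?L\<^esub> C"
      if "A \<in> carrier ?L" "B \<in> carrier ?L" "C \<in> carrier ?L" for A B C
      using laws(2) that by blast
  qed
qed

lemma loc_mod_module:
  assumes "primeideal p R" "module R M"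
  shows "module (loc_ring R p) (loc_mod R p M)"
proof (rule moduleI[OF loc_ring_cring[OF assms(1)] loc_mod_abelian_group[OF assms]])
  note laws = loc_mod_smult_laws[OF assms]
  show "A \<odot>\<^bsub>loc_mod R p M\<^esub> X \<in> carrier (loc_mod R p M)"
    if "A \<in> carrier (loc_ring R p)" "X \<in> carrier (loc_mod R p M)" for A X
    by (rule laws(1)[OF that(1,1,2,2)])
  show "\<one>\<^bsub>loc_ring R p\<^esub> \<odot>\<^bsub>loc_mod R p M\<^esub> X = X" if "X \<in> carrier (loc_mod R p M)" for X
    using laws(5)[OF _ _ that that] cring.cring_simprules(6)[OF loc_ring_cring[OF assms(1)]] by blast
qed (rule loc_mod_smult_laws[OF assms]; assumption)+

lemma loc_map_fraction:
  assumes "primeideal p R" "module R M" "module R N" "f \<in> mod_hom R M N"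
    and "m \<in> carrier M" "s \<in> carrier R - p"
  shows "loc_map R p N f (fraction R p M m s) = fraction R p N (f m) s"
proof -
  note f = mod_homD[OF assms(4)]
  interpret M: module R M by fact
  have "fraction R p N (f m') s' = fraction R p N (f m) s"
    if "(m', s') \<in> fraction R p M m s" for m' s'
  proof -
    note r = that[unfolded fraction_mem frac_rel_iff]
    then obtain u where u: "u \<in> carrier R - p" "u \<odot>\<^bsub>M\<^esub> (s' \<odot>\<^bsub>M\<^esub> m) = u \<odot>\<^bsub>M\<^esub> (s \<odot>\<^bsub>M\<^esub> m')" by blast
    have "f (u \<odot>\<^bsub>M\<^esub> (s \<odot>\<^bsub>M\<^esub> m')) = f (u \<odot>\<^bsub>M\<^esub> (s' \<odot>\<^bsub>M\<^esub> m))" using u(2) by simp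
    then show ?thesis
      using r u(1) f by (intro fraction_eqI[OF assms(1,3) _ _ _ _ u(1)]) simp_all
  qed
  then have "\<forall>x \<in> fraction R p M m s. (case x of (m', s') \<Rightarrow> fraction R p N (f m') s')
      = fraction R p N (f m) s" by auto
  from UN_constant_eq[OF fraction_nonempty[OF assms(1,2,5,6)] this]
  show ?thesis by (simp add: loc_map_def)
qed

lemma loc_map_hom:
  assumes "primeideal p R" "module R M" "module R N" "f \<in> mod_hom R M N"
  shows "loc_map R p N f \<in> mod_hom (loc_ring R p) (loc_mod R p M) (loc_mod R p N)"
proof (rule mod_homI)
  note f = mod_homD[OF assms(4)]
  note map = loc_map_fraction[OF assms]
  interpret p: primeideal p R by fact
  interpret M: module R M by fact
  note S = self_mod_module[OF p.is_cring]
  show "loc_map R p N f X \<in> carrier (loc_mod R p N)" if X: "X \<in> carrier (loc_mod R p M)" for X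
  proof -
    obtain m s where "m \<in> carrier M" "s \<in> carrier R - p" "X = fraction R p M m s"
      using X unfolding loc_mod_carrier by blast
    then show ?thesis by (simp add: map f fraction_in_carrier)
  qed
  show "loc_map R p N f (X \<oplus>\<^bsub>loc_mod R p M\<^esub> Y)
      = loc_map R p N f X \<oplus>\<^bsub>loc_mod R p N\<^esub> loc_map R p N f Y"
    if X: "X \<in> carrier (loc_mod R p M)" and Y: "Y \<in> carrier (loc_mod R p M)" for X Y
  proof -
    obtain m n s where "m \<in> carrier M" "n \<in> carrier M" "s \<in> carrier R - p"
      "X = fraction R p M m s" "Y = fraction R p M n s"
      using common_denominator[OF assms(1,2) X Y Y] by blast
    then show ?thesis
      by (simp add: map f loc_mod_add_same[OF assms(1,2)] loc_mod_add_same[OF assms(1,3)])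
  qed
  show "loc_map R p N f (A \<odot>\<^bsub>loc_mod R p M\<^esub> X) = A \<odot>\<^bsub>loc_mod R p N\<^esub> loc_map R p N f X"
    if A: "A \<in> carrier (loc_ring R p)" and X: "X \<in> carrier (loc_mod R p M)" for A X
  proof -
    obtain m s where m: "m \<in> carrier M" "s \<in> carrier R - p" "X = fraction R p M m s"
      using X unfolding loc_mod_carrier by blast
    obtain a t where a: "a \<in> carrier R" "t \<in> carrier R - p" "A = fraction R p (self_mod R) a t"
      using A unfolding loc_ring_sel loc_mod_carrier self_mod_sel by blast
    show ?thesis
      using a m loc_mod_smult[OF assms(1,2) a(1) m(1) a(2) m(2)]
        loc_mod_smult[OF assms(1,3) a(1) f(1)[OF m(1)] a(2) m(2)]
        map[OF M.smult_closed[OF a(1) m(1)] prime_complement_mult[OF assms(1) a(2) m(2)]]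
      by (simp add: map f)
  qed
qed

lemma loc_complex_sel:
  "obj (loc_complex R p X) n = loc_mod R p (obj X n)"
  "bd (loc_complex R p X) n = loc_map R p (obj X (n - 1)) (bd X n)"
  by (simp_all add: loc_complex_def)

lemma loc_complex_is_complex:
  assumes "primeideal p R" "is_complex R X"
  shows "is_complex (loc_ring R p) (loc_complex R p X)"
proof -
  note C = is_complexD[OF assms(2)]
  have "loc_map R p (obj X (n - 1 - 1)) (bd X (n - 1)) (loc_map R p (obj X (n - 1)) (bd X n) Y)
      = \<zero>\<^bsub>loc_mod R p (obj X (n - 1 - 1))\<^esub>" if Y: "Y \<in> carrier (loc_mod R p (obj X n))" for n Y
  proof -
    obtain m s where m: "m \<in> carrier (obj X n)" "s \<in> carrier R - p" "Y = fraction R p (obj X n) m s"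
      using Y unfolding loc_mod_carrier by blast
    show ?thesis
      unfolding m(3) loc_map_fraction[OF assms(1) C(1) C(1) C(2) m(1,2)]
        loc_map_fraction[OF assms(1) C(1) C(1) C(2) mod_homD(1)[OF C(2) m(1)] m(2)] C(3)[OF m(1)]
      by (rule fraction_zero[OF assms(1) C(1) m(2)])
  qed
  then show ?thesis
    unfolding is_complex_def loc_complex_sel
    using loc_mod_module[OF assms(1) C(1)] loc_map_hom[OF assms(1) C(1) C(1) C(2)] by blast
qed

text \<open>
  Since localization commutes with homology, exactness of \<open>X\<^sub>p\<close> means that \<open>H(X)\<^sub>p\<close> vanishes, that is,
  that each homology class is killed by an element outside \<open>p\<close>.
\<close>

lemma exact_loc_complex_iff:
  assumes "primeideal p R" "is_complex R X"
  shows "exact_complex (loc_complex R p X) \<longleftrightarrow>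
    (\<forall>n. \<forall>z \<in> cycles X n. \<exists>s \<in> carrier R - p. s \<odot>\<^bsub>obj X n\<^esub> z \<in> boundaries X n)"
proof
  interpret p: primeideal p R by fact
  note C = is_complexD[OF assms(2)]
  note pm = prime_complement_mult[OF assms(1)] and one = prime_complement_one[OF assms(1)]
  let ?L = "loc_complex R p X"
  have bdL: "bd ?L n (fraction R p (obj X n) m s) = fraction R p (obj X (n - 1)) (bd X n m) s"
    if "m \<in> carrier (obj X n)" "s \<in> carrier R - p" for n m s
    unfolding loc_complex_sel by (rule loc_map_fraction[OF assms(1) C(1) C(1) C(2) that])
  have bdL': "bd ?L (n + 1) (fraction R p (obj X (n + 1)) m s) = fraction R p (obj X n) (bd X (n + 1) m) s"
    if "m \<in> carrier (obj X (n + 1))" "s \<in> carrier R - p" for n m s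
    using bdL[OF that] by simp
  show "exact_complex ?L"
    if H: "\<forall>n. \<forall>z \<in> cycles X n. \<exists>s \<in> carrier R - p. s \<odot>\<^bsub>obj X n\<^esub> z \<in> boundaries X n"
    unfolding exact_complex_def
  proof (intro allI subsetI)
    fix n Y assume Y: "Y \<in> cycles ?L n"
    interpret M: module R "obj X n" by (rule C(1))
    obtain m s where m: "m \<in> carrier (obj X n)" "s \<in> carrier R - p" "Y = fraction R p (obj X n) m s"
      using Y unfolding cycles_def loc_complex_sel loc_mod_carrier by blast
    have "fraction R p (obj X (n - 1)) (bd X n m) s = \<zero>\<^bsub>loc_mod R p (obj X (n - 1))\<^esub>"
      using Y bdL[OF m(1,2)] m(3) unfolding cycles_def loc_complex_sel by simp
    then obtain u where u: "u \<in> carrier R - p" "u \<odot>\<^bsub>obj X (n - 1)\<^esub> bd X n m = \<zero>\<^bsub>obj X (n - 1)\<^esub>"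
      using fraction_zero_iff[OF assms(1) C(1) mod_homD(1)[OF C(2) m(1)] m(2)] by blast
    then have "u \<odot>\<^bsub>obj X n\<^esub> m \<in> cycles X n"
      using m(1) mod_homD(3)[OF C(2) _ m(1), of u] by (simp add: cycles_def)
    then obtain v where v: "v \<in> carrier R - p" "v \<odot>\<^bsub>obj X n\<^esub> (u \<odot>\<^bsub>obj X n\<^esub> m) \<in> boundaries X n"
      using H by blast
    then obtain w where w: "w \<in> carrier (obj X (n + 1))"
      "v \<odot>\<^bsub>obj X n\<^esub> (u \<odot>\<^bsub>obj X n\<^esub> m) = bd X (n + 1) w"
      unfolding boundaries_def by blast
    have vus: "v \<otimes>\<^bsub>R\<^esub> (u \<otimes>\<^bsub>R\<^esub> s) \<in> carrier R - p" using pm u(1) v(1) m(2) by blast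
    \<comment> \<open>the numerator of \<open>Y\<close> becomes a cycle after multiplication by \<open>u\<close>, and then a boundary by \<open>v\<close>\<close>
    have "Y = fraction R p (obj X n) (v \<odot>\<^bsub>obj X n\<^esub> (u \<odot>\<^bsub>obj X n\<^esub> m)) (v \<otimes>\<^bsub>R\<^esub> (u \<otimes>\<^bsub>R\<^esub> s))"
      using fraction_expand[OF assms(1) C(1) m(1,2) u(1)]
        fraction_expand[OF assms(1) C(1) _ pm[OF u(1) m(2)] v(1), of "u \<odot>\<^bsub>obj X n\<^esub> m"] m u(1) by simp
    then have "Y = bd ?L (n + 1) (fraction R p (obj X (n + 1)) w (v \<otimes>\<^bsub>R\<^esub> (u \<otimes>\<^bsub>R\<^esub> s)))"
      using bdL'[OF w(1) vus] w(2) by simp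
    moreover have "fraction R p (obj X (n + 1)) w (v \<otimes>\<^bsub>R\<^esub> (u \<otimes>\<^bsub>R\<^esub> s)) \<in> carrier (obj ?L (n + 1))"
      unfolding loc_complex_sel by (rule fraction_in_carrier[OF w(1) vus])
    ultimately show "Y \<in> boundaries ?L n" unfolding boundaries_def by blast
  qed
  assume ex: "exact_complex ?L"
  show "\<forall>n. \<forall>z \<in> cycles X n. \<exists>s \<in> carrier R - p. s \<odot>\<^bsub>obj X n\<^esub> z \<in> boundaries X n"
  proof (intro allI ballI)
    fix n z assume z: "z \<in> cycles X n"
    interpret M: module R "obj X n" by (rule C(1))
    have zc: "z \<in> carrier (obj X n)" "bd X n z = \<zero>\<^bsub>obj X (n - 1)\<^esub>" using z by (simp_all add: cycles_def)
    have "fraction R p (obj X n) z \<one>\<^bsub>R\<^esub> \<in> cycles ?L n"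
      using bdL[OF zc(1) one] fraction_in_carrier[OF zc(1) one] zc(2)
      by (simp add: cycles_def loc_complex_sel loc_mod_zero)
    then obtain W where W: "W \<in> carrier (obj ?L (n + 1))" "fraction R p (obj X n) z \<one>\<^bsub>R\<^esub> = bd ?L (n + 1) W"
      using ex unfolding exact_complex_def boundaries_def by blast
    obtain w t where w: "w \<in> carrier (obj X (n + 1))" "t \<in> carrier R - p" "W = fraction R p (obj X (n + 1)) w t"
      using W(1) unfolding loc_complex_sel loc_mod_carrier by blast
    have "fraction R p (obj X n) z \<one>\<^bsub>R\<^esub> = fraction R p (obj X n) (bd X (n + 1) w) t"
      using W(2) bdL'[OF w(1,2)] w(3) by simp
    then obtain u where u: "u \<in> carrier R - p"
      "u \<odot>\<^bsub>obj X n\<^esub> (t \<odot>\<^bsub>obj X n\<^esub> z) = u \<odot>\<^bsub>obj X n\<^esub> (\<one>\<^bsub>R\<^esub> \<odot>\<^bsub>obj X n\<^esub> bd X (n + 1) w)"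
      using fraction_eq_iff[OF assms(1) C(1) zc(1) mod_homD(1)[OF C(4) w(1)] one w(2)] by blast
    have "(u \<otimes>\<^bsub>R\<^esub> t) \<odot>\<^bsub>obj X n\<^esub> z = bd X (n + 1) (u \<odot>\<^bsub>obj X (n + 1)\<^esub> w)"
      using u w(1,2) zc(1) mod_homD(1)[OF C(4) w(1)] mod_homD(3)[OF C(4) _ w(1), of u]
      by (simp add: M.smult_assoc1)
    moreover have "u \<odot>\<^bsub>obj X (n + 1)\<^esub> w \<in> carrier (obj X (n + 1))"
      using module.smult_closed[OF C(1) _ w(1), of u] u(1) by simp
    ultimately have "(u \<otimes>\<^bsub>R\<^esub> t) \<odot>\<^bsub>obj X n\<^esub> z \<in> boundaries X n" unfolding boundaries_def by blast
    then show "\<exists>s \<in> carrier R - p. s \<odot>\<^bsub>obj X n\<^esub> z \<in> boundaries X n" using pm[OF u(1) w(2)] by blast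
  qed
qed

text \<open>
  \<open>R\<^sub>p\<close> is local: a fraction with numerator outside \<open>p\<close> is a unit, so every proper ideal lies in
  \<open>pR\<^sub>p\<close>. That \<open>pR\<^sub>p\<close> itself is proper is seen from the description of its elements as the fractions
  with numerator in \<open>p\<close>.
\<close>

lemma loc_ideal_largest:
  assumes "primeideal p R"
  shows "ideal (loc_ideal R p) (loc_ring R p)"
    and "loc_ideal R p \<noteq> carrier (loc_ring R p)"
    and "\<And>J. ideal J (loc_ring R p) \<Longrightarrow> J \<noteq> carrier (loc_ring R p) \<Longrightarrow> J \<subseteq> loc_ideal R p"
proof -
  interpret p: primeideal p R by fact
  interpret L: cring "loc_ring R p" by (rule loc_ring_cring[OF assms])
  note S = self_mod_module[OF p.is_cring]
  note pm = prime_complement_mult[OF assms] and one = prime_complement_one[OF assms]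
  let ?fr = "fraction R p (self_mod R)"
  have fc: "?fr a s \<in> carrier (loc_ring R p)" if "a \<in> carrier R" "s \<in> carrier R - p" for a s
    using fraction_in_carrier[of a "self_mod R" s R p] that by (simp add: loc_ring_sel)
  have mult: "?fr a s \<otimes>\<^bsub>loc_ring R p\<^esub> ?fr b t = ?fr (a \<otimes>\<^bsub>R\<^esub> b) (s \<otimes>\<^bsub>R\<^esub> t)"
    if "a \<in> carrier R" "s \<in> carrier R - p" "b \<in> carrier R" "t \<in> carrier R - p" for a s b t
    using loc_mod_smult[OF assms S, of a b s t] that by (simp add: loc_ring_sel)
  have rep: "\<exists>a \<in> carrier R. \<exists>s \<in> carrier R - p. X = ?fr a s" if "X \<in> carrier (loc_ring R p)" for X
    using that unfolding loc_ring_sel loc_mod_carrier self_mod_sel .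
  have gen: "(\<lambda>a. ?fr a \<one>\<^bsub>R\<^esub>) ` p \<subseteq> carrier (loc_ring R p)" using fc one p.Icarr by blast
  show idl: "ideal (loc_ideal R p) (loc_ring R p)"
    unfolding loc_ideal_def by (rule L.genideal_ideal[OF gen])
  define P where "P = {?fr a s | a s. a \<in> p \<and> s \<in> carrier R - p}"
  have P_I: "?fr a s \<in> P" if "a \<in> p" "s \<in> carrier R - p" for a s
    unfolding P_def using that by blast
  have p_zero: "\<zero>\<^bsub>R\<^esub> \<in> p"
    and p_add: "\<And>a b. a \<in> p \<Longrightarrow> b \<in> p \<Longrightarrow> a \<oplus>\<^bsub>R\<^esub> b \<in> p"
    using additive_subgroup.zero_closed additive_subgroup.a_closed p.additive_subgroup_axioms
    by blast+
  have Pc: "P \<subseteq> carrier (loc_ring R p)" unfolding P_def using fc p.Icarr by blast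
  have P_mult: "A \<otimes>\<^bsub>loc_ring R p\<^esub> X \<in> P" if AX: "X \<in> P" "A \<in> carrier (loc_ring R p)" for A X
  proof -
    obtain a s where a: "a \<in> carrier R" "s \<in> carrier R - p" "A = ?fr a s" using rep[OF AX(2)] by blast
    obtain x t where x: "x \<in> p" "t \<in> carrier R - p" "X = ?fr x t" using AX(1) unfolding P_def by blast
    have "A \<otimes>\<^bsub>loc_ring R p\<^esub> X = ?fr (a \<otimes>\<^bsub>R\<^esub> x) (s \<otimes>\<^bsub>R\<^esub> t)" using a x mult p.Icarr by simp
    then show ?thesis using P_I[OF p.I_l_closed[OF x(1) a(1)] pm[OF a(2) x(2)]] by simp
  qed
  have "ideal P (loc_ring R p)"
  proof (rule idealI[OF L.ring_axioms])
    show "subgroup P (add_monoid (loc_ring R p))"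
    proof (rule L.add.subgroupI[OF Pc])
      show "P \<noteq> {}" using P_I[OF p_zero one] by blast
      show "\<ominus>\<^bsub>loc_ring R p\<^esub> X \<in> P" if X: "X \<in> P" for X
      proof -
        have Xc: "X \<in> carrier (loc_ring R p)" using X Pc by blast
        have "\<ominus>\<^bsub>loc_ring R p\<^esub> X = (\<ominus>\<^bsub>loc_ring R p\<^esub> \<one>\<^bsub>loc_ring R p\<^esub>) \<otimes>\<^bsub>loc_ring R p\<^esub> X"
          using L.l_minus[OF L.one_closed Xc] Xc by simp
        then show ?thesis using P_mult[OF X] by simp
      qed
      show "X \<oplus>\<^bsub>loc_ring R p\<^esub> Y \<in> P" if XY: "X \<in> P" "Y \<in> P" for X Y
      proof -
        obtain x s where x: "x \<in> p" "s \<in> carrier R - p" "X = ?fr x s" using XY(1) unfolding P_def by blast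
        obtain y t where y: "y \<in> p" "t \<in> carrier R - p" "Y = ?fr y t" using XY(2) unfolding P_def by blast
        have "X \<oplus>\<^bsub>loc_ring R p\<^esub> Y = ?fr (t \<otimes>\<^bsub>R\<^esub> x \<oplus>\<^bsub>R\<^esub> s \<otimes>\<^bsub>R\<^esub> y) (s \<otimes>\<^bsub>R\<^esub> t)"
          using loc_mod_add[OF assms S, of x y s t] x y p.Icarr by (simp add: loc_ring_sel)
        moreover have "t \<otimes>\<^bsub>R\<^esub> x \<oplus>\<^bsub>R\<^esub> s \<otimes>\<^bsub>R\<^esub> y \<in> p"
          using x y p.I_l_closed by (intro p_add) auto
        ultimately show ?thesis using P_I pm[OF x(2) y(2)] by simp
      qed
    qed
    show "X \<otimes>\<^bsub>loc_ring R p\<^esub> A \<in> P" if "X \<in> P" "A \<in> carrier (loc_ring R p)" for X A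
      using P_mult[OF that] L.m_comm[of X A] that Pc by auto
  qed (rule P_mult)
  moreover have "(\<lambda>a. ?fr a \<one>\<^bsub>R\<^esub>) ` p \<subseteq> P" using P_I[OF _ one] by blast
  ultimately have "loc_ideal R p \<subseteq> P" unfolding loc_ideal_def by (rule L.genideal_minimal)
  moreover have "\<one>\<^bsub>loc_ring R p\<^esub> \<notin> P"
  proof
    assume "\<one>\<^bsub>loc_ring R p\<^esub> \<in> P"
    then obtain a s where a: "a \<in> p" "s \<in> carrier R - p" "?fr \<one>\<^bsub>R\<^esub> \<one>\<^bsub>R\<^esub> = ?fr a s"
      unfolding P_def loc_ring_sel by blast
    obtain u where u: "u \<in> carrier R - p" "u \<otimes>\<^bsub>R\<^esub> (s \<otimes>\<^bsub>R\<^esub> \<one>\<^bsub>R\<^esub>) = u \<otimes>\<^bsub>R\<^esub> (\<one>\<^bsub>R\<^esub> \<otimes>\<^bsub>R\<^esub> a)"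
      using fraction_eq_iff[OF assms S, of "\<one>\<^bsub>R\<^esub>" a "\<one>\<^bsub>R\<^esub>" s] a one p.Icarr[OF a(1)]
      by auto
    have "u \<otimes>\<^bsub>R\<^esub> s = u \<otimes>\<^bsub>R\<^esub> a" using u a(2) p.Icarr[OF a(1)] by simp
    then have "u \<otimes>\<^bsub>R\<^esub> s \<in> p" using p.I_l_closed[OF a(1), of u] u(1) by simp
    then show False using pm[OF u(1) a(2)] by blast
  qed
  ultimately show "loc_ideal R p \<noteq> carrier (loc_ring R p)" using L.one_closed by blast
  fix J assume J: "ideal J (loc_ring R p)" "J \<noteq> carrier (loc_ring R p)"
  show "J \<subseteq> loc_ideal R p"
  proof
    fix X assume X: "X \<in> J"
    obtain a s where a: "a \<in> carrier R" "s \<in> carrier R - p" "X = ?fr a s"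
      using rep[OF ideal.Icarr[OF J(1) X]] by blast
    have "a \<in> p"
    proof (rule ccontr)
      assume "a \<notin> p"
      then have a': "a \<in> carrier R - p" using a(1) by blast
      have sc: "s \<in> carrier R" using a(2) by blast
      have "?fr s a \<otimes>\<^bsub>loc_ring R p\<^esub> X = ?fr (s \<otimes>\<^bsub>R\<^esub> a) (a \<otimes>\<^bsub>R\<^esub> s)"
        using mult[OF sc a' a(1,2)] a(3) by simp
      also have "\<dots> = \<one>\<^bsub>loc_ring R p\<^esub>"
        using fraction_expand[OF assms S _ one pm[OF a' a(2)], of "\<one>\<^bsub>R\<^esub>"] a(1) sc p.m_comm[of s a]
        by (simp add: loc_ring_sel)
      finally have "\<one>\<^bsub>loc_ring R p\<^esub> \<in> J" using ideal.I_l_closed[OF J(1) X fc[OF sc a']] by simp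
      then show False using ideal.one_imp_carrier[OF J(1)] J(2) by blast
    qed
    then have "?fr a \<one>\<^bsub>R\<^esub> \<in> loc_ideal R p"
      using L.genideal_self[OF gen] unfolding loc_ideal_def by blast
    then have "?fr \<one>\<^bsub>R\<^esub> s \<otimes>\<^bsub>loc_ring R p\<^esub> ?fr a \<one>\<^bsub>R\<^esub> \<in> loc_ideal R p"
      using ideal.I_l_closed[OF idl] fc[OF p.one_closed a(2)] by blast
    then show "X \<in> loc_ideal R p" using mult[OF p.one_closed a(2) a(1) one] a by simp
  qed
qed

lemma residue_envelope_cogenerating:
  assumes "primeideal p R" "injective_envelope (loc_ring R p) (residue_mod R p) E"
  shows "baer_injective (loc_ring R p) E" and "cogenerating (loc_ring R p) E"
proof -
  note m = loc_ideal_largest[OF assms(1)]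
  note env = injective_envelope_quot[OF loc_ring_cring[OF assms(1)] m(1,2)
      assms(2)[unfolded residue_mod_def]]
  show "baer_injective (loc_ring R p) E" by (rule env(1))
  obtain e where "e \<in> carrier E" "e \<noteq> \<zero>\<^bsub>E\<^esub>" "\<forall>r \<in> loc_ideal R p. r \<odot>\<^bsub>E\<^esub> e = \<zero>\<^bsub>E\<^esub>"
    using env(2) by blast
  then show "cogenerating (loc_ring R p) E" using m(3) unfolding cogenerating_def by blast
qed


section \<open>Support and cosupport\<close>

lemma big_Supp_iff:
  assumes "primeideal p R" "is_complex R X"
  shows "p \<in> big_Supp R X \<longleftrightarrow>
    \<not> (\<forall>n. \<forall>z \<in> cycles X n. \<exists>s \<in> carrier R - p. s \<odot>\<^bsub>obj X n\<^esub> z \<in> boundaries X n)"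
  using derived_iso_zero_iff_exact[OF loc_complex_is_complex[OF assms]]
    exact_loc_complex_iff[OF assms] assms(1)
  by (simp add: big_Supp_def)

lemma matlis_dual_is_complex:
  assumes "is_complex R X" "module R (direct_sum_mod {m. maximalideal m R} E)"
  shows "is_complex R (matlis_dual R E X)"
  unfolding matlis_dual_def by (rule hom_complex_is_complex[OF assms])

text \<open>
  Since \<open>E(k(p))\<close> is an injective cogenerator over \<open>R\<^sub>p\<close>, applying \<open>Hom(-, E(k(p)))\<close> to \<open>D(X)\<^sub>p\<close>
  neither creates nor destroys exactness.
\<close>

lemma big_coSupp_iff_big_Supp_dual:
  assumes "primeideal p R" "is_complex R X"
    and "module R (direct_sum_mod {m. maximalideal m R} E)"
    and "injective_envelope (loc_ring R p) (residue_mod R p) (F p)"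
  shows "p \<in> big_coSupp R E F X \<longleftrightarrow> p \<in> big_Supp R (matlis_dual R E X)"
proof -
  note D = loc_complex_is_complex[OF assms(1) matlis_dual_is_complex[OF assms(2,3)]]
  note F = residue_envelope_cogenerating[OF assms(1,4)]
  have "module (loc_ring R p) (F p)" using F(1) unfolding baer_injective_def by blast
  note C = hom_complex_is_complex[OF D this]
  show ?thesis
    using derived_iso_zero_iff_exact[OF D] derived_iso_zero_iff_exact[OF C]
      exact_hom_complex_iff[OF D F] assms(1)
    by (simp add: big_coSupp_def big_Supp_def colocalization_def)
qed

theorem theoremB:
  fixes R :: "('r, 'z) ring_scheme"
    and M :: "('r, 'm) cplx"
    and p :: "'r set"
    and E :: "'r set \<Rightarrow> ('r, 'e) module"
    and F :: "'r set \<Rightarrow> (('r \<times> 'r) set, 'f) module"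
  assumes "cring R" and "noetherian_ring R"
    and "is_complex R M"
    and "primeideal p R"
    and "\<And>m. maximalideal m R \<Longrightarrow> injective_envelope R (quot_mod (self_mod R) m) (E m)"
    and "\<And>q. primeideal q R \<Longrightarrow> injective_envelope (loc_ring R q) (residue_mod R q) (F q)"
  shows "(p \<in> big_coSupp R E F M \<longleftrightarrow> p \<in> big_Supp R (matlis_dual R E M)) \<and>
    (p \<in> big_Supp R M \<longrightarrow> p \<in> big_coSupp R E F (matlis_dual R E M)) \<and>
    ((\<forall>i. noetherian_mod R (homology M i)) \<longrightarrow>
       p \<in> big_coSupp R E F (matlis_dual R E M) \<longrightarrow> p \<in> big_Supp R M)"
proof -
  let ?I = "direct_sum_mod {m. maximalideal m R} E"
  let ?D = "matlis_dual R E M" and ?DD = "matlis_dual R E (matlis_dual R E M)"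
  have baer: "baer_injective R ?I" and cogen: "cogenerating R ?I"
    using sum_of_envelopes_injective_cogenerator[OF assms(1,2,5)] by blast+
  have I: "module R ?I" using baer unfolding baer_injective_def by blast
  have D: "is_complex R ?D" by (rule matlis_dual_is_complex[OF assms(3) I])
  have DD: "is_complex R ?DD" by (rule matlis_dual_is_complex[OF D I])
  note F = assms(6)[OF assms(4)]
  note coSupp_D = big_coSupp_iff_big_Supp_dual[where F = F, OF assms(4) D I F]
  have DD_eq: "?DD = hom_complex R (hom_complex R M ?I) ?I" by (simp add: matlis_dual_def)
  show ?thesis
  proof (intro conjI impI)
    show "p \<in> big_coSupp R E F M \<longleftrightarrow> p \<in> big_Supp R ?D"
      by (rule big_coSupp_iff_big_Supp_dual[where F = F, OF assms(4,3) I F])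
  next
    assume Supp: "p \<in> big_Supp R M"
    have "p \<in> big_Supp R ?DD"
    proof (rule ccontr)
      assume "p \<notin> big_Supp R ?DD"
      then have loc: "\<exists>s \<in> carrier R - p. s \<odot>\<^bsub>obj ?DD n\<^esub> w \<in> boundaries ?DD n"
        if "w \<in> cycles ?DD n" for n w
        using that unfolding big_Supp_iff[OF assms(4) DD] by blast
      have "\<exists>s \<in> carrier R - p. s \<odot>\<^bsub>obj M n\<^esub> z \<in> boundaries M n" if z: "z \<in> cycles M n" for n z
      proof -
        obtain w where w: "w \<in> cycles ?DD n"
          "\<forall>s \<in> carrier R. s \<odot>\<^bsub>obj ?DD n\<^esub> w \<in> boundaries ?DD n \<longrightarrow> s \<odot>\<^bsub>obj M n\<^esub> z \<in> boundaries M n"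
          using double_dual_evaluation[OF assms(3) baer cogen z] unfolding DD_eq by blast
        then show ?thesis using loc[OF w(1)] by blast
      qed
      then show False using Supp unfolding big_Supp_iff[OF assms(4,3)] by blast
    qed
    then show "p \<in> big_coSupp R E F ?D" by (rule iffD2[OF coSupp_D])
  next
    assume noeth: "\<forall>i. noetherian_mod R (homology M i)" and coSupp: "p \<in> big_coSupp R E F ?D"
    show "p \<in> big_Supp R M"
    proof (rule ccontr)
      assume "p \<notin> big_Supp R M"
      then have loc: "\<exists>s \<in> carrier R - p. s \<odot>\<^bsub>obj M n\<^esub> z \<in> boundaries M n" if "z \<in> cycles M n" for n z
        using that unfolding big_Supp_iff[OF assms(4,3)] by blast
      have "\<exists>s \<in> carrier R - p. s \<odot>\<^bsub>obj ?DD n\<^esub> w \<in> boundaries ?DD n" if w: "w \<in> cycles ?DD n" for n w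
      proof -
        obtain s where s: "s \<in> carrier R - p" "\<forall>z \<in> cycles M n. s \<odot>\<^bsub>obj M n\<^esub> z \<in> boundaries M n"
          using noetherian_uniform_annihilator[OF assms(3,4) noeth[rule_format] loc] by blast
        then have sc: "s \<in> carrier R" by blast
        \<comment> \<open>dualizing preserves the annihilator \<open>s\<close> of homology and moves it from degree \<open>n\<close> to \<open>-n\<close>\<close>
        have "s \<odot>\<^bsub>obj ?D (- n)\<^esub> f \<in> boundaries ?D (- n)" if "f \<in> cycles ?D (- n)" for f
          using hom_complex_annihilator[OF assms(3) baer sc] s(2) that unfolding matlis_dual_def by blast
        then have "s \<odot>\<^bsub>obj ?DD (- (- n))\<^esub> w \<in> boundaries ?DD (- (- n))"
          using hom_complex_annihilator[OF D baer sc, of "- n" w] w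
          unfolding matlis_dual_def[of R E ?D] by simp
        then show ?thesis using s(1) by auto
      qed
      then have "p \<notin> big_Supp R ?DD" unfolding big_Supp_iff[OF assms(4) DD] by blast
      then show False using iffD1[OF coSupp_D coSupp] by blast
    qed
  qed
qed

end
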